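(* Let $\nu\in\mathbb{R}$, let $r\ge 0$ be an integer and let $\beta>0$. If $\beta<\frac{1}{r+1}$, then the system $\mathcal{G}_\nu(h_r,Z_\beta)=\{\Sigma_\nu(M_{\beta n}h_r): n\in\mathbb{Z}\}$, where $h_r$ is the $r$-th Hermite function, is a Gabor frame for $L^2_\nu(0,1)$.
   Context: $L^2_\nu(0,1)$ is the Hilbert space of measurable $f:\mathbb{R}\to\mathbb{C}$ with $f(t+k)=e^{2\pi i k\nu}f(t)$ for all $k\in\mathbb{Z}$ and $\int_0^1|f|^2<\infty$, with inner product $\langle f,g\rangle=\int_0^1 f\bar g\,dt$. $M_\xi f(t)=e^{2\pi i\xi t}f(t)$. The periodization operator is $\Sigma_\nu g(t)=\sum_{k\in\mathbb{Z}}e^{2\pi i k\nu}g(t-k)$. The Hermite functions are $h_r(t)=c_r\,e^{\pi t^2}\frac{d^r}{dt^r}\left(e^{-2\pi t^2}\right)$, with the constant $c_r$ chosen so that $\|h_r\|_{L^2(\mathbb{R})}=1$. $Z_\beta=i\beta\mathbb{Z}$, i.e. the set of points $(0,\beta n)$, $n\in\mathbb{Z}$, in $[0,1)\times\mathbb{R}$. The system $\mathcal{G}_\nu(g,Z_\beta)=\{\Sigma_\nu(M_{\beta n}g):n\in\mathbb{Z}\}$ is a Gabor frame for $L^2_\nu(0,1)$ if there are constants $A,B>0$ such that for all $f\in L^2_\nu(0,1)$, $A\|f\|^2\le\sum_{n\in\mathbb{Z}}|\langle f,\Sigma_\nu(M_{\beta n}g)\rangle_{L^2_\nu(0,1)}|^2\le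 B\|f\|^2$. *)

theory Defs
  imports "HOL-Analysis.Analysis"
begin

text \<open>
  Functions are honest functions rather than classes modulo null sets. This is harmless below:
  norms and inner products depend only on the class, and every class of an almost everywhere
  quasi-periodic function has a representative that is quasi-periodic everywhere.
\<close>

definition L2_nu :: "real \<Rightarrow> (real \<Rightarrow> complex) set" where
  "L2_nu \<nu> = {f. f \<in> borel_measurable lebesgue \<and>
     (\<forall>(k::int) t. f (t + of_int k) = cis (2 * pi * of_int k * \<nu>) * f t) \<and>
     set_integrable lebesgue {0..1} (\<lambda>t. (cmod (f t))\<^sup>2)}"

definition L2_norm_on :: "real set \<Rightarrow> (real \<Rightarrow> complex) \<Rightarrow> real" where
  "L2_norm_on S f = sqrt (LINT t:S|lebesgue. (cmod (f t))\<^sup>2)"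

definition inner_01 :: "(real \<Rightarrow> complex) \<Rightarrow> (real \<Rightarrow> complex) \<Rightarrow> complex" where
  "inner_01 f g = (LINT t:{0..1}|lebesgue. f t * cnj (g t))"

definition modulation :: "real \<Rightarrow> (real \<Rightarrow> complex) \<Rightarrow> real \<Rightarrow> complex" where
  "modulation \<xi> f t = cis (2 * pi * \<xi> * t) * f t"

definition periodization :: "real \<Rightarrow> (real \<Rightarrow> complex) \<Rightarrow> real \<Rightarrow> complex" where
  "periodization \<nu> g t =
     (\<Sum>\<^sub>\<infinity>k\<in>(UNIV::int set). cis (2 * pi * of_int k * \<nu>) * g (t - of_int k))"

definition hermite_unnormalized :: "nat \<Rightarrow> real \<Rightarrow> complex" where
  "hermite_unnormalized r t =
     of_real (exp (pi * t\<^sup>2) * (deriv ^^ r) (\<lambda>s::real. exp (- 2 * pi * s\<^sup>2)) t)"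

text \<open>
  The normalizing constant is only determined up to a unimodular factor; the positive one is
  taken here. The factor affects neither the inner products in absolute value nor the norms.
\<close>

definition hermite_const :: "nat \<Rightarrow> real" where
  "hermite_const r = 1 / L2_norm_on UNIV (hermite_unnormalized r)"

definition hermite_fun :: "nat \<Rightarrow> real \<Rightarrow> complex" where
  "hermite_fun r t = of_real (hermite_const r) * hermite_unnormalized r t"

definition gabor_system :: "real \<Rightarrow> (real \<Rightarrow> complex) \<Rightarrow> real \<Rightarrow> int \<Rightarrow> real \<Rightarrow> complex" where
  "gabor_system \<nu> g \<beta> n = periodization \<nu> (modulation (\<beta> * of_int n) g)"

text \<open>
  Membership of the system in the space and summability are stated explicitly, since integrals
  and infinite sums are total and take the value 0 when they do not exist.
\<close>

definition is_gabor_frame :: "real \<Rightarrow> (real \<Rightarrow> complex) \<Rightarrow> real \<Rightarrow> bool" where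
  "is_gabor_frame \<nu> g \<beta> \<longleftrightarrow>
     (\<forall>n. gabor_system \<nu> g \<beta> n \<in> L2_nu \<nu>) \<and>
     (\<exists>A>0. \<exists>B>0. \<forall>f\<in>L2_nu \<nu>.
        (\<lambda>n. (cmod (inner_01 f (gabor_system \<nu> g \<beta> n)))\<^sup>2) summable_on UNIV \<and>
        A * (L2_norm_on {0..1} f)\<^sup>2
          \<le> (\<Sum>\<^sub>\<infinity>n\<in>UNIV. (cmod (inner_01 f (gabor_system \<nu> g \<beta> n)))\<^sup>2) \<and>
        (\<Sum>\<^sub>\<infinity>n\<in>UNIV. (cmod (inner_01 f (gabor_system \<nu> g \<beta> n)))\<^sup>2)
          \<le> B * (L2_norm_on {0..1} f)\<^sup>2)"

end

theory Submission
  imports Defs "HOL-Probability.Characteristic_Functions" "HOL-Computational_Algebra.Polynomial"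
begin

text \<open>
  An element \<open>f\<close> of the space is expanded in the exponentials \<open>cis (2 * pi * (m + \<nu>) * t)\<close>, with
  coefficients \<open>c m\<close>. Unfolding the periodization, the \<open>m\<close>-th coefficient of the \<open>n\<close>-th member of the
  system is \<open>\<phi> (m + \<nu> - \<beta> * n)\<close>, where \<open>\<phi>\<close> is the Fourier transform of the Hermite function
  (\<open>periodization_fourier_coeff\<close>). By Parseval's identity (\<open>Parseval_fourier_exp\<close>,
  \<open>Parseval_fourier_exp_inner\<close>), the frame inequalities say that the matrix with the entries
  \<open>cnj (\<phi> (m + \<nu> - \<beta> * n))\<close> is bounded, and bounded from below, on square-summable sequences. All that is used
  about \<open>\<phi>\<close> is that it is a polynomial of degree exactly \<open>r\<close> times \<open>exp (- pi * y\<^sup>2)\<close>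
  (\<open>fourier_transform_poly_gaussian\<close>).

  The entries decay away from \<open>m + \<nu> = \<beta> * n\<close>, so the upper bound is Schur's test. For the lower bound,
  a left inverse with the same decay is enough (\<open>Schur_left_inverse_bounds\<close>). It is constructed explicitly in
  \<open>dual_kernel\<close>: for every real \<open>\<tau>\<close>, a sequence \<open>B \<tau>\<close>, decaying away from \<open>\<tau> = \<beta> * n\<close> uniformly
  in \<open>\<tau>\<close>, such that \<open>(\<Sum>n. B \<tau> n * \<phi> (\<tau> + l - \<beta> * n))\<close> is 1 for \<open>l = 0\<close> and 0 for all other
  integers \<open>l\<close>.

  Take \<open>\<tau>\<close> in \<open>[0, \<beta>)\<close> and let \<open>B \<tau> n\<close> be \<open>d n * exp (pi * \<beta>\<^sup>2 * n\<^sup>2 - 2 * pi * \<beta> * n * \<tau>)\<close> up to a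
  constant. Expanding the square in the exponent of \<open>\<phi>\<close> turns the conditions into conditions on the entire function
  \<open>H y = (\<Sum>n. d n * exp (n * y))\<close>. Since the polynomial in \<open>\<phi>\<close> acts as a differential operator of
  order \<open>r\<close>, they hold as soon as \<open>H\<close> has zeros of order at least \<open>r + 1\<close> at the points
  \<open>2 * pi * \<beta> * l\<close> with \<open>l \<noteq> 0\<close> and a zero of order exactly \<open>r\<close> at 0. A theta function without its zero at the origin,
  raised to the power \<open>r + 1\<close> and multiplied by \<open>(1 - exp y) ^ r\<close>, does this. Its
  growth on the real axis is that of \<open>exp ((r + 1) * y\<^sup>2 / (4 * pi * \<beta>))\<close>, up to a factor exponential in
  \<open>\<bar>y\<bar>\<close>; hence \<open>d n\<close> is of size \<open>exp (- pi * \<beta> * n\<^sup>2 / (r + 1))\<close>, up to a factor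
  exponential in \<open>\<bar>n\<bar>\<close>, and this beats
  \<open>exp (pi * \<beta>\<^sup>2 * n\<^sup>2)\<close> precisely when \<open>\<beta> < 1 / (r + 1)\<close>.

  The functions \<open>H\<close> are handled through their coefficient sequences: products are convolutions, and derivatives are
  moments \<open>(\<Sum>n. d n * n ^ k * exp (y * n))\<close>.
\<close>

section \<open>Sums over countable index sets\<close>

lemma has_sum_diff:
  fixes f g :: "'a \<Rightarrow> 'b :: real_normed_vector"
  assumes "(f has_sum a) A" "(g has_sum b) A"
  shows "((\<lambda>x. f x - g x) has_sum (a - b)) A"
proof -
  have "((\<lambda>x. - g x) has_sum (- b)) A" using assms(2) by (simp add: has_sum_uminus)
  from has_sum_add[OF assms(1) this] show ?thesis by simp
qed

lemma has_sum_finite_sum: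
  fixes f :: "'i \<Rightarrow> 'a \<Rightarrow> 'b :: topological_comm_monoid_add"
  assumes "\<And>i. i \<in> I \<Longrightarrow> (f i has_sum s i) A" "finite I"
  shows "((\<lambda>x. \<Sum>i\<in>I. f i x) has_sum (\<Sum>i\<in>I. s i)) A"
  using assms(2,1) by (induction I) (auto intro!: has_sum_add)

lemma summable_on_bound_real:
  fixes f :: "'a \<Rightarrow> real"
  assumes "g summable_on A" "\<And>x. x \<in> A \<Longrightarrow> \<bar>f x\<bar> \<le> g x"
  shows "f summable_on A"
proof -
  have "(\<lambda>x. \<bar>f x\<bar>) summable_on A"
    by (rule summable_on_comparison_test[OF assms(1)]) (use assms in auto)
  then show ?thesis using summable_on_iff_abs_summable_on_real by fastforce
qed

lemma has_sum_product_real: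
  fixes f g :: "_ \<Rightarrow> real"
  assumes f: "(f has_sum A) S" and g: "(g has_sum B) T"
  shows "((\<lambda>(a,b). f a * g b) has_sum A * B) (S \<times> T)"
proof (rule has_sum_SigmaI)
  show "((\<lambda>b. case (a, b) of (a, b) \<Rightarrow> f a * g b) has_sum f a * B) T" for a
    using has_sum_cmult_right[OF g] by simp
  show "((\<lambda>a. f a * B) has_sum A * B) S" using has_sum_cmult_left[OF f] by simp
  have fa: "(\<lambda>a. \<bar>f a\<bar>) summable_on S" 
    using f summable_on_iff_abs_summable_on_real[of f S] by (auto simp: summable_on_def)
  have ga: "(\<lambda>a. \<bar>g a\<bar>) summable_on T" 
    using g summable_on_iff_abs_summable_on_real[of g T] by (auto simp: summable_on_def)
  have "Infinite_Sum.abs_summable_on (\<lambda>(a,b). f a * g b) (S \<times> T)"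
    unfolding Infinite_Sum.abs_summable_on_Sigma_iff
    by (auto simp: abs_mult infsum_cmult_right' infsum_nonneg intro!: summable_on_cmult_right summable_on_cmult_left ga fa)
  then show "(\<lambda>(a,b). f a * g b) summable_on S \<times> T"
    by (rule abs_summable_summable)
qed

lemma has_sum_int_of_nat:
  assumes "(f has_sum S) (UNIV::nat set)"
  shows "((\<lambda>k::int. if k \<ge> 0 then f (nat k) else 0) has_sum S) UNIV"
proof -
  have "((\<lambda>k::int. if k \<ge> 0 then f (nat k) else 0) has_sum S) {0..}"
    using assms by (subst has_sum_reindex_bij_witness[where j = nat and i = int and T = UNIV and h = f]) auto
  then show ?thesis by (subst has_sum_cong_neutral[where T = "{0..}"]) auto
qed

lemma has_sum_int_LIMSEQ:
  assumes "(f has_sum S) (UNIV :: int set)"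
  shows "(\<lambda>N. \<Sum>k\<in>{-int N..int N}. f k) \<longlonglongrightarrow> S"
proof -
  have "filterlim (\<lambda>N. {-int N..int N}) (finite_subsets_at_top UNIV) sequentially"
    unfolding filterlim_finite_subsets_at_top
  proof safe
    fix X :: "int set" assume X: "finite X"
    define M where "M = Max (insert 0 (abs ` X))"
    have M: "\<bar>x\<bar> \<le> M" if "x \<in> X" for x unfolding M_def using X that by (intro Max_ge) auto
    show "eventually (\<lambda>N. finite {-int N..int N} \<and> X \<subseteq> {-int N..int N} \<and> {-int N..int N} \<subseteq> UNIV) sequentially"
      using eventually_ge_at_top[of "nat M"] by eventually_elim (use M in fastforce)
  qed
  with assms show ?thesis unfolding has_sum_def by (rule filterlim_compose)
qed

section \<open>Schur's test\<close>

text \<open>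
  A matrix whose entries are dominated by a nonnegative kernel with bounded row and column sums
  acts boundedly on square-summable sequences: Cauchy-Schwarz within a row, weighted by the kernel,
  uses the row sums, and summing the result over the rows uses the column sums.
\<close>

lemma Schur_test:
  fixes T :: "'i \<Rightarrow> 'j \<Rightarrow> complex" and K :: "'i \<Rightarrow> 'j \<Rightarrow> real" and x :: "'j \<Rightarrow> complex"
  assumes T: "\<And>i j. cmod (T i j) \<le> K i j"
    and row: "\<And>i. (\<lambda>j. K i j) summable_on UNIV" "\<And>i. (\<Sum>\<^sub>\<infinity>j. K i j) \<le> A"
    and col: "\<And>j. (\<lambda>i. K i j) summable_on UNIV" "\<And>j. (\<Sum>\<^sub>\<infinity>i. K i j) \<le> B"
    and x: "(\<lambda>j. (cmod (x j))\<^sup>2) summable_on UNIV"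
  shows "(\<lambda>j. T i j * x j) summable_on UNIV"
    and "(\<lambda>i. (cmod (\<Sum>\<^sub>\<infinity>j. T i j * x j))\<^sup>2) summable_on UNIV"
    and "(\<Sum>\<^sub>\<infinity>i. (cmod (\<Sum>\<^sub>\<infinity>j. T i j * x j))\<^sup>2) \<le> A * B * (\<Sum>\<^sub>\<infinity>j. (cmod (x j))\<^sup>2)"
proof -
  have K: "0 \<le> K i j" for i j using T[of i j] norm_ge_zero order_trans by blast
  have KB: "K i j \<le> B" for i j
    using finite_sum_le_infsum[OF col(1)[of j], of "{i}"] col(2)[of j] K by simp
  have sumB: "sum (\<lambda>i. K i j) I \<le> B" if "finite I" for I j
    using finite_sum_le_infsum[OF col(1)[of j], of I] col(2)[of j] K that by simp
  have sumA: "sum (\<lambda>j. K i j) J \<le> A" if "finite J" for i J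
    using finite_sum_le_infsum[OF row(1)[of i], of J] row(2)[of i] K that by simp
  have A: "0 \<le> A" using sumA[of "{}"] by simp
  have B: "0 \<le> B" using sumB[of "{}"] by simp
  have Z: "(\<lambda>j. K i j * (cmod (x j))\<^sup>2) summable_on UNIV" for i
    by (rule summable_on_comparison_test[OF summable_on_cmult_right[OF x, of B]]) (use K KB in \<open>auto intro: mult_right_mono\<close>)
  have abs: "(\<lambda>j. cmod (T i j * x j)) summable_on UNIV" for i
  proof (rule summable_on_comparison_test[OF summable_on_add[OF row(1)[of i] Z[of i]]])
    fix j
    have "2 * cmod (x j) \<le> (cmod (x j))\<^sup>2 + 1" using sum_squares_bound[of "cmod (x j)" 1] by simp
    then have "cmod (x j) \<le> 1 + (cmod (x j))\<^sup>2" using norm_ge_zero[of "x j"] by linarith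
    then have "cmod (T i j) * cmod (x j) \<le> K i j * (1 + (cmod (x j))\<^sup>2)"
      by (intro mult_mono T K) auto
    then show "cmod (T i j * x j) \<le> K i j + K i j * (cmod (x j))\<^sup>2" by (simp add: norm_mult algebra_simps)
  qed simp
  then show s: "(\<lambda>j. T i j * x j) summable_on UNIV" for i by (rule abs_summable_summable)
  define Y where "Y i = (\<Sum>\<^sub>\<infinity>j. K i j * (cmod (x j))\<^sup>2)" for i
  have y: "(cmod (\<Sum>\<^sub>\<infinity>j. T i j * x j))\<^sup>2 \<le> A * Y i" for i
  proof -
    have "cmod (\<Sum>\<^sub>\<infinity>j. T i j * x j) \<le> (\<Sum>\<^sub>\<infinity>j. cmod (T i j * x j))"
      by (rule norm_infsum_bound[OF abs])
    also have "\<dots> \<le> sqrt (A * Y i)"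
    proof (rule infsum_le_finite_sums[OF abs])
      fix J :: "'j set" assume J: "finite J"
      \<comment> \<open>Cauchy-Schwarz, after splitting the weight \<open>K i j\<close> evenly between the two factors.\<close>
      have "(\<Sum>j\<in>J. cmod (T i j * x j)) \<le> (\<Sum>j\<in>J. sqrt (K i j) * (sqrt (K i j) * cmod (x j)))"
        using T K by (intro sum_mono) (auto simp: norm_mult mult.assoc[symmetric] intro: mult_right_mono)
      also have "\<dots> \<le> sqrt (A * Y i)"
      proof (rule real_le_rsqrt)
        have "(\<Sum>j\<in>J. sqrt (K i j) * (sqrt (K i j) * cmod (x j)))\<^sup>2 \<le> (\<Sum>j\<in>J. (sqrt (K i j))\<^sup>2) * (\<Sum>j\<in>J. (sqrt (K i j) * cmod (x j))\<^sup>2)"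
          by (rule Cauchy_Schwarz_ineq_sum)
        also have "\<dots> = (\<Sum>j\<in>J. K i j) * (\<Sum>j\<in>J. K i j * (cmod (x j))\<^sup>2)"
          using K by (simp add: power_mult_distrib)
        also have "\<dots> \<le> A * Y i"
          unfolding Y_def using K J A by (intro mult_mono sumA finite_sum_le_infsum[OF Z] sum_nonneg) auto
        finally show "(\<Sum>j\<in>J. sqrt (K i j) * (sqrt (K i j) * cmod (x j)))\<^sup>2 \<le> A * Y i" .
      qed
      finally show "(\<Sum>j\<in>J. cmod (T i j * x j)) \<le> sqrt (A * Y i)" .
    qed
    finally have "(cmod (\<Sum>\<^sub>\<infinity>j. T i j * x j))\<^sup>2 \<le> (sqrt (A * Y i))\<^sup>2" by (rule power_mono) simp
    moreover have "0 \<le> Y i" unfolding Y_def using K by (intro infsum_nonneg) auto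
    ultimately show ?thesis using A by simp
  qed
  have fin: "(\<Sum>i\<in>I. (cmod (\<Sum>\<^sub>\<infinity>j. T i j * x j))\<^sup>2) \<le> A * B * (\<Sum>\<^sub>\<infinity>j. (cmod (x j))\<^sup>2)" if I: "finite I" for I
  proof -
    have "(\<Sum>i\<in>I. (cmod (\<Sum>\<^sub>\<infinity>j. T i j * x j))\<^sup>2) \<le> A * (\<Sum>i\<in>I. Y i)"
      unfolding sum_distrib_left by (intro sum_mono y)
    also have "(\<Sum>i\<in>I. Y i) \<le> B * (\<Sum>\<^sub>\<infinity>j. (cmod (x j))\<^sup>2)"
    proof (rule has_sum_mono)
      show "((\<lambda>j. \<Sum>i\<in>I. K i j * (cmod (x j))\<^sup>2) has_sum (\<Sum>i\<in>I. Y i)) UNIV"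
        unfolding Y_def using Z I by (intro has_sum_finite_sum) auto
      show "((\<lambda>j. B * (cmod (x j))\<^sup>2) has_sum B * (\<Sum>\<^sub>\<infinity>j. (cmod (x j))\<^sup>2)) UNIV"
        using x by (intro has_sum_cmult_right) auto
      show "(\<Sum>i\<in>I. K i j * (cmod (x j))\<^sup>2) \<le> B * (cmod (x j))\<^sup>2" for j
        unfolding sum_distrib_right[symmetric] by (intro mult_right_mono sumB I) auto
    qed
    then have "A * (\<Sum>i\<in>I. Y i) \<le> A * (B * (\<Sum>\<^sub>\<infinity>j. (cmod (x j))\<^sup>2))" using A by (rule mult_left_mono)
    finally show ?thesis by (simp add: mult.assoc)
  qed
  show sy: "(\<lambda>i. (cmod (\<Sum>\<^sub>\<infinity>j. T i j * x j))\<^sup>2) summable_on UNIV"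
    by (rule nonneg_bdd_above_summable_on) (auto intro!: bdd_aboveI2 fin)
  show "(\<Sum>\<^sub>\<infinity>i. (cmod (\<Sum>\<^sub>\<infinity>j. T i j * x j))\<^sup>2) \<le> A * B * (\<Sum>\<^sub>\<infinity>j. (cmod (x j))\<^sup>2)"
    by (rule infsum_le_finite_sums[OF sy]) (auto intro: fin)
qed

text \<open>
  A matrix that has a left inverse is bounded from below by the reciprocal of the norm of that
  left inverse. The common majorant \<open>W\<close> serves twice: for Schur's test on both matrices, and to
  justify \<open>T' (T c) = (T' T) c\<close>.
\<close>

lemma Schur_left_inverse_bounds:
  fixes T :: "'i \<Rightarrow> 'j \<Rightarrow> complex" and T' :: "'j \<Rightarrow> 'i \<Rightarrow> complex" and W :: "'j \<Rightarrow> 'i \<Rightarrow> real"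
  assumes W: "\<And>m n. 0 \<le> W m n"
    and S: "\<And>m. (\<lambda>n. W m n) summable_on UNIV" "\<And>m. (\<Sum>\<^sub>\<infinity>n. W m n) \<le> S"
    and S': "\<And>n. (\<lambda>m. W m n) summable_on UNIV" "\<And>n. (\<Sum>\<^sub>\<infinity>m. W m n) \<le> S'"
    and T: "0 \<le> C" "\<And>n m. cmod (T n m) \<le> C * W m n"
    and T': "0 \<le> D" "\<And>m n. cmod (T' m n) \<le> D * W m n"
    and inv: "\<And>m j. ((\<lambda>n. T' m n * T n j) has_sum (if m = j then 1 else 0)) UNIV"
    and c: "(\<lambda>m. (cmod (c m))\<^sup>2) summable_on UNIV"
    and F: "\<And>n. F n = (\<Sum>\<^sub>\<infinity>m. T n m * c m)"
  shows "(\<lambda>n. (cmod (F n))\<^sup>2) summable_on UNIV"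
    and "(\<Sum>\<^sub>\<infinity>n. (cmod (F n))\<^sup>2) \<le> (C * S') * (C * S) * (\<Sum>\<^sub>\<infinity>m. (cmod (c m))\<^sup>2)"
    and "(\<Sum>\<^sub>\<infinity>m. (cmod (c m))\<^sup>2) \<le> (D * S) * (D * S') * (\<Sum>\<^sub>\<infinity>n. (cmod (F n))\<^sup>2)"
proof -
  have scaled: "(\<lambda>i. k * g i) summable_on UNIV" "(\<Sum>\<^sub>\<infinity>i. k * g i) \<le> k * R" if "g summable_on UNIV" "infsum g UNIV \<le> R" "0 \<le> k"
    for k R and g :: "'k \<Rightarrow> real"
    using that by (auto intro: summable_on_cmult_right mult_left_mono simp: infsum_cmult_right')
  note up = Schur_test[where T = T and K = "\<lambda>n m. C * W m n" and x = c, OF T(2) scaled(1)[OF S' T(1)] scaled(2)[OF S' T(1)] scaled(1)[OF S T(1)] scaled(2)[OF S T(1)] c, folded F]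
  show sF: "(\<lambda>n. (cmod (F n))\<^sup>2) summable_on UNIV"
    and "(\<Sum>\<^sub>\<infinity>n. (cmod (F n))\<^sup>2) \<le> (C * S') * (C * S) * (\<Sum>\<^sub>\<infinity>m. (cmod (c m))\<^sup>2)"
    by (fact up(2), fact up(3))
  have cF: "(\<Sum>\<^sub>\<infinity>n. T' m n * F n) = c m" for m
  proof -
    define M where "M = sqrt (\<Sum>\<^sub>\<infinity>m. (cmod (c m))\<^sup>2)"
    have M: "cmod (c j) \<le> M" for j
      unfolding M_def using finite_sum_le_infsum[OF c, of "{j}"] by (intro real_le_rsqrt) auto
    have M0: "0 \<le> M" unfolding M_def by (simp add: infsum_nonneg)
    \<comment> \<open>A summable majorant of the double series, which permits exchanging the two sums.\<close>
    have K: "(\<lambda>(n,j). (D * W m n) * ((C * M) * W j n)) summable_on UNIV \<times> UNIV"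
    proof (rule summable_on_SigmaI)
      show "((\<lambda>j. case (n, j) of (n, j) \<Rightarrow> (D * W m n) * ((C * M) * W j n)) has_sum (D * W m n) * ((C * M) * (\<Sum>\<^sub>\<infinity>j. W j n))) UNIV" for n
        by (simp, intro has_sum_cmult_right has_sum_infsum S')
      show "(\<lambda>n. (D * W m n) * ((C * M) * (\<Sum>\<^sub>\<infinity>j. W j n))) summable_on UNIV"
      proof (rule summable_on_comparison_test[OF summable_on_cmult_right[OF S(1)[of m], of "D * (C * M * S')"]])
        fix n
        have n0: "0 \<le> (\<Sum>\<^sub>\<infinity>j. W j n)" by (intro infsum_nonneg W)
        show "0 \<le> (D * W m n) * ((C * M) * (\<Sum>\<^sub>\<infinity>j. W j n))"
          using T'(1) T(1) M0 n0 W by (intro mult_nonneg_nonneg) auto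
        have "(D * W m n) * ((C * M) * (\<Sum>\<^sub>\<infinity>j. W j n)) \<le> (D * W m n) * ((C * M) * S')"
          using T'(1) T(1) M0 S'(2) W by (intro mult_left_mono mult_nonneg_nonneg) auto
        then show "(D * W m n) * ((C * M) * (\<Sum>\<^sub>\<infinity>j. W j n)) \<le> D * (C * M * S') * W m n"
          by (simp add: mult_ac)
      qed
      show "0 \<le> (case (n, j) of (n, j) \<Rightarrow> (D * W m n) * ((C * M) * W j n))" for n j
        using T'(1) T(1) M0 W by simp
    qed
    have "Infinite_Sum.abs_summable_on (\<lambda>(n,j). T' m n * (T n j * c j)) (UNIV \<times> UNIV)"
    proof (rule summable_on_comparison_test[OF K])
      fix p :: "'i \<times> 'j"
      obtain n j where p: "p = (n, j)" by (cases p)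
      have "cmod (T n j * c j) \<le> (C * W j n) * M"
        unfolding norm_mult by (intro mult_mono T M mult_nonneg_nonneg W norm_ge_zero)
      then have "cmod (T' m n * (T n j * c j)) \<le> (D * W m n) * ((C * W j n) * M)"
        unfolding norm_mult[of "T' m n"] by (intro mult_mono T' mult_nonneg_nonneg W norm_ge_zero)
      then show "norm (case p of (n, j) \<Rightarrow> T' m n * (T n j * c j)) \<le> (case p of (n, j) \<Rightarrow> (D * W m n) * ((C * M) * W j n))"
        by (simp add: p mult_ac)
    qed simp
    then have s: "(\<lambda>(n,j). T' m n * (T n j * c j)) summable_on UNIV \<times> UNIV" by (rule abs_summable_summable)
    have "(\<Sum>\<^sub>\<infinity>n. T' m n * F n) = (\<Sum>\<^sub>\<infinity>n. \<Sum>\<^sub>\<infinity>j. T' m n * (T n j * c j))"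
      unfolding F infsum_cmult_right' ..
    also have "\<dots> = (\<Sum>\<^sub>\<infinity>j. \<Sum>\<^sub>\<infinity>n. T' m n * (T n j * c j))" by (rule infsum_swap_banach[OF s])
    also have "\<dots> = (\<Sum>\<^sub>\<infinity>j. (if m = j then 1 else 0) * c j)"
      unfolding mult.assoc[symmetric] infsum_cmult_left' infsumI[OF inv] ..
    also have "\<dots> = c m"
      by (rule infsumI, rule has_sum_finite_neutralI[of "{m}"]) auto
    finally show ?thesis .
  qed
  show "(\<Sum>\<^sub>\<infinity>m. (cmod (c m))\<^sup>2) \<le> (D * S) * (D * S') * (\<Sum>\<^sub>\<infinity>n. (cmod (F n))\<^sup>2)"
    using Schur_test(3)[where T = T' and K = "\<lambda>m n. D * W m n" and x = F, OF T'(2) scaled(1)[OF S T'(1)] scaled(2)[OF S T'(1)] scaled(1)[OF S' T'(1)] scaled(2)[OF S' T'(1)] sF]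
    unfolding cF .
qed

lemma summable_exp_neg_abs_int:
  assumes "b > 0" shows "(\<lambda>n::int. exp (- b * \<bar>of_int n\<bar> :: real)) summable_on UNIV"
proof -
  have g: "((\<lambda>n. exp (- b) ^ n) has_sum (1 / (1 - exp (- b)))) (UNIV :: nat set)"
    using assms by (intro sums_nonneg_imp_has_sum geometric_sums) auto
  have 1: "((\<lambda>k::int. if k \<ge> 0 then exp (- b) ^ nat k else 0) has_sum (1 / (1 - exp (- b)))) UNIV"
    by (rule has_sum_int_of_nat[OF g])
  then have 2: "((\<lambda>k::int. if - k \<ge> 0 then exp (- b) ^ nat (- k) else 0) has_sum (1 / (1 - exp (- b)))) UNIV"
    by (subst has_sum_reindex_bij_witness[where j = uminus and i = uminus and T = UNIV and h = "\<lambda>k::int. if k \<ge> 0 then exp (- b) ^ nat k else 0"]) auto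
  show ?thesis
  proof (rule summable_on_comparison_test[OF has_sum_imp_summable[OF has_sum_add[OF 1 2]]])
    fix n :: int
    have "exp (- b * \<bar>of_int n\<bar>) = exp (- b) ^ nat \<bar>n\<bar>" by (simp add: mult.commute flip: exp_of_nat_mult)
    then show "exp (- b * \<bar>of_int n\<bar>) \<le> (if n \<ge> 0 then exp (- b) ^ nat n else 0) + (if - n \<ge> 0 then exp (- b) ^ nat (- n) else 0)"
      by (cases "n \<ge> 0") auto
  qed simp
qed

text \<open>
  The uniformity in the shift \<open>x\<close> matters: it bounds all row and column sums at once.
\<close>

lemma lattice_exp_sum:
  assumes b: "b > 0"
  obtains C where "0 < C" "\<And>x::real. (\<lambda>n::int. exp (- \<bar>x - b * of_int n\<bar>)) summable_on UNIV"
    "\<And>x::real. (\<Sum>\<^sub>\<infinity>n::int. exp (- \<bar>x - b * of_int n\<bar>)) \<le> C"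
proof -
  define S where "S = (\<Sum>\<^sub>\<infinity>n::int. exp (- b * \<bar>of_int n\<bar> :: real))"
  have S: "((\<lambda>n::int. exp (- b * \<bar>of_int n\<bar> :: real)) has_sum S) UNIV"
    unfolding S_def by (rule has_sum_infsum[OF summable_exp_neg_abs_int[OF b]])
  have S0: "0 \<le> S" unfolding S_def by (intro infsum_nonneg) auto
  have sh: "((\<lambda>n::int. exp b * exp (- b * \<bar>of_int (n - k)\<bar> :: real)) has_sum exp b * S) UNIV" for k
  proof (rule has_sum_cmult_right)
    show "((\<lambda>n::int. exp (- b * \<bar>of_int (n - k)\<bar> :: real)) has_sum S) UNIV"
      using S by (subst has_sum_reindex_bij_witness[where j = "\<lambda>n. n - k" and i = "\<lambda>n. n + k" and T = UNIV and h = "\<lambda>n. exp (- b * \<bar>of_int n\<bar> :: real)"]) auto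
  qed
  have le: "exp (- \<bar>x - b * of_int n\<bar>) \<le> exp b * exp (- b * \<bar>of_int (n - \<lfloor>x / b\<rfloor>)\<bar>)" for x and n :: int
  proof -
    \<comment> \<open>Replacing \<open>x / b\<close> by its floor changes the distance to a lattice point by at most \<open>b\<close>.\<close>
    define k where "k = \<lfloor>x / b\<rfloor>"
    have "of_int k \<le> x / b" "x / b < of_int k + 1" by (auto simp: k_def)
    then have "b * of_int k \<le> x" "x < b * of_int k + b" using b by (auto simp: field_simps)
    then have "\<bar>b * of_int n - b * of_int k\<bar> \<le> \<bar>x - b * of_int n\<bar> + b" by linarith
    moreover have "\<bar>b * of_int n - b * of_int k\<bar> = b * \<bar>of_int (n - k)\<bar>"
      using b by (simp add: abs_mult flip: right_diff_distrib)
    ultimately show ?thesis by (simp add: k_def flip: exp_add)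
  qed
  have s: "(\<lambda>n::int. exp (- \<bar>x - b * of_int n\<bar>)) summable_on UNIV" for x
    by (rule summable_on_comparison_test[OF has_sum_imp_summable[OF sh[of "\<lfloor>x / b\<rfloor>"]]]) (use le in auto)
  show ?thesis
  proof
    show "(\<Sum>\<^sub>\<infinity>n::int. exp (- \<bar>x - b * of_int n\<bar>)) \<le> exp b * S + 1" for x
    proof -
      have "(\<Sum>\<^sub>\<infinity>n::int. exp (- \<bar>x - b * of_int n\<bar>)) \<le> exp b * S"
        by (rule has_sum_mono[OF has_sum_infsum[OF s] sh[of "\<lfloor>x / b\<rfloor>"]]) (use le in auto)
      then show ?thesis by simp
    qed
    show "0 < exp b * S + 1" using S0 by (simp add: add_nonneg_pos)
  qed (rule s)
qed

section \<open>Entire periodic functions through their coefficients\<close>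

text \<open>
  The coefficient sequences of functions \<open>H y = (\<Sum>n. d n * exp (y * n))\<close> that are entire in
  \<open>y\<close>, that is, of Laurent series in \<open>exp y\<close> converging off the origin.
\<close>

definition exp_summable :: "(int \<Rightarrow> real) \<Rightarrow> bool" where
  "exp_summable d \<longleftrightarrow> (\<forall>x. (\<lambda>n. d n * exp (x * of_int n)) summable_on UNIV)"

text \<open>
  The \<open>k\<close>-th derivative at \<open>y\<close> of the function with coefficients \<open>d\<close>.
\<close>

definition exp_moment :: "(int \<Rightarrow> real) \<Rightarrow> nat \<Rightarrow> real \<Rightarrow> real" where
  "exp_moment d k y = (\<Sum>\<^sub>\<infinity>n. d n * of_int n ^ k * exp (y * of_int n))"

text \<open>
  Multiplication of functions, seen on coefficients.
\<close>

definition int_conv :: "(int \<Rightarrow> real) \<Rightarrow> (int \<Rightarrow> real) \<Rightarrow> int \<Rightarrow> real" where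
  "int_conv d e n = (\<Sum>\<^sub>\<infinity>a. d a * e (n - a))"

lemma power_le_fact_exp: 
  fixes x :: real assumes "x \<ge> 0" shows "x ^ k \<le> fact k * exp x"
proof -
  have s: "(\<lambda>n. x^n /\<^sub>R fact n) sums exp x" by (rule exp_converges)
  then have "sum (\<lambda>n. x^n /\<^sub>R fact n) {k} \<le> exp x"
    unfolding sums_unique[OF s] using assms by (intro sum_le_suminf) (auto simp: sums_iff)
  then show ?thesis by (simp add: field_simps)
qed

lemma exp_summable_abs: "exp_summable d \<Longrightarrow> (\<lambda>n. \<bar>d n\<bar> * exp (x * of_int n)) summable_on UNIV"
  unfolding exp_summable_def
  by (subst (asm) summable_on_iff_abs_summable_on_real) (simp add: abs_mult)

lemma exp_summable_absI: 
  assumes "\<And>x. (\<lambda>n. \<bar>d n\<bar> * exp (x * of_int n)) summable_on UNIV" shows "exp_summable d"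
  unfolding exp_summable_def
  by (subst summable_on_iff_abs_summable_on_real) (use assms in \<open>simp add: abs_mult\<close>)

lemma exp_summable_poly:
  assumes "exp_summable d"
  shows "(\<lambda>n. d n * of_int n ^ k * exp (y * of_int n)) summable_on UNIV"
proof (rule summable_on_bound_real)
  show "(\<lambda>n. fact k * (\<bar>d n\<bar> * exp ((y+1) * of_int n) + \<bar>d n\<bar> * exp ((y-1) * of_int n))) summable_on UNIV"
    by (intro summable_on_cmult_right summable_on_add exp_summable_abs assms)
  fix n :: int
  have "\<bar>of_int n\<bar>^k \<le> fact k * exp \<bar>of_int n :: real\<bar>" by (rule power_le_fact_exp) simp
  also have "\<dots> \<le> fact k * (exp (of_int n) + exp (- of_int n))"
    by (rule mult_left_mono) (auto simp: abs_if add_pos_pos less_imp_le)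
  finally have *: "\<bar>of_int n\<bar>^k \<le> fact k * (exp (of_int n) + exp (- of_int n :: real))" .
  have "\<bar>d n * of_int n ^ k * exp (y * of_int n)\<bar> = (\<bar>d n\<bar> * exp (y * of_int n)) * \<bar>of_int n\<bar>^k"
    by (simp add: abs_mult power_abs)
  also have "\<dots> \<le> (\<bar>d n\<bar> * exp (y * of_int n)) * (fact k * (exp (of_int n) + exp (- of_int n :: real)))"
    by (rule mult_left_mono[OF *]) simp
  also have "\<dots> = fact k * (\<bar>d n\<bar> * exp ((y+1) * of_int n) + \<bar>d n\<bar> * exp ((y-1) * of_int n))"
    by (simp add: algebra_simps exp_add exp_diff exp_minus field_simps)
  finally show "\<bar>d n * of_int n ^ k * exp (y * of_int n)\<bar> \<le> fact k * (\<bar>d n\<bar> * exp ((y+1) * of_int n) + \<bar>d n\<bar> * exp ((y-1) * of_int n))" .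
qed

lemma exp_moment_has_sum:
  assumes "exp_summable d"
  shows "((\<lambda>n. d n * of_int n ^ k * exp (y * of_int n)) has_sum exp_moment d k y) UNIV"
  unfolding exp_moment_def using exp_summable_poly[OF assms] by simp

lemma int_conv_has_sum:
  assumes "exp_summable d" "exp_summable e"
  shows "((\<lambda>a. d a * e (n - a)) has_sum int_conv d e n) UNIV"
proof -
  have "((\<lambda>a. d a) has_sum exp_moment d 0 0) UNIV" "((\<lambda>a. e a) has_sum exp_moment e 0 0) UNIV"
    using exp_moment_has_sum[OF assms(1), of 0 0] exp_moment_has_sum[OF assms(2), of 0 0] by auto
  from has_sum_product_real[OF this] have "(\<lambda>(a,b). d a * e b) summable_on UNIV \<times> UNIV"
    by (auto simp: summable_on_def)
  then have "(\<lambda>(n,a). d a * e (n - a)) summable_on (UNIV \<times> UNIV)"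
    by (subst summable_on_reindex_bij_witness[where j = "\<lambda>(n,a). (a, n-a)" and i = "\<lambda>(a,b). (a+b, a)" and T = "UNIV \<times> UNIV" and h = "\<lambda>(a,b). d a * e b"]) auto
  then have "(\<lambda>a. d a * e (n - a)) summable_on UNIV"
    by (rule summable_on_SigmaD1) auto
  then show ?thesis unfolding int_conv_def by simp
qed

text \<open>
  The Leibniz rule for the \<open>N\<close>-th derivative of a product, obtained from the binomial theorem
  inside an absolutely convergent double series.
\<close>

lemma int_conv_moment_has_sum:
  assumes "exp_summable d" "exp_summable e"
  shows "((\<lambda>n. int_conv d e n * of_int n ^ N * exp (y * of_int n)) has_sum
    (\<Sum>i\<le>N. of_nat (N choose i) * (exp_moment d i y * exp_moment e (N - i) y))) UNIV"
proof -
  \<comment> \<open>Expand \<open>(a + b) ^ N\<close> binomially, then collect the pairs \<open>(a, b)\<close> with the same \<open>n = a + b\<close>.\<close>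
  let ?f = "\<lambda>(a,b). d a * e b * of_int (a + b) ^ N * exp (y * of_int (a + b))"
  have "((\<lambda>p. \<Sum>i\<le>N. of_nat (N choose i) * (case p of (a,b) \<Rightarrow> (d a * of_int a ^ i * exp (y * of_int a)) * (e b * of_int b ^ (N-i) * exp (y * of_int b)))) has_sum
    (\<Sum>i\<le>N. of_nat (N choose i) * (exp_moment d i y * exp_moment e (N - i) y))) (UNIV \<times> UNIV)"
    by (intro has_sum_finite_sum has_sum_cmult_right has_sum_product_real exp_moment_has_sum assms finite_atMost)
  also have "(\<lambda>p. \<Sum>i\<le>N. of_nat (N choose i) * (case p of (a,b) \<Rightarrow> (d a * of_int a ^ i * exp (y * of_int a)) * (e b * of_int b ^ (N-i) * exp (y * of_int b)))) = ?f"
    by (auto simp: fun_eq_iff binomial_ring sum_distrib_left sum_distrib_right algebra_simps exp_add intro!: sum.cong)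
  finally have "(?f has_sum (\<Sum>i\<le>N. of_nat (N choose i) * (exp_moment d i y * exp_moment e (N - i) y))) (UNIV \<times> UNIV)" .
  then have "((\<lambda>(n,a). (d a * e (n - a)) * (of_int n ^ N * exp (y * of_int n))) has_sum (\<Sum>i\<le>N. of_nat (N choose i) * (exp_moment d i y * exp_moment e (N - i) y))) (UNIV \<times> UNIV)"
    by (subst has_sum_reindex_bij_witness[where j = "\<lambda>(n,a). (a, n-a)" and i = "\<lambda>(a,b). (a+b, a)" and T = "UNIV \<times> UNIV" and h = ?f]) auto
  then show ?thesis
    apply (rule has_sum_SigmaD)
    using has_sum_cmult_left[OF int_conv_has_sum[OF assms]] by (auto simp: mult.assoc)
qed

lemma exp_summable_int_conv:
  assumes "exp_summable d" "exp_summable e"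
  shows "exp_summable (int_conv d e)"
  unfolding exp_summable_def
  using int_conv_moment_has_sum[OF assms, of 0] by (auto simp: summable_on_def)

lemma exp_moment_int_conv:
  assumes "exp_summable d" "exp_summable e"
  shows "exp_moment (int_conv d e) N y = (\<Sum>i\<le>N. of_nat (N choose i) * (exp_moment d i y * exp_moment e (N - i) y))"
  using has_sum_unique[OF exp_moment_has_sum[OF exp_summable_int_conv[OF assms]] int_conv_moment_has_sum[OF assms]] .

definition zero_order_ge :: "(int \<Rightarrow> real) \<Rightarrow> nat \<Rightarrow> real \<Rightarrow> bool" where
  "zero_order_ge d j y \<longleftrightarrow> (\<forall>k<j. exp_moment d k y = 0)"

text \<open>
  Orders of zeros add up under multiplication. The second part identifies the first derivative that
  may fail to vanish, so that exact orders add up as well.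
\<close>

lemma zero_order_ge_int_conv:
  assumes "exp_summable d" "exp_summable e" "zero_order_ge d j y" "zero_order_ge e k y"
  shows "zero_order_ge (int_conv d e) (j + k) y"
    and "exp_moment (int_conv d e) (j + k) y = of_nat ((j + k) choose j) * (exp_moment d j y * exp_moment e k y)"
proof -
  show "zero_order_ge (int_conv d e) (j + k) y"
    unfolding zero_order_ge_def
  proof safe
    fix N assume N: "N < j + k"
    have "i < j \<or> N - i < k" if "i \<le> N" for i using that N by linarith
    then show "exp_moment (int_conv d e) N y = 0"
      unfolding exp_moment_int_conv[OF assms(1,2)]
      using assms(3,4) by (intro sum.neutral) (auto simp: zero_order_ge_def)
  qed
  have "exp_moment (int_conv d e) (j + k) y = (\<Sum>i\<in>{j}. of_nat ((j + k) choose i) * (exp_moment d i y * exp_moment e (j + k - i) y))"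
    unfolding exp_moment_int_conv[OF assms(1,2)]
  proof (rule sum.mono_neutral_right)
    have "i < j \<or> j + k - i < k" if "i \<noteq> j" "i \<le> j + k" for i using that by linarith
    then show "\<forall>i\<in>{..j + k} - {j}. real (j + k choose i) * (exp_moment d i y * exp_moment e (j + k - i) y) = 0"
      using assms(3,4) by (auto simp: zero_order_ge_def)
  qed auto
  then show "exp_moment (int_conv d e) (j + k) y = of_nat ((j + k) choose j) * (exp_moment d j y * exp_moment e k y)" by simp
qed

text \<open>
  Growth of the function on the real axis, measured by \<open>exp \<circ> s\<close> up to factors \<open>exp (K * \<bar>x\<bar>)\<close>.
  The slack \<open>K\<close> absorbs all terms that are linear in \<open>x\<close>, which would otherwise
  have to be tracked through every product.
\<close>

definition exp_growth :: "(real \<Rightarrow> real) \<Rightarrow> (int \<Rightarrow> real) \<Rightarrow> bool" where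
  "exp_growth s d \<longleftrightarrow> exp_summable d \<and> (\<exists>C K. 0 \<le> C \<and> 0 \<le> K \<and> 
     (\<forall>x. (\<Sum>\<^sub>\<infinity>n. \<bar>d n\<bar> * exp (x * of_int n)) \<le> C * exp (s x + K * \<bar>x\<bar>)))"

text \<open>
  The sum of absolute values is submultiplicative under convolution, so exponents of growth add up.
\<close>

lemma exp_growth_int_conv:
  assumes "exp_growth s d" "exp_growth t e"
  shows "exp_growth (\<lambda>x. s x + t x) (int_conv d e)"
proof -
  have sd: "exp_summable d" and se: "exp_summable e" using assms by (auto simp: exp_growth_def)
  have sd': "exp_summable (\<lambda>n. \<bar>d n\<bar>)" and se': "exp_summable (\<lambda>n. \<bar>e n\<bar>)" 
    using exp_summable_abs[OF sd] exp_summable_abs[OF se] by (auto simp: exp_summable_def)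
  obtain C K where C: "0 \<le> C" "0 \<le> K" "\<And>x. (\<Sum>\<^sub>\<infinity>n. \<bar>d n\<bar> * exp (x * of_int n)) \<le> C * exp (s x + K * \<bar>x\<bar>)"
    using assms(1) unfolding exp_growth_def by auto
  obtain C' K' where C': "0 \<le> C'" "0 \<le> K'" "\<And>x. (\<Sum>\<^sub>\<infinity>n. \<bar>e n\<bar> * exp (x * of_int n)) \<le> C' * exp (t x + K' * \<bar>x\<bar>)"
    using assms(2) unfolding exp_growth_def by auto
  have le: "\<bar>int_conv d e n\<bar> \<le> int_conv (\<lambda>n. \<bar>d n\<bar>) (\<lambda>n. \<bar>e n\<bar>) n" for n
  proof -
    have "\<bar>int_conv d e n\<bar> \<le> (\<Sum>\<^sub>\<infinity>a. \<bar>d a * e (n - a)\<bar>)"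
      unfolding int_conv_def using norm_infsum_bound[of "\<lambda>a. d a * e (n - a)" UNIV]
      int_conv_has_sum[OF sd se, of n] summable_on_iff_abs_summable_on_real[of "\<lambda>a. d a * e (n - a)" UNIV]
      by (auto simp: summable_on_def)
    also have "\<dots> = int_conv (\<lambda>n. \<bar>d n\<bar>) (\<lambda>n. \<bar>e n\<bar>) n"
      by (simp add: int_conv_def abs_mult)
    finally show ?thesis .
  qed
  have "(\<Sum>\<^sub>\<infinity>n. \<bar>int_conv d e n\<bar> * exp (x * of_int n)) \<le> (C * C') * exp ((s x + t x) + (K + K') * \<bar>x\<bar>)" for x
  proof -
    have h: "((\<lambda>n. int_conv (\<lambda>n. \<bar>d n\<bar>) (\<lambda>n. \<bar>e n\<bar>) n * exp (x * of_int n)) has_sum 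
        (\<Sum>\<^sub>\<infinity>n. \<bar>d n\<bar> * exp (x * of_int n)) * (\<Sum>\<^sub>\<infinity>n. \<bar>e n\<bar> * exp (x * of_int n))) UNIV"
      using int_conv_moment_has_sum[OF sd' se', of 0 x] by (simp add: exp_moment_def)
    have "(\<Sum>\<^sub>\<infinity>n. \<bar>int_conv d e n\<bar> * exp (x * of_int n)) \<le> (\<Sum>\<^sub>\<infinity>n. \<bar>d n\<bar> * exp (x * of_int n)) * (\<Sum>\<^sub>\<infinity>n. \<bar>e n\<bar> * exp (x * of_int n))"
    proof (rule has_sum_mono[OF _ h])
      show "((\<lambda>n. \<bar>int_conv d e n\<bar> * exp (x * of_int n)) has_sum (\<Sum>\<^sub>\<infinity>n. \<bar>int_conv d e n\<bar> * exp (x * of_int n))) UNIV"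
        using exp_summable_abs[OF exp_summable_int_conv[OF sd se]] by simp
    qed (use le in \<open>auto intro: mult_right_mono\<close>)
    also have "\<dots> \<le> (C * exp (s x + K * \<bar>x\<bar>)) * (C' * exp (t x + K' * \<bar>x\<bar>))"
      by (intro mult_mono C C' infsum_nonneg) (use C in auto)
    also have "\<dots> = (C * C') * exp ((s x + t x) + (K + K') * \<bar>x\<bar>)"
      by (simp add: exp_add algebra_simps)
    finally show ?thesis .
  qed
  then show ?thesis unfolding exp_growth_def
    using exp_summable_int_conv[OF sd se] C C' by (intro conjI exI[of _ "C * C'"] exI[of _ "K + K'"]) auto
qed

text \<open>
  The counterpart of Cauchy's estimate: \<open>x\<close> is free and can be optimized for each \<open>n\<close>.
\<close>

lemma coeff_bound_of_growth:
  assumes "exp_growth s d"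
  obtains C K where "0 \<le> C" "0 \<le> K" "\<And>n x. \<bar>d n\<bar> \<le> C * exp (s x + K * \<bar>x\<bar> - x * of_int n)"
proof -
  have sd: "exp_summable d" using assms by (auto simp: exp_growth_def)
  obtain C K where C: "0 \<le> C" "0 \<le> K" "\<And>x. (\<Sum>\<^sub>\<infinity>n. \<bar>d n\<bar> * exp (x * of_int n)) \<le> C * exp (s x + K * \<bar>x\<bar>)"
    using assms(1) unfolding exp_growth_def by auto
  have "\<bar>d n\<bar> \<le> C * exp (s x + K * \<bar>x\<bar> - x * of_int n)" for n x
  proof -
    have "sum (\<lambda>n. \<bar>d n\<bar> * exp (x * of_int n)) {n} \<le> (\<Sum>\<^sub>\<infinity>n. \<bar>d n\<bar> * exp (x * of_int n))"
      by (rule finite_sum_le_infsum) (use exp_summable_abs[OF sd] in auto)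
    then have "\<bar>d n\<bar> * exp (x * of_int n) \<le> C * exp (s x + K * \<bar>x\<bar>)" using C(3)[of x] by simp
    then show ?thesis by (simp add: exp_diff field_simps)
  qed
  then show ?thesis using that C by blast
qed

lemma exp_growth_imp_summable: "exp_growth s d \<Longrightarrow> exp_summable d"
  by (auto simp: exp_growth_def)

definition int_refl :: "(int \<Rightarrow> real) \<Rightarrow> int \<Rightarrow> real" where "int_refl d n = d (- n)"

lemma int_refl_has_sum:
  "((\<lambda>n. g (int_refl d n) * exp (x * of_int n)) has_sum S) UNIV \<longleftrightarrow> ((\<lambda>n. g (d n) * exp (- x * of_int n)) has_sum S) UNIV"
  by (rule has_sum_reindex_bij_witness[where j = uminus and i = uminus]) (auto simp: int_refl_def)

lemma exp_summable_int_refl: "exp_summable d \<Longrightarrow> exp_summable (int_refl d)"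
  unfolding exp_summable_def summable_on_def using int_refl_has_sum[of "\<lambda>x. x" d] by metis

lemma exp_moment_int_refl: "exp_summable d \<Longrightarrow> exp_moment (int_refl d) 0 y = exp_moment d 0 (- y)"
  using int_refl_has_sum[of "\<lambda>x. x" d y] exp_moment_has_sum[of d 0 "-y"] exp_moment_has_sum[OF exp_summable_int_refl, of d 0 y] has_sum_unique
  by fastforce

lemma exp_growth_int_refl: 
  assumes "exp_growth s d" shows "exp_growth (\<lambda>x. s (- x)) (int_refl d)"
proof -
  have sd: "exp_summable d" using assms by (auto simp: exp_growth_def)
  obtain C K where C: "0 \<le> C" "0 \<le> K" "\<And>x. (\<Sum>\<^sub>\<infinity>n. \<bar>d n\<bar> * exp (x * of_int n)) \<le> C * exp (s x + K * \<bar>x\<bar>)"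
    using assms(1) unfolding exp_growth_def by auto
  have "(\<Sum>\<^sub>\<infinity>n. \<bar>int_refl d n\<bar> * exp (x * of_int n)) = (\<Sum>\<^sub>\<infinity>n. \<bar>d n\<bar> * exp (- x * of_int n))" for x
    using int_refl_has_sum[of abs d x] has_sum_infsum[OF exp_summable_abs[OF sd, of "-x"]] by (intro infsumI) auto
  then show ?thesis unfolding exp_growth_def
    using exp_summable_int_refl[OF sd] C(1,2) C(3)[of "-_"] by (intro conjI exI[of _ C] exI[of _ K]) auto
qed

section \<open>A function with prescribed zeros and minimal growth\<close>

text \<open>
  Euler's expansion of \<open>\<Prod>j\<ge>1. 1 - Q ^ j * w\<close> in powers of \<open>w\<close>, where \<open>Q = exp (- a)\<close>. With
  \<open>w = exp y\<close>, its zeros are the points \<open>a * j\<close> for \<open>j \<ge> 1\<close>. The series is taken as the definition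
  because growth and the functional equation can be read off the coefficients.
\<close>

primrec euler_coeff :: "real \<Rightarrow> nat \<Rightarrow> real" where
  "euler_coeff a 0 = 1"
| "euler_coeff a (Suc n) = - (exp (- a * (n + 1)) / (1 - exp (- a * (n + 1)))) * euler_coeff a n"

definition euler_seq :: "real \<Rightarrow> int \<Rightarrow> real" where
  "euler_seq a k = (if k \<ge> 0 then euler_coeff a (nat k) else 0)"

lemma euler_coeff_bound:
  assumes "a > 0"
  shows "\<bar>euler_coeff a n\<bar> \<le> exp (- a * n\<^sup>2 / 2 - ln (1 - exp (- a)) * n)"
proof (induction n)
  case (Suc n)
  have p: "1 - exp (- a) > 0" using assms by simp
  \<comment> \<open>Every denominator \<open>1 - exp (- a * n)\<close> is at least \<open>1 - exp (- a)\<close>, at a cost that is only exponential in \<open>n\<close>.\<close>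
  define L where "L = ln (1 - exp (- a))"
  have exp_L: "exp L = 1 - exp (- a)" using p by (simp add: L_def)
  have le: "exp (- a * (n + 1)) \<le> exp (- a)" using assms by (simp add: mult_le_cancel_left1)
  then have p': "1 - exp (- a * (n + 1)) > 0" using p by linarith
  have "\<bar>euler_coeff a (Suc n)\<bar> = exp (- a * (n + 1)) / (1 - exp (- a * (n + 1))) * \<bar>euler_coeff a n\<bar>"
    using p' by (simp add: abs_mult)
  also have "\<dots> \<le> exp (- a * (n + 1)) / (1 - exp (- a)) * exp (- a * n\<^sup>2 / 2 - ln (1 - exp (- a)) * n)"
    using p p' le by (intro mult_mono Suc.IH divide_left_mono) (auto intro!: divide_nonneg_pos)
  also have "\<dots> = exp (- a * (n + 1) - L + (- a * n\<^sup>2 / 2 - L * n))"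
    by (simp only: L_def[symmetric]) (simp only: exp_L[symmetric] exp_add exp_diff ln_exp)
  also have "\<dots> \<le> exp (- a * (Suc n)\<^sup>2 / 2 - L * Suc n)"
    using assms by (simp add: power2_eq_square field_simps)
  finally show ?case by (simp add: L_def)
qed auto

text \<open>
  Completing the square in the exponent: a sequence of size \<open>exp (- a * n\<^sup>2 / 2)\<close> has a generating
  function of size \<open>exp (x\<^sup>2 / (2 * a))\<close>. Only \<open>max x 0\<close> enters, because there are no
  negative powers.
\<close>

lemma euler_seq_bound:
  fixes n :: int
  assumes a: "a > 0"
  defines "L \<equiv> a - ln (1 - exp (- a))"
  shows "\<bar>euler_seq a n\<bar> * exp (x * of_int n) \<le> exp ((max x 0)\<^sup>2 / (2 * a) + L / a * max x 0 + L\<^sup>2 / (2 * a)) *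
     (if n \<ge> 0 then exp (- a) ^ nat n else 0)"
proof (cases "n \<ge> 0")
  case True
  define m :: real where "m = of_int n"
  have m: "m = real (nat n)" "m \<ge> 0" using True by (auto simp: m_def)
  define u where "u = max x 0"
  have "\<bar>euler_seq a n\<bar> * exp (x * m) \<le> exp (- a * m\<^sup>2 / 2 - ln (1 - exp (- a)) * m) * exp (u * m)"
    using True euler_coeff_bound[OF a, of "nat n"] m
    by (intro mult_mono) (auto simp: euler_seq_def u_def intro!: mult_right_mono)
  \<comment> \<open>The factor \<open>exp (- a * m)\<close> is set aside before completing the square: it makes the bound summable over \<open>m\<close>.\<close>
  also have "\<dots> = exp (- a * m\<^sup>2 / 2 + (L + u) * m - a * m)"
    by (simp add: exp_add [symmetric] L_def algebra_simps)
  also have "\<dots> \<le> exp ((u\<^sup>2 / (2 * a) + L / a * u + L\<^sup>2 / (2 * a)) - a * m)"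
  proof -
    have "0 \<le> (a * m - (L + u))\<^sup>2 / (2 * a)" using a by simp
    also have "\<dots> = a * m\<^sup>2 / 2 - (L + u) * m + (u\<^sup>2 / (2 * a) + L / a * u + L\<^sup>2 / (2 * a))"
      using a by (simp add: power2_eq_square field_simps)
    finally show ?thesis by simp
  qed
  also have "\<dots> = exp (u\<^sup>2 / (2 * a) + L / a * u + L\<^sup>2 / (2 * a)) * exp (- a) ^ nat n"
  proof -
    have "exp (- a) ^ nat n = exp (- (a * m))" unfolding m(1) by (simp add: mult.commute flip: exp_of_nat_mult)
    then show ?thesis by (simp only: diff_conv_add_uminus exp_add)
  qed
  finally show ?thesis using True by (simp add: m_def u_def)
qed (auto simp: euler_seq_def)

lemma euler_growth:
  assumes a: "a > 0"
  shows "exp_growth (\<lambda>x. (max x 0)\<^sup>2 / (2 * a)) (euler_seq a)"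
proof -
  define L where "L = a - ln (1 - exp (- a))"
  have "ln (1 - exp (- a)) \<le> 0" using a by (subst ln_le_zero_iff) auto
  then have L: "L \<ge> 0" using a unfolding L_def by linarith
  have g: "((\<lambda>k::int. if k \<ge> 0 then exp (- a) ^ nat k else 0) has_sum (1 / (1 - exp (- a)))) UNIV"
    using a by (intro has_sum_int_of_nat sums_nonneg_imp_has_sum geometric_sums) auto
  define B where "B x = exp ((max x 0)\<^sup>2 / (2 * a) + L / a * max x 0 + L\<^sup>2 / (2 * a))" for x
  have g': "((\<lambda>k::int. B x * (if k \<ge> 0 then exp (- a) ^ nat k else 0)) has_sum (B x * (1 / (1 - exp (- a))))) UNIV" for x
    by (rule has_sum_cmult_right[OF g])
  have le: "\<bar>euler_seq a n\<bar> * exp (x * of_int n) \<le> B x * (if n \<ge> 0 then exp (- a) ^ nat n else 0)" for n x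
    using euler_seq_bound[OF a] by (simp add: B_def L_def)
  have s: "(\<lambda>n. \<bar>euler_seq a n\<bar> * exp (x * of_int n)) summable_on UNIV" for x
    by (rule summable_on_comparison_test[OF has_sum_imp_summable[OF g'[of x]]]) (use le in auto)
  have "(\<Sum>\<^sub>\<infinity>n. \<bar>euler_seq a n\<bar> * exp (x * of_int n)) \<le> (exp (L\<^sup>2 / (2 * a)) / (1 - exp (- a))) * exp ((max x 0)\<^sup>2 / (2 * a) + L / a * \<bar>x\<bar>)" for x
  proof -
    have "(\<Sum>\<^sub>\<infinity>n. \<bar>euler_seq a n\<bar> * exp (x * of_int n)) \<le> B x * (1 / (1 - exp (- a)))"
      by (rule has_sum_mono[OF has_sum_infsum[OF s] g']) (use le in auto)
    also have "B x \<le> exp ((max x 0)\<^sup>2 / (2 * a) + L / a * \<bar>x\<bar> + L\<^sup>2 / (2 * a))"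
      using L a by (auto simp: B_def intro!: divide_right_mono mult_left_mono)
    then have "B x * (1 / (1 - exp (- a))) \<le> exp ((max x 0)\<^sup>2 / (2 * a) + L / a * \<bar>x\<bar> + L\<^sup>2 / (2 * a)) * (1 / (1 - exp (- a)))"
      using a by (intro mult_right_mono) auto
    finally show ?thesis by (simp add: exp_add mult_ac)
  qed
  then show ?thesis using a L exp_summable_absI[OF s] unfolding exp_growth_def
    by (intro conjI exI[of _ "exp (L\<^sup>2 / (2 * a)) / (1 - exp (- a))"] exI[of _ "L / a"]) auto
qed

lemma euler_seq_rec:
  assumes "a > 0"
  shows "euler_seq a n = exp (- a * of_int n) * euler_seq a n - exp (- a * of_int n) * euler_seq a (n - 1)"
proof (cases "n \<le> 0")
  case False
  define k where "k = nat (n - 1)"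
  have k: "nat n = Suc k" "nat (n - 1) = k" "of_int n = real k + 1" "0 \<le> n" "0 \<le> n - 1" using False by (simp_all add: k_def)
  define q where "q = exp (- a * (real k + 1))"
  have "q < 1" using assms by (simp add: q_def)
  then have q: "1 - q \<noteq> 0" by linarith
  have 1: "euler_seq a n = - (q / (1 - q)) * euler_coeff a k" "euler_seq a (n - 1) = euler_coeff a k" 
    using k(4,5) unfolding euler_seq_def k(1,2) q_def by (simp_all add: add.commute)
  have 2: "exp (- a * of_int n) = q" unfolding k(3) q_def ..
  have "- (q / (1 - q)) * c = q * (- (q / (1 - q)) * c) - q * c" for c
    using q by (simp add: divide_simps) (simp add: algebra_simps)
  then show ?thesis unfolding 1 2 .
qed (auto simp: euler_seq_def)

text \<open>
  Splitting off the first factor of the product and rescaling the remaining ones.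
\<close>

lemma euler_functional_eq:
  assumes a: "a > 0"
  shows "exp_moment (euler_seq a) 0 y = (1 - exp (y - a)) * exp_moment (euler_seq a) 0 (y - a)"
proof -
  note s = exp_growth_imp_summable[OF euler_growth[OF a]]
  have h: "((\<lambda>n. euler_seq a n * exp ((y - a) * of_int n)) has_sum exp_moment (euler_seq a) 0 (y - a)) UNIV"
    using exp_moment_has_sum[OF s, of 0 "y - a"] by simp
  then have "((\<lambda>n. euler_seq a (n - 1) * exp ((y - a) * of_int (n - 1))) has_sum exp_moment (euler_seq a) 0 (y - a)) UNIV"
    by (subst has_sum_reindex_bij_witness[where j = "\<lambda>n. n - 1" and i = "\<lambda>n. n + 1" and T = UNIV and h = "\<lambda>n. euler_seq a n * exp ((y - a) * of_int n)"]) auto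
  from has_sum_diff[OF h has_sum_cmult_right[OF this, of "exp (y - a)"]]
  have "((\<lambda>n. euler_seq a n * exp ((y - a) * of_int n) - exp (y - a) * (euler_seq a (n - 1) * exp ((y - a) * of_int (n - 1)))) has_sum
     (1 - exp (y - a)) * exp_moment (euler_seq a) 0 (y - a)) UNIV"
    by (simp add: algebra_simps)
  also have "(\<lambda>n. euler_seq a n * exp ((y - a) * of_int n) - exp (y - a) * (euler_seq a (n - 1) * exp ((y - a) * of_int (n - 1))))
     = (\<lambda>n. euler_seq a n * exp (y * of_int n))"
  proof
    fix n
    have "exp (y - a) * exp ((y - a) * of_int (n - 1)) = exp ((y - a) * of_int n)"
      by (simp flip: exp_add add: algebra_simps)
    then have "euler_seq a n * exp ((y - a) * of_int n) - exp (y - a) * (euler_seq a (n - 1) * exp ((y - a) * of_int (n - 1)))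
      = exp (y * of_int n) * (exp (- a * of_int n) * euler_seq a n - exp (- a * of_int n) * euler_seq a (n - 1))"
      by (simp add: algebra_simps exp_diff exp_minus field_simps)
    also have "\<dots> = exp (y * of_int n) * euler_seq a n" using euler_seq_rec[OF a, of n] by simp
    finally show "euler_seq a n * exp ((y - a) * of_int n) - exp (y - a) * (euler_seq a (n - 1) * exp ((y - a) * of_int (n - 1))) = euler_seq a n * exp (y * of_int n)"
      by (simp add: mult.commute)
  qed
  finally show ?thesis
    using has_sum_unique exp_moment_has_sum[OF s, of 0 y] by fastforce
qed

text \<open>
  The factor \<open>1 - exp (y - a)\<close> vanishes at \<open>y = a\<close>, and the functional equation propagates this zero
  to the right.
\<close>

lemma euler_zero:
  assumes a: "a > 0"
  shows "exp_moment (euler_seq a) 0 (a * of_nat (Suc n)) = 0"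
proof (induction n)
  case 0
  then show ?case using euler_functional_eq[OF a, of a] by simp
next
  case (Suc n)
  then show ?case using euler_functional_eq[OF a, of "a * of_nat (Suc (Suc n))"] by (simp add: algebra_simps)
qed

lemma euler_nonzero:
  assumes a: "a > 0"
  shows "exp_moment (euler_seq a) 0 0 \<noteq> 0"
proof
  assume z: "exp_moment (euler_seq a) 0 0 = 0"
  \<comment> \<open>The functional equation carries a zero at 0 down to all points \<open>- a * n\<close>, where the series tends to its constant term 1.\<close>
  have z': "exp_moment (euler_seq a) 0 (- a * of_nat n) = 0" for n
  proof (induction n)
    case (Suc n)
    have "a * of_nat n \<ge> 0" using a by simp
    then have "- a * of_nat n - a < 0" using a by linarith
    then have "exp (- a * of_nat n - a) < 1" by (subst exp_less_one_iff)
    moreover have "- a * of_nat (Suc n) = - a * of_nat n - a" by (simp add: algebra_simps)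
    ultimately show ?case using Suc.IH euler_functional_eq[OF a, of "- a * of_nat n"] by simp
  qed (use z in simp)
  note s = exp_growth_imp_summable[OF euler_growth[OF a]]
  define M where "M = (\<Sum>\<^sub>\<infinity>n. \<bar>euler_seq a n\<bar>)"
  have M: "((\<lambda>n. \<bar>euler_seq a n\<bar>) has_sum M) UNIV" unfolding M_def
    using exp_summable_abs[OF s, of 0] by simp
  have "1 \<le> exp (- a) ^ n * M" for n :: nat
  proof -
    define y where "y = - a * of_nat n"
    have d0: "((\<lambda>k::int. if k = 0 then 1 else (0::real)) has_sum 1) UNIV"
      by (rule has_sum_finite_neutralI[of "{0}"]) auto
    have "((\<lambda>k. euler_seq a k * exp (y * of_int k)) has_sum 0) UNIV"
      using exp_moment_has_sum[OF s, of 0 y] z'[of n] by (simp add: y_def)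
    from has_sum_diff[OF d0 this]
    have "((\<lambda>k. (if k = 0 then 1 else 0) - euler_seq a k * exp (y * of_int k)) has_sum 1) UNIV" by simp
    moreover have "((\<lambda>k. exp y * \<bar>euler_seq a k\<bar>) has_sum exp y * M) UNIV"
      by (rule has_sum_cmult_right[OF M])
    moreover have "(if k = 0 then 1 else 0) - euler_seq a k * exp (y * of_int k) \<le> exp y * \<bar>euler_seq a k\<bar>" for k
    proof -
      consider "k < 0" | "k = 0" | "k \<ge> 1" by linarith
      then show ?thesis
      proof cases
        assume k: "k \<ge> 1"
        have "- euler_seq a k * exp (y * of_int k) \<le> \<bar>euler_seq a k\<bar> * exp (y * of_int k)"
          by (intro mult_right_mono) auto
        also have "y * of_int k \<le> y * 1" using a k unfolding y_def by (intro mult_left_mono_neg) auto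
        then have "\<bar>euler_seq a k\<bar> * exp (y * of_int k) \<le> \<bar>euler_seq a k\<bar> * exp y"
          by (intro mult_left_mono) auto
        finally show ?thesis using k by (simp add: mult.commute)
      qed (auto simp: euler_seq_def)
    qed
    ultimately have "1 \<le> exp y * M" by (rule has_sum_mono) 
    then show ?thesis by (simp add: y_def mult.commute flip: exp_of_nat_mult)
  qed
  moreover have "(\<lambda>n. exp (- a) ^ n * M) \<longlonglongrightarrow> 0 * M"
    by (intro tendsto_mult tendsto_const LIMSEQ_power_zero) (use a in auto)
  ultimately have "1 \<le> 0 * M" by (intro LIMSEQ_le_const) auto
  then show False by simp
qed

text \<open>
  The coefficients of \<open>1 - w\<close>.
\<close>

definition diff_seq :: "int \<Rightarrow> real" where "diff_seq n = (if n = 0 then 1 else if n = 1 then - 1 else 0)"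

lemma diff_seq_has_sum: "g 0 = 0 \<Longrightarrow> ((\<lambda>n. g (diff_seq n) * h n :: real) has_sum (g 1 * h 0 + g (-1) * h 1)) UNIV"
  by (rule has_sum_finite_neutralI[of "{0, 1}"]) (auto simp: diff_seq_def)

lemma exp_summable_diff_seq: "exp_summable diff_seq"
  unfolding exp_summable_def
proof
  show "(\<lambda>n. diff_seq n * exp (x * of_int n)) summable_on UNIV" for x
    using diff_seq_has_sum[of "\<lambda>x. x" "\<lambda>n. exp (x * of_int n)"] by (auto intro: has_sum_imp_summable)
qed

lemma exp_moment_diff_seq: "exp_moment diff_seq k y = 0 ^ k - exp y"
  unfolding exp_moment_def 
  using infsumI[OF diff_seq_has_sum[of "\<lambda>x. x" "\<lambda>n. of_int n ^ k * exp (y * of_int n)"]]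
  by (simp add: mult.assoc)

lemma exp_growth_diff_seq: "exp_growth (\<lambda>_. 0) diff_seq"
proof -
  have "(\<Sum>\<^sub>\<infinity>n. \<bar>diff_seq n\<bar> * exp (x * of_int n)) \<le> 2 * exp (0 + 1 * \<bar>x\<bar>)" for x
  proof -
    have "(\<Sum>\<^sub>\<infinity>n. \<bar>diff_seq n\<bar> * exp (x * of_int n)) = 1 + exp x"
      using infsumI[OF diff_seq_has_sum[of "abs" "\<lambda>n. exp (x * of_int n)"]] by simp
    moreover have "1 \<le> exp \<bar>x\<bar>" "exp x \<le> exp \<bar>x\<bar>" by auto
    then have "1 + exp x \<le> 2 * exp \<bar>x\<bar>" by linarith
    ultimately show ?thesis by simp
  qed
  then show ?thesis unfolding exp_growth_def using exp_summable_diff_seq 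
    by (intro conjI exI[of _ "2"] exI[of _ "1"]) auto
qed

text \<open>
  The coefficients of \<open>\<Prod>j\<ge>1. (1 - Q ^ j * w) * (1 - Q ^ j / w)\<close>, up to a constant factor the quotient of
  Jacobi's theta function by its factor \<open>1 - w\<close>: with \<open>w = exp y\<close>, there is a simple
  zero at \<open>y = a * l\<close> for every nonzero integer \<open>l\<close>, and none at \<open>y = 0\<close>.
\<close>

definition theta_seq :: "real \<Rightarrow> int \<Rightarrow> real" where
  "theta_seq a = int_conv (euler_seq a) (int_refl (euler_seq a))"

lemma theta_growth:
  assumes a: "a > 0"
  shows "exp_growth (\<lambda>x. x\<^sup>2 / (2 * a)) (theta_seq a)"
proof -
  have "exp_growth (\<lambda>x. (max x 0)\<^sup>2 / (2 * a) + (max (-x) 0)\<^sup>2 / (2 * a)) (theta_seq a)"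
    unfolding theta_seq_def by (intro exp_growth_int_conv exp_growth_int_refl euler_growth a)
  also have "(\<lambda>x. (max x 0)\<^sup>2 / (2 * a) + (max (-x) 0)\<^sup>2 / (2 * a)) = (\<lambda>x. x\<^sup>2 / (2 * a))"
    by (auto simp: fun_eq_iff max_def)
  finally show ?thesis .
qed

lemma theta_moment:
  assumes a: "a > 0"
  shows "exp_moment (theta_seq a) 0 y = exp_moment (euler_seq a) 0 y * exp_moment (euler_seq a) 0 (- y)"
  unfolding theta_seq_def
  using exp_growth_imp_summable[OF euler_growth[OF a]]
  by (subst exp_moment_int_conv) (auto simp: exp_moment_int_refl exp_summable_int_refl)

lemma theta_zero:
  assumes a: "a > 0" and l: "l \<noteq> (0::int)"
  shows "exp_moment (theta_seq a) 0 (a * of_int l) = 0"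
proof -
  obtain n where "l = int (Suc n) \<or> l = - int (Suc n)" using l
    by (metis int_cases not0_implies_Suc of_nat_0 minus_zero)
  then have "a * of_int l = a * of_nat (Suc n) \<or> - (a * of_int l) = a * of_nat (Suc n)" 
    by (elim disjE) (simp_all only: of_int_of_nat_eq of_int_minus mult_minus_right minus_minus simp_thms)
  then show ?thesis using euler_zero[OF a, of n] by (metis theta_moment[OF a] mult_zero_left mult_zero_right)
qed

lemma theta_nonzero:
  assumes a: "a > 0" shows "exp_moment (theta_seq a) 0 0 \<noteq> 0"
  using euler_nonzero[OF a] by (simp add: theta_moment[OF a])

text \<open>
  The coefficients of \<open>\<theta> w ^ (r + 1) * (1 - w) ^ r\<close>, where \<open>\<theta>\<close> has the coefficients \<open>theta_seq a\<close>.
\<close>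

primrec dual_seq :: "real \<Rightarrow> nat \<Rightarrow> int \<Rightarrow> real" where
  "dual_seq a 0 = theta_seq a"
| "dual_seq a (Suc r) = int_conv (dual_seq a r) (int_conv (theta_seq a) diff_seq)"

text \<open>
  Each theta factor contributes \<open>x\<^sup>2 / (2 * a)\<close> to the exponent and the factors \<open>1 - w\<close> contribute
  nothing: zeros of order \<open>r + 1\<close> cost \<open>r + 1\<close> Gaussians.
\<close>

lemma dual_seq_growth:
  assumes a: "a > 0"
  shows "exp_growth (\<lambda>x. real (r + 1) * x\<^sup>2 / (2 * a)) (dual_seq a r)"
proof (induction r)
  case 0
  then show ?case using theta_growth[OF a] by simp
next
  case (Suc r)
  have "exp_growth (\<lambda>x. real (r + 1) * x\<^sup>2 / (2 * a) + (x\<^sup>2 / (2 * a) + 0)) (dual_seq a (Suc r))"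
    unfolding dual_seq.simps by (intro exp_growth_int_conv Suc.IH theta_growth exp_growth_diff_seq a)
  then show ?case by (simp add: algebra_simps add_divide_distrib)
qed

lemma dual_seq_zero:
  assumes a: "a > 0" and l: "l \<noteq> (0::int)"
  shows "zero_order_ge (dual_seq a r) (r + 1) (a * of_int l)"
proof (induction r)
  case 0
  then show ?case using theta_zero[OF a l] by (simp add: zero_order_ge_def)
next
  case (Suc r)
  note s = exp_growth_imp_summable
  have "zero_order_ge (int_conv (theta_seq a) diff_seq) (1 + 0) (a * of_int l)"
    by (rule zero_order_ge_int_conv) (use theta_zero[OF a l] in \<open>auto simp: zero_order_ge_def exp_summable_diff_seq intro: s[OF theta_growth[OF a]]\<close>)
  from zero_order_ge_int_conv(1)[OF _ _ Suc.IH this] show ?case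
    using s[OF dual_seq_growth[OF a]] exp_summable_diff_seq s[OF theta_growth[OF a]] by (simp add: exp_summable_int_conv)
qed

lemma dual_seq_exact_order:
  assumes a: "a > 0" 
  shows "zero_order_ge (dual_seq a r) r 0 \<and> exp_moment (dual_seq a r) r 0 \<noteq> 0"
proof (induction r)
  case 0
  then show ?case using theta_nonzero[OF a] by (simp add: zero_order_ge_def)
next
  case (Suc r)
  note s = exp_growth_imp_summable
  note sums = s[OF dual_seq_growth[OF a]] exp_summable_diff_seq s[OF theta_growth[OF a]]
  have 0: "zero_order_ge (theta_seq a) 0 0" "zero_order_ge diff_seq 1 0" by (auto simp: zero_order_ge_def exp_moment_diff_seq)
  note 1 = zero_order_ge_int_conv[OF sums(3) sums(2) 0]
  have "zero_order_ge (int_conv (theta_seq a) diff_seq) 1 0" using 1(1) by simp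
  from zero_order_ge_int_conv[OF sums(1) _ conjunct1[OF Suc.IH] this]
  show ?case using sums 1(2) Suc.IH theta_nonzero[OF a] by (auto simp: exp_summable_int_conv exp_moment_diff_seq)
qed

lemma dual_seq_decay:
  assumes a: "a > 0" 
  obtains C K where "0 \<le> C" "0 \<le> K" "\<And>n. \<bar>dual_seq a r n\<bar> \<le> C * exp (- a * (of_int n)\<^sup>2 / (2 * real (r + 1)) + K * \<bar>of_int n\<bar>)"
proof -
  obtain C K where C: "0 \<le> C" "0 \<le> K" "\<And>n x. \<bar>dual_seq a r n\<bar> \<le> C * exp (real (r + 1) * x\<^sup>2 / (2 * a) + K * \<bar>x\<bar> - x * of_int n)"
    using coeff_bound_of_growth[OF dual_seq_growth[OF a, of r]] by blast
  show ?thesis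
  proof
    show "0 \<le> C" "0 \<le> K * (a / real (r + 1))" using C a by auto
    fix n
    define s where "s = real (r + 1)"
    have s: "s > 0" by (simp add: s_def)
    \<comment> \<open>This \<open>x\<close> minimizes \<open>s * x\<^sup>2 / (2 * a) - x * n\<close>.\<close>
    define x where "x = a * of_int n / s"
    have "s * x\<^sup>2 / (2 * a) + K * \<bar>x\<bar> - x * of_int n = - a * (of_int n)\<^sup>2 / (2 * s) + K * (a / s) * \<bar>of_int n\<bar>"
      using a s by (simp add: x_def abs_mult power2_eq_square field_simps)
    then show "\<bar>dual_seq a r n\<bar> \<le> C * exp (- a * (of_int n)\<^sup>2 / (2 * real (r + 1)) + K * (a / real (r + 1)) * \<bar>of_int n\<bar>)"
      using C(3)[of n x] by (simp add: s_def)
  qed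
qed

section \<open>Square-integrable functions and orthonormal systems\<close>

definition square_integrable :: "'a measure \<Rightarrow> ('a \<Rightarrow> complex) \<Rightarrow> bool" where
  "square_integrable M f \<longleftrightarrow> f \<in> borel_measurable M \<and> integrable M (\<lambda>t. (cmod (f t))\<^sup>2)"

lemma borel_measurable_cnj [measurable (raw)]:
  "g \<in> borel_measurable M \<Longrightarrow> (\<lambda>t. cnj (g t)) \<in> borel_measurable M"
  by (rule borel_measurable_continuous_on[OF linear_continuous_on[OF bounded_linear_cnj]])

lemma square_integrable_mult_cnj:
  assumes "square_integrable M f" "square_integrable M g"
  shows "integrable M (\<lambda>t. f t * cnj (g t))"
proof (rule Bochner_Integration.integrable_bound)
  show "integrable M (\<lambda>t. (cmod (f t))\<^sup>2 + (cmod (g t))\<^sup>2)"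
    using assms by (auto simp: square_integrable_def)
  have [measurable]: "f \<in> borel_measurable M" "g \<in> borel_measurable M"
    using assms by (auto simp: square_integrable_def)
  show "(\<lambda>t. f t * cnj (g t)) \<in> borel_measurable M" by measurable
  have "cmod (f t * cnj (g t)) \<le> norm ((cmod (f t))\<^sup>2 + (cmod (g t))\<^sup>2)" for t
  proof -
    have "2 * cmod (f t) * cmod (g t) \<le> (cmod (f t))\<^sup>2 + (cmod (g t))\<^sup>2" by (rule sum_squares_bound)
    moreover have "0 \<le> cmod (f t) * cmod (g t)" by simp
    ultimately have "cmod (f t) * cmod (g t) \<le> (cmod (f t))\<^sup>2 + (cmod (g t))\<^sup>2" by linarith
    then show ?thesis by (simp add: norm_mult)
  qed
  then show "AE t in M. cmod (f t * cnj (g t)) \<le> norm ((cmod (f t))\<^sup>2 + (cmod (g t))\<^sup>2)" by simp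
qed

lemma cmod_add_square: "(cmod (x + y))\<^sup>2 = (cmod x)\<^sup>2 + (cmod y)\<^sup>2 + 2 * Re (x * cnj y)"
  unfolding cmod_power2 by (simp add: power2_eq_square algebra_simps)

lemma square_integrable_add:
  assumes "square_integrable M f" "square_integrable M g"
  shows "square_integrable M (\<lambda>t. f t + g t)"
proof -
  have "integrable M (\<lambda>t. (cmod (f t))\<^sup>2 + (cmod (g t))\<^sup>2 + 2 * Re (f t * cnj (g t)))"
    using assms integrable_Re[OF square_integrable_mult_cnj[OF assms]]
    by (intro Bochner_Integration.integrable_add integrable_mult_right) (auto simp: square_integrable_def)
  moreover have "(\<lambda>t. f t + g t) \<in> borel_measurable M"
    using assms by (intro borel_measurable_add) (auto simp: square_integrable_def)
  ultimately show ?thesis by (simp add: square_integrable_def cmod_add_square)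
qed

lemma square_integrable_cmult:
  assumes "square_integrable M f" shows "square_integrable M (\<lambda>t. c * f t)"
  using assms by (auto simp: square_integrable_def norm_mult power_mult_distrib)

lemma square_integrable_diff:
  assumes "square_integrable M f" "square_integrable M g"
  shows "square_integrable M (\<lambda>t. f t - g t)"
  using square_integrable_add[OF assms(1) square_integrable_cmult[OF assms(2), of "-1"]] by simp

lemma square_integrable_sum:
  assumes "\<And>i. i \<in> I \<Longrightarrow> square_integrable M (f i)"
  shows "square_integrable M (\<lambda>t. \<Sum>i\<in>I. f i t)"
  using assms
  by (induction I rule: infinite_finite_induct) (auto simp: square_integrable_add square_integrable_def[of M "\<lambda>_. 0"])

definition l2_norm2 :: "'a measure \<Rightarrow> ('a \<Rightarrow> complex) \<Rightarrow> real" where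
  "l2_norm2 M f = (LINT t|M. (cmod (f t))\<^sup>2)"

definition l2_inner :: "'a measure \<Rightarrow> ('a \<Rightarrow> complex) \<Rightarrow> ('a \<Rightarrow> complex) \<Rightarrow> complex" where
  "l2_inner M f g = (LINT t|M. f t * cnj (g t))"

lemma l2_norm2_nonneg: "0 \<le> l2_norm2 M f"
  by (simp add: l2_norm2_def)

lemma l2_norm2_add:
  assumes "square_integrable M f" "square_integrable M g"
  shows "l2_norm2 M (\<lambda>t. f t + g t) = l2_norm2 M f + l2_norm2 M g + 2 * Re (l2_inner M f g)"
proof -
  have i: "integrable M (\<lambda>t. (cmod (f t))\<^sup>2)" "integrable M (\<lambda>t. (cmod (g t))\<^sup>2)"
    using assms by (auto simp: square_integrable_def)
  note j = square_integrable_mult_cnj[OF assms]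
  have *: "integral\<^sup>L M (\<lambda>t. u t + v t + 2 * w t) = integral\<^sup>L M u + integral\<^sup>L M v + 2 * integral\<^sup>L M w"
    if "integrable M u" "integrable M v" "integrable M w" for u v w :: "'a \<Rightarrow> real"
    using that by simp
  have "l2_norm2 M (\<lambda>t. f t + g t) = (LINT t|M. (cmod (f t))\<^sup>2 + (cmod (g t))\<^sup>2 + 2 * Re (f t * cnj (g t)))"
    by (simp add: l2_norm2_def cmod_add_square)
  also have "\<dots> = l2_norm2 M f + l2_norm2 M g + 2 * (LINT t|M. Re (f t * cnj (g t)))"
    unfolding l2_norm2_def by (rule *[OF i integrable_Re[OF j]])
  finally show ?thesis unfolding l2_inner_def by (simp only: integral_Re[OF j])
qed

lemma l2_norm2_cmult: "l2_norm2 M (\<lambda>t. c * f t) = (cmod c)\<^sup>2 * l2_norm2 M f"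
  by (simp add: l2_norm2_def norm_mult power_mult_distrib)

lemma l2_inner_cmult_left: "l2_inner M (\<lambda>t. c * f t) g = c * l2_inner M f g"
  by (simp add: l2_inner_def mult.assoc)

lemma l2_inner_cmult_right: "l2_inner M f (\<lambda>t. c * g t) = cnj c * l2_inner M f g"
  by (simp add: l2_inner_def mult.left_commute)

lemma l2_inner_add_left:
  assumes "square_integrable M f" "square_integrable M g" "square_integrable M h"
  shows "l2_inner M (\<lambda>t. f t + g t) h = l2_inner M f h + l2_inner M g h"
  using square_integrable_mult_cnj[OF assms(1,3)] square_integrable_mult_cnj[OF assms(2,3)]
  by (simp add: l2_inner_def distrib_right)

lemma l2_inner_sum_right:
  assumes "square_integrable M f" "\<And>i. i \<in> I \<Longrightarrow> square_integrable M (g i)"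
  shows "l2_inner M f (\<lambda>t. \<Sum>i\<in>I. g i t) = (\<Sum>i\<in>I. l2_inner M f (g i))"
  unfolding l2_inner_def cnj_sum sum_distrib_left
  by (rule Bochner_Integration.integral_sum) (use assms square_integrable_mult_cnj in blast)

lemma l2_inner_sum_left:
  assumes "square_integrable M f" "\<And>i. i \<in> I \<Longrightarrow> square_integrable M (g i)"
  shows "l2_inner M (\<lambda>t. \<Sum>i\<in>I. g i t) f = (\<Sum>i\<in>I. l2_inner M (g i) f)"
  unfolding l2_inner_def sum_distrib_right
  by (rule Bochner_Integration.integral_sum) (use assms square_integrable_mult_cnj in blast)

lemma l2_inner_self: "l2_inner M f f = of_real (l2_norm2 M f)"
  unfolding l2_inner_def l2_norm2_def complex_norm_square[symmetric] integral_complex_of_real ..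

lemma polarization_complex:
  "4 * (x * cnj y) = of_real ((cmod (x + y))\<^sup>2) - of_real ((cmod (x + (-1) * y))\<^sup>2) 
     + \<i> * of_real ((cmod (x + \<i> * y))\<^sup>2) - \<i> * of_real ((cmod (x + (-\<i>) * y))\<^sup>2)"
  unfolding cmod_add_square by (simp add: complex_eq_iff norm_mult)

lemma l2_inner_polarization:
  assumes "square_integrable M f" "square_integrable M g"
  shows "4 * l2_inner M f g = of_real (l2_norm2 M (\<lambda>t. f t + g t)) - of_real (l2_norm2 M (\<lambda>t. f t + (-1) * g t))
     + \<i> * of_real (l2_norm2 M (\<lambda>t. f t + \<i> * g t)) - \<i> * of_real (l2_norm2 M (\<lambda>t. f t + (-\<i>) * g t))"
proof -
  note * = l2_norm2_add[OF assms(1) square_integrable_cmult[OF assms(2)]] 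
  show ?thesis
    unfolding * l2_norm2_add[OF assms] l2_norm2_cmult l2_inner_cmult_right
    by (simp add: complex_eq_iff)
qed

lemma l2_norm2_add_le:
  assumes "square_integrable M f" "square_integrable M g"
  shows "l2_norm2 M (\<lambda>t. f t + g t) \<le> 2 * l2_norm2 M f + 2 * l2_norm2 M g"
proof -
  \<comment> \<open>The parallelogram identity.\<close>
  have "l2_norm2 M (\<lambda>t. f t + (-1) * g t) = l2_norm2 M f + l2_norm2 M g - 2 * Re (l2_inner M f g)"
    using l2_norm2_add[OF assms(1) square_integrable_cmult[OF assms(2), of "-1"]] l2_norm2_cmult[of M "-1" g] l2_inner_cmult_right[of M f "-1" g]
    by simp
  then show ?thesis using l2_norm2_add[OF assms] l2_norm2_nonneg[of M "\<lambda>t. f t + (-1) * g t"] by linarith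
qed

definition orthonormal_system :: "'a measure \<Rightarrow> ('i \<Rightarrow> 'a \<Rightarrow> complex) \<Rightarrow> bool" where
  "orthonormal_system M e \<longleftrightarrow> (\<forall>i. square_integrable M (e i)) \<and> 
     (\<forall>i j. l2_inner M (e i) (e j) = (if i = j then 1 else 0))"

text \<open>
  The Pythagorean theorem: the error of an approximation splits into the error of the orthogonal
  projection and the deviation of the coefficients from those of \<open>f\<close>.
\<close>

lemma l2_norm2_minus_combination:
  assumes "square_integrable M f" "orthonormal_system M e" "finite I"
  shows "l2_norm2 M (\<lambda>t. f t - (\<Sum>i\<in>I. a i * e i t)) 
     = l2_norm2 M f - (\<Sum>i\<in>I. (cmod (l2_inner M f (e i)))\<^sup>2) + (\<Sum>i\<in>I. (cmod (l2_inner M f (e i) - a i))\<^sup>2)"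
proof -
  define p where "p t = (\<Sum>i\<in>I. a i * e i t)" for t
  have e: "square_integrable M (e i)" for i using assms by (auto simp: orthonormal_system_def)
  have p: "square_integrable M p" unfolding p_def by (intro square_integrable_sum square_integrable_cmult e)
  have fp: "l2_inner M f p = (\<Sum>i\<in>I. cnj (a i) * l2_inner M f (e i))"
    unfolding p_def using assms(1) e by (simp add: l2_inner_sum_right square_integrable_cmult l2_inner_cmult_right)
  have "l2_inner M p p = (\<Sum>i\<in>I. a i * l2_inner M (e i) p)"
    unfolding p_def using p e by (subst l2_inner_sum_left) (auto simp: p_def[abs_def] square_integrable_cmult l2_inner_cmult_left)
  also have "\<dots> = (\<Sum>i\<in>I. a i * (\<Sum>j\<in>I. cnj (a j) * l2_inner M (e i) (e j)))"
    unfolding p_def using e by (simp add: l2_inner_sum_right square_integrable_cmult l2_inner_cmult_right)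
  also have "\<dots> = (\<Sum>i\<in>I. a i * cnj (a i))"
  proof (rule sum.cong[OF refl])
    fix i assume "i \<in> I"
    have "(\<Sum>j\<in>I. cnj (a j) * l2_inner M (e i) (e j)) = (\<Sum>j\<in>I. if j = i then cnj (a i) else 0)"
      using assms(2) by (intro sum.cong) (auto simp: orthonormal_system_def)
    then show "a i * (\<Sum>j\<in>I. cnj (a j) * l2_inner M (e i) (e j)) = a i * cnj (a i)"
      using \<open>i \<in> I\<close> assms(3) by simp
  qed
  also have "\<dots> = of_real (\<Sum>i\<in>I. (cmod (a i))\<^sup>2)" by (simp only: of_real_sum complex_norm_square)
  finally have pp: "l2_norm2 M p = (\<Sum>i\<in>I. (cmod (a i))\<^sup>2)"
    unfolding l2_inner_self of_real_eq_iff .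
  have "l2_norm2 M (\<lambda>t. f t + (-1) * p t) = l2_norm2 M f + (\<Sum>i\<in>I. (cmod (a i))\<^sup>2) - 2 * Re (\<Sum>i\<in>I. cnj (a i) * l2_inner M f (e i))"
    using l2_norm2_add[OF assms(1) square_integrable_cmult[OF p, of "-1"]] l2_norm2_cmult[of M "-1" p] l2_inner_cmult_right[of M f "-1" p]
    unfolding pp fp by (simp del: Re_sum times_complex.sel)
  also have "\<dots> = l2_norm2 M f + (\<Sum>i\<in>I. (cmod (a i))\<^sup>2 - 2 * Re (cnj (a i) * l2_inner M f (e i)))"
    by (simp only: sum_subtractf Re_sum sum_distrib_left)
  also have "(\<Sum>i\<in>I. (cmod (a i))\<^sup>2 - 2 * Re (cnj (a i) * l2_inner M f (e i))) = (\<Sum>i\<in>I. (cmod (l2_inner M f (e i) - a i))\<^sup>2 - (cmod (l2_inner M f (e i)))\<^sup>2)"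
  proof (rule sum.cong[OF refl])
    fix i
    show "(cmod (a i))\<^sup>2 - 2 * Re (cnj (a i) * l2_inner M f (e i)) = (cmod (l2_inner M f (e i) - a i))\<^sup>2 - (cmod (l2_inner M f (e i)))\<^sup>2"
      using cmod_add_square[of "l2_inner M f (e i)" "- a i"] by simp
  qed
  finally show ?thesis by (simp add: p_def sum_subtractf)
qed

lemma Bessel_finite:
  assumes "square_integrable M f" "orthonormal_system M e" "finite I"
  shows "(\<Sum>i\<in>I. (cmod (l2_inner M f (e i)))\<^sup>2) \<le> l2_norm2 M f"
  using l2_norm2_minus_combination[OF assms, of "\<lambda>i. l2_inner M f (e i)"] l2_norm2_nonneg[of M]
  by (metis (no_types, lifting) add.right_neutral cancel_comm_monoid_add_class.diff_cancel diff_ge_0_iff_ge norm_zero power_zero_numeral sum.neutral)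

text \<open>
  An approximation by any finite combination forces the projection onto the same span to be at least as
  good, so Bessel's inequality cannot lose mass.
\<close>

lemma Parseval_of_dense:
  assumes f: "square_integrable M f" and e: "orthonormal_system M e"
    and dense: "\<And>\<epsilon>. \<epsilon> > 0 \<Longrightarrow> \<exists>I a. finite I \<and> l2_norm2 M (\<lambda>t. f t - (\<Sum>i\<in>I. a i * e i t)) < \<epsilon>"
  shows "((\<lambda>i. (cmod (l2_inner M f (e i)))\<^sup>2) has_sum l2_norm2 M f) UNIV"
proof -
  let ?g = "\<lambda>i. (cmod (l2_inner M f (e i)))\<^sup>2"
  have s: "?g summable_on UNIV"
    by (rule nonneg_bdd_above_summable_on) (auto intro!: bdd_aboveI2[where M = "l2_norm2 M f"] Bessel_finite[OF f e])
  have "infsum ?g UNIV \<le> l2_norm2 M f"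
    by (rule infsum_le_finite_sums[OF s]) (auto intro: Bessel_finite[OF f e])
  moreover have "l2_norm2 M f \<le> infsum ?g UNIV"
  proof (rule field_le_epsilon)
    fix \<epsilon> :: real assume "\<epsilon> > 0"
    then obtain I a where I: "finite I" "l2_norm2 M (\<lambda>t. f t - (\<Sum>i\<in>I. a i * e i t)) < \<epsilon>"
      using dense by blast
    have "l2_norm2 M f \<le> sum ?g I + \<epsilon>"
      using I(2) l2_norm2_minus_combination[OF f e I(1), of a] sum_nonneg[of I "\<lambda>i. (cmod (l2_inner M f (e i) - a i))\<^sup>2"] by simp
    also have "sum ?g I \<le> infsum ?g UNIV"
      by (rule finite_sum_le_infsum[OF s]) (use I in auto)
    finally show "l2_norm2 M f \<le> infsum ?g UNIV + \<epsilon>" by simp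
  qed
  ultimately show ?thesis using s by (simp add: has_sum_iff)
qed

section \<open>Completeness of the exponentials on the unit interval\<close>

inductive trig_poly :: "(real \<Rightarrow> complex) \<Rightarrow> bool" where
  exponential: "trig_poly (\<lambda>t. c * cis (2 * pi * of_int m * t))"
| add: "trig_poly p \<Longrightarrow> trig_poly q \<Longrightarrow> trig_poly (\<lambda>t. p t + q t)"

lemma trig_poly_const: "trig_poly (\<lambda>t. c)"
  using trig_poly.exponential[of c 0] by simp

lemma trig_poly_mult_exponential:
  assumes "trig_poly q" shows "trig_poly (\<lambda>t. c * cis (2 * pi * of_int m * t) * q t)"
  using assms
proof induction
  case (exponential d n)
  have "trig_poly (\<lambda>t. (c * d) * cis (2 * pi * of_int (m + n) * t))" by (rule trig_poly.exponential)
  then show ?case by (simp add: algebra_simps flip: cis_mult)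
next
  case (add p q)
  from trig_poly.add[OF add.IH] show ?case by (simp add: algebra_simps)
qed

lemma trig_poly_mult:
  assumes "trig_poly p" "trig_poly q" shows "trig_poly (\<lambda>t. p t * q t)"
  using assms
proof induction
  case (exponential d n)
  then show ?case by (rule trig_poly_mult_exponential)
next
  case (add p p')
  from trig_poly.add[OF add.IH[OF add.prems]] show ?case by (simp add: algebra_simps)
qed

lemma trig_poly_continuous: "trig_poly p \<Longrightarrow> continuous_on A p"
  by (induction rule: trig_poly.induct) (intro continuous_intros | assumption)+

lemma trig_poly_expansion:
  assumes "trig_poly p"
  shows "\<exists>N a. \<forall>t. p t = (\<Sum>m\<in>{-int N..int N}. a m * cis (2 * pi * of_int m * t))"
  using assms
proof induction
  case (exponential c n)
  have "c * cis (2 * pi * of_int n * t) = (\<Sum>m\<in>{-int (nat \<bar>n\<bar>)..int (nat \<bar>n\<bar>)}. (if m = n then c else 0) * cis (2 * pi * of_int m * t))" for t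
    by (subst sum.mono_neutral_right[of _ "{n}"]) auto
  then show ?case by (intro exI[of _ "nat \<bar>n\<bar>"] exI[of _ "\<lambda>m. if m = n then c else 0"]) blast
next
  case (add p q)
  then obtain N a N' a' where
    1: "\<And>t. p t = (\<Sum>m\<in>{-int N..int N}. a m * cis (2 * pi * of_int m * t))" and
    2: "\<And>t. q t = (\<Sum>m\<in>{-int N'..int N'}. a' m * cis (2 * pi * of_int m * t))" by blast
  have ext: "(\<Sum>m\<in>{-int N..int N}. a m * cis (2 * pi * of_int m * t)) = 
     (\<Sum>m\<in>{-int (max N K)..int (max N K)}. (if \<bar>m\<bar> \<le> int N then a m else 0) * cis (2 * pi * of_int m * t))" for N K a t
    by (rule sum.mono_neutral_cong_left) auto
  show ?case
    unfolding 1 2 ext[where N = N and K = N'] ext[where N = N' and K = N] max.commute[of N' N]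
    by (intro exI[of _ "max N N'"] exI[of _ "\<lambda>m. (if \<bar>m\<bar> \<le> int N then a m else 0) + (if \<bar>m\<bar> \<le> int N' then a' m else 0)"])
      (simp add: sum.distrib[symmetric] distrib_right)
qed

text \<open>
  On the unit circle, \<open>cnj z\<close> is \<open>z ^ (- 1)\<close>, so polynomials in the real and the imaginary part of \<open>z\<close>
  become trigonometric polynomials.
\<close>

lemma trig_poly_real_polynomial_on_circle:
  fixes g :: "complex \<Rightarrow> real"
  assumes "real_polynomial_function g" shows "trig_poly (\<lambda>t. of_real (g (cis (2 * pi * t))))"
  using assms
proof induction
  case (linear f)
  interpret bounded_linear f by fact
  define A D where "A = complex_of_real (f 1) / 2" and "D = - \<i> * complex_of_real (f \<i>) / 2"
  have "complex_of_real (f z) = (A + D) * z + (A - D) * cnj z" for z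
  proof -
    have "z = Re z *\<^sub>R 1 + Im z *\<^sub>R \<i>" by (simp add: complex_eq_iff)
    then have "f z = Re z * f 1 + Im z * f \<i>" by (metis add scaleR real_scaleR_def)
    then have "complex_of_real (f z) = A * (z + cnj z) + D * (z - cnj z)"
      unfolding complex_add_cnj complex_diff_cnj by (simp add: A_def D_def complex_eq_iff)
    then show ?thesis by (simp add: algebra_simps)
  qed
  then have "(\<lambda>t. complex_of_real (f (cis (2 * pi * t)))) = 
    (\<lambda>t. (A + D) * cis (2 * pi * of_int 1 * t) + (A - D) * cis (2 * pi * of_int (-1) * t))"
    by (simp add: cis_cnj)
  moreover have "trig_poly \<dots>" by (intro trig_poly.intros)
  ultimately show ?case by simp
qed (auto intro: trig_poly_const trig_poly.add trig_poly_mult)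

lemma trig_poly_polynomial_on_circle:
  fixes g :: "complex \<Rightarrow> complex"
  assumes "polynomial_function g" shows "trig_poly (\<lambda>t. g (cis (2 * pi * t)))"
proof -
  have "real_polynomial_function (Re \<circ> g)" "real_polynomial_function (Im \<circ> g)"
    using assms bounded_linear_Re bounded_linear_Im unfolding polynomial_function_def by blast+
  note * = this[THEN trig_poly_real_polynomial_on_circle]
  from trig_poly.add[OF *(1) trig_poly_mult[OF trig_poly_const[of \<i>] *(2)]]
  show ?thesis by (simp flip: complex_eq)
qed

text \<open>
  A continuous function on the interval need not be periodic. Away from the endpoints it is
  a continuous function on an arc of the circle, which Tietze's theorem extends to the whole circle with the same
  bound; there the Stone-Weierstrass theorem applies.
\<close>

lemma trig_poly_approx_continuous:
  fixes h :: "real \<Rightarrow> complex"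
  assumes h: "continuous_on UNIV h" "\<And>t. cmod (h t) \<le> B" and d: "0 < \<delta>" and e: "0 < \<epsilon>"
  obtains p where "trig_poly p" "\<And>t. cmod (p t) \<le> B + \<epsilon>" "\<And>t. t \<in> {\<delta>..1-\<delta>} \<Longrightarrow> cmod (p t - h t) < \<epsilon>"
proof -
  have B: "0 \<le> B" by (rule order_trans[OF norm_ge_zero h(2)])
  let ?c = "\<lambda>t::real. cis (2 * pi * t)"
  define S where "S = ?c ` {\<delta>..1-\<delta>}"
  have S: "compact S" unfolding S_def by (intro compact_continuous_image continuous_intros) auto
  \<comment> \<open>On the arc \<open>S\<close>, which avoids the branch cut, \<open>h\<close> can be read as a function of \<open>z = cis (2 * pi * t)\<close>.\<close>
  have inv: "Arg2pi (?c t) / (2 * pi) = t" if "t \<in> {\<delta>..1-\<delta>}" for t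
  proof -
    have "2 * pi * t < 2 * pi * 1" using that d by (intro mult_strict_left_mono) auto
    then have "Arg2pi (?c t) = 2 * pi * t"
      using that d by (intro Arg2pi_unique[of 1]) (auto simp: cis_conv_exp)
    then show ?thesis by simp
  qed
  have "continuous_on S (\<lambda>z. Arg2pi z / (2 * pi))"
    unfolding S_def using inv by (intro continuous_on_inv) (auto intro!: continuous_intros)
  then have "continuous_on S (\<lambda>z. h (Arg2pi z / (2 * pi)))"
    by (intro continuous_on_compose2[OF h(1)]) auto
  from Tietze[OF this, of UNIV B] obtain F where F: "continuous_on UNIV F" 
    "\<And>z. z \<in> S \<Longrightarrow> F z = h (Arg2pi z / (2 * pi))" "\<And>z. cmod (F z) \<le> B"
    using S B h(2) compact_imp_closed[OF S] by auto
  obtain g where g: "polynomial_function g" "\<And>z. z \<in> sphere 0 1 \<Longrightarrow> cmod (F z - g z) < \<epsilon>"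
    using Stone_Weierstrass_polynomial_function[OF compact_sphere[of 0 1] continuous_on_subset[OF F(1) subset_UNIV] e] by auto
  have c: "?c t \<in> sphere 0 1" for t by simp
  show ?thesis
  proof
    show "trig_poly (\<lambda>t. g (?c t))" by (rule trig_poly_polynomial_on_circle[OF g(1)])
    show "cmod (g (?c t)) \<le> B + \<epsilon>" for t
    proof -
      have "cmod (g (?c t)) \<le> cmod (F (?c t)) + cmod (F (?c t) - g (?c t))" 
        using norm_triangle_ineq[of "F (?c t)" "g (?c t) - F (?c t)"] by (simp add: norm_minus_commute)
      also have "\<dots> \<le> B + \<epsilon>" using F(3)[of "?c t"] g(2)[OF c[of t]] by linarith
      finally show ?thesis .
    qed
    show "cmod (g (?c t) - h t) < \<epsilon>" if "t \<in> {\<delta>..1-\<delta>}" for t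
    proof -
      have "?c t \<in> S" using that by (auto simp: S_def)
      from F(2)[OF this] have "F (?c t) = h t" using inv[OF that] by simp
      then show ?thesis using g(2)[OF c[of t]] by (simp add: norm_minus_commute)
    qed
  qed
qed

text \<open>
  A measurable function is an almost everywhere limit of continuous ones. The excluded neighbourhoods of
  the endpoints shrink to the two points 0 and 1, a null set, and the uniform bound prepares
  for dominated convergence.
\<close>

lemma trig_poly_approx_bounded_measurable:
  fixes f :: "real \<Rightarrow> complex"
  assumes f: "f \<in> borel_measurable lebesgue" "\<And>t. cmod (f t) \<le> B"
  obtains p where "\<And>n::nat. trig_poly (p n)" "\<And>n t. cmod (p n t) \<le> B + 1" 
    "AE t in lebesgue_on {0..1}. (\<lambda>n. p n t) \<longlonglongrightarrow> f t"
proof -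
  have B: "0 \<le> B" by (rule order_trans[OF norm_ge_zero f(2)])
  from lebesgue_measurable_imp_measurable_on[OF f(1), of UNIV] obtain N g where
    N: "negligible N" and g: "\<And>n. continuous_on UNIV (g n)" "\<And>t. t \<notin> N \<Longrightarrow> (\<lambda>n. g n t) \<longlonglongrightarrow> f t"
    unfolding measurable_on_def by auto
  \<comment> \<open>Projecting the approximating continuous functions to the ball keeps the bound and does not disturb the limit.\<close>
  define h where "h n t = closest_point (cball 0 B) (g n t)" for n t
  have cl: "continuous_on UNIV (closest_point (cball (0::complex) B))"
    using B by (intro continuous_on_closest_point) auto
  have h: "continuous_on UNIV (h n)" for n
    unfolding h_def by (rule continuous_on_compose2[OF cl g(1)]) auto
  have hB: "cmod (h n t) \<le> B" for n t
    using closest_point_in_set[of "cball (0::complex) B" "g n t"] B by (simp add: h_def)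
  have hlim: "(\<lambda>n. h n t) \<longlonglongrightarrow> f t" if "t \<notin> N" for t
  proof -
    have "(\<lambda>n. closest_point (cball 0 B) (g n t)) \<longlonglongrightarrow> closest_point (cball 0 B) (f t)"
      by (rule continuous_on_tendsto_compose[OF cl g(2)[OF that]]) auto
    then show ?thesis using f(2)[of t] by (simp add: h_def closest_point_self)
  qed
  have "\<exists>p. trig_poly p \<and> (\<forall>t. cmod (p t) \<le> B + inverse (real (Suc n))) \<and> (\<forall>t\<in>{inverse (real (Suc n))..1-inverse (real (Suc n))}. cmod (p t - h n t) < inverse (real (Suc n)))" for n
    by (rule trig_poly_approx_continuous[OF h[of n] hB, of "inverse (real (Suc n))" "inverse (real (Suc n))"]) auto
  then obtain p where p: "\<And>n. trig_poly (p n)" "\<And>n t. cmod (p n t) \<le> B + inverse (real (Suc n))"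
    "\<And>n t. t \<in> {inverse (real (Suc n))..1-inverse (real (Suc n))} \<Longrightarrow> cmod (p n t - h n t) < inverse (real (Suc n))"
    by metis
  have lim: "(\<lambda>n. p n t) \<longlonglongrightarrow> f t" if t: "t \<notin> N \<union> {0, 1}" "t \<in> {0..1}" for t
  proof -
    have "min t (1 - t) > 0" using t by auto
    from order_tendstoD(2)[OF LIMSEQ_inverse_real_of_nat this]
    have "eventually (\<lambda>n. cmod (p n t - h n t) \<le> inverse (real (Suc n))) sequentially"
      by eventually_elim (use p(3) in \<open>auto intro!: less_imp_le\<close>)
    then have "(\<lambda>n. p n t - h n t) \<longlonglongrightarrow> 0"
      by (rule Lim_null_comparison[OF _ LIMSEQ_inverse_real_of_nat])
    from tendsto_add[OF this hlim[of t]] t show ?thesis by simp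
  qed
  have "negligible (N \<union> {0, 1})" using N by (simp add: negligible_Un)
  then have "N \<union> {0,1} \<in> null_sets lebesgue" by (simp add: negligible_iff_null_sets)
  then have "AE t in lebesgue. t \<notin> N \<union> {0,1}" by (rule AE_not_in)
  then have "AE t in lebesgue. t \<in> {0..1} \<longrightarrow> (\<lambda>n. p n t) \<longlonglongrightarrow> f t"
    by (rule eventually_mono) (use lim in blast)
  then have "AE t in lebesgue_on {0..1}. (\<lambda>n. p n t) \<longlonglongrightarrow> f t"
    by (subst AE_restrict_space_iff) simp_all
  moreover have "cmod (p n t) \<le> B + 1" for n t
    using p(2)[of n t] by (rule order_trans) (simp add: field_simps)
  ultimately show ?thesis using that p(1) by blast
qed

lemma square_integrable_bounded:
  fixes f :: "real \<Rightarrow> complex"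
  assumes "f \<in> borel_measurable (lebesgue_on {0..1})" "\<And>t. t \<in> {0..1} \<Longrightarrow> cmod (f t) \<le> B"
  shows "square_integrable (lebesgue_on {0..1}) f"
proof -
  have "integrable (lebesgue_on {0..1}) (\<lambda>t. (cmod (f t))\<^sup>2)"
  proof (rule Bochner_Integration.integrable_bound[where f = "\<lambda>_. B\<^sup>2"])
    show "(\<lambda>t. (cmod (f t))\<^sup>2) \<in> borel_measurable (lebesgue_on {0..1})"
      using assms(1) by measurable
    show "AE t in lebesgue_on {0..1}. norm ((cmod (f t))\<^sup>2) \<le> norm (B\<^sup>2)"
      by (rule AE_I2) (use assms(2) in \<open>auto intro: power_mono\<close>)
  qed simp
  then show ?thesis using assms(1) by (simp add: square_integrable_def)
qed

lemma square_integrable_continuous: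
  fixes f :: "real \<Rightarrow> complex"
  assumes "continuous_on {0..1} f"
  shows "square_integrable (lebesgue_on {0..1}) f"
proof -
  have "bounded (f ` {0..1})" by (intro compact_imp_bounded compact_continuous_image assms) auto
  then obtain B where "\<forall>t\<in>{0..1}. cmod (f t) \<le> B" unfolding bounded_iff by blast
  with continuous_imp_measurable_on_sets_lebesgue[OF assms] show ?thesis
    by (intro square_integrable_bounded) auto
qed

lemma trig_poly_dense_bounded:
  fixes f :: "real \<Rightarrow> complex"
  assumes f: "f \<in> borel_measurable lebesgue" "\<And>t. cmod (f t) \<le> B" and e: "\<epsilon> > 0"
  shows "\<exists>p. trig_poly p \<and> l2_norm2 (lebesgue_on {0..1}) (\<lambda>t. f t - p t) < \<epsilon>"
proof -
  obtain p where p: "\<And>n::nat. trig_poly (p n)" "\<And>n t. cmod (p n t) \<le> B + 1" 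
    "AE t in lebesgue_on {0..1}. (\<lambda>n. p n t) \<longlonglongrightarrow> f t"
    using trig_poly_approx_bounded_measurable[OF f] by blast
  have [measurable]: "f \<in> borel_measurable (lebesgue_on {0..1})"
    by (rule measurable_restrict_space1[OF f(1)])
  have [measurable]: "p n \<in> borel_measurable (lebesgue_on {0..1})" for n
    by (rule continuous_imp_measurable_on_sets_lebesgue[OF trig_poly_continuous[OF p(1)]]) simp
  have "(\<lambda>n. LINT t|lebesgue_on {0..1}. (cmod (f t - p n t))\<^sup>2) \<longlonglongrightarrow> (LINT t|lebesgue_on {0..1::real}. 0)"
  proof (rule integral_dominated_convergence[where w = "\<lambda>_. (2 * B + 1)\<^sup>2"])
    show "AE t in lebesgue_on {0..1}. (\<lambda>n. (cmod (f t - p n t))\<^sup>2) \<longlonglongrightarrow> 0"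
      using p(3)
    proof eventually_elim
      case (elim t)
      have "(\<lambda>n. (cmod (f t - p n t))\<^sup>2) \<longlonglongrightarrow> (cmod (f t - f t))\<^sup>2" by (intro tendsto_intros elim)
      then show ?case by simp
    qed
    show "AE t in lebesgue_on {0..1}. norm ((cmod (f t - p n t))\<^sup>2) \<le> (2 * B + 1)\<^sup>2" for n
    proof (rule AE_I2)
      fix t
      have "cmod (f t - p n t) \<le> 2 * B + 1"
        using norm_triangle_ineq4[of "f t" "p n t"] f(2)[of t] p(2)[of n t] by linarith
      then show "norm ((cmod (f t - p n t))\<^sup>2) \<le> (2 * B + 1)\<^sup>2" by (simp add: power_mono)
    qed
    show "(\<lambda>t. (cmod (f t - p n t))\<^sup>2) \<in> borel_measurable (lebesgue_on {0..1})" for n by measurable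
  qed simp_all
  then have "(\<lambda>n. l2_norm2 (lebesgue_on {0..1}) (\<lambda>t. f t - p n t)) \<longlonglongrightarrow> 0" by (simp add: l2_norm2_def)
  from order_tendstoD(2)[OF this e] have "\<exists>n. l2_norm2 (lebesgue_on {0..1}) (\<lambda>t. f t - p n t) < \<epsilon>"
    by (intro eventually_happens'[OF sequentially_bot])
  then show ?thesis using p(1) by blast
qed

lemma trig_poly_dense:
  fixes f :: "real \<Rightarrow> complex"
  assumes f: "square_integrable (lebesgue_on {0..1}) f" and e: "\<epsilon> > 0"
  shows "\<exists>p. trig_poly p \<and> l2_norm2 (lebesgue_on {0..1}) (\<lambda>t. f t - p t) < \<epsilon>"
proof -
  define f' where "f' t = (if t \<in> {0..1} then f t else 0)" for t
  have fm [measurable]: "f \<in> borel_measurable (lebesgue_on {0..1})" using f by (simp add: square_integrable_def)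
  then have [measurable]: "f' \<in> borel_measurable lebesgue"
    unfolding f'_def[abs_def] by (subst borel_measurable_if) auto
  \<comment> \<open>Truncation reduces the claim to bounded functions.\<close>
  define fk where "fk k t = (if cmod (f' t) \<le> real k then f' t else 0)" for k :: nat and t
  have fkm [measurable]: "fk k \<in> borel_measurable lebesgue" for k unfolding fk_def[abs_def] by measurable
  have fkm' [measurable]: "fk k \<in> borel_measurable (lebesgue_on {0..1})" for k
    by (rule measurable_restrict_space1[OF fkm])
  have "(\<lambda>k. LINT t|lebesgue_on {0..1}. (cmod (f t - fk k t))\<^sup>2) \<longlonglongrightarrow> (LINT t|lebesgue_on {0..1::real}. 0)"
  proof (rule integral_dominated_convergence[where w = "\<lambda>t. (cmod (f t))\<^sup>2"])
    show "AE t in lebesgue_on {0..1}. (\<lambda>k. (cmod (f t - fk k t))\<^sup>2) \<longlonglongrightarrow> 0"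
    proof (rule AE_I2)
      fix t assume t: "t \<in> space (lebesgue_on {0..1::real})"
      have "eventually (\<lambda>k. (cmod (f t - fk k t))\<^sup>2 = 0) sequentially"
        using eventually_ge_at_top[of "nat \<lceil>cmod (f t)\<rceil>"]
        by eventually_elim (use t in \<open>auto simp: fk_def f'_def ceiling_le_iff nat_le_iff\<close>)
      then show "(\<lambda>k. (cmod (f t - fk k t))\<^sup>2) \<longlonglongrightarrow> 0" by (rule tendsto_eventually)
    qed
    show "AE t in lebesgue_on {0..1}. norm ((cmod (f t - fk k t))\<^sup>2) \<le> (cmod (f t))\<^sup>2" for k
      by (rule AE_I2) (auto simp: fk_def f'_def)
    show "(\<lambda>t. (cmod (f t - fk k t))\<^sup>2) \<in> borel_measurable (lebesgue_on {0..1})" for k by measurable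
  qed (use f in \<open>simp_all add: square_integrable_def\<close>)
  then have "(\<lambda>k. l2_norm2 (lebesgue_on {0..1}) (\<lambda>t. f t - fk k t)) \<longlonglongrightarrow> 0" by (simp add: l2_norm2_def)
  from order_tendstoD(2)[OF this, of "\<epsilon> / 4"] e have "\<exists>k. l2_norm2 (lebesgue_on {0..1}) (\<lambda>t. f t - fk k t) < \<epsilon> / 4"
    by (intro eventually_happens'[OF sequentially_bot]) simp
  then obtain k where k: "l2_norm2 (lebesgue_on {0..1}) (\<lambda>t. f t - fk k t) < \<epsilon> / 4" by blast
  have kb: "cmod (fk k t) \<le> real k" for t by (simp add: fk_def)
  obtain p where p: "trig_poly p" "l2_norm2 (lebesgue_on {0..1}) (\<lambda>t. fk k t - p t) < \<epsilon> / 4"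
    using trig_poly_dense_bounded[OF fkm kb, of "\<epsilon> / 4"] e by auto
  have sk: "square_integrable (lebesgue_on {0..1}) (fk k)"
    by (rule square_integrable_bounded[OF fkm' kb])
  have sp: "square_integrable (lebesgue_on {0..1}) p"
    by (rule square_integrable_continuous[OF trig_poly_continuous[OF p(1)]])
  have "l2_norm2 (lebesgue_on {0..1}) (\<lambda>t. (f t - fk k t) + (fk k t - p t)) < \<epsilon>"
    using l2_norm2_add_le[OF square_integrable_diff[OF f sk] square_integrable_diff[OF sk sp]] k p(2) by linarith
  then show ?thesis using p(1) by auto
qed

definition fourier_exp :: "real \<Rightarrow> int \<Rightarrow> real \<Rightarrow> complex" where
  "fourier_exp \<nu> m t = cis (2 * pi * (of_int m + \<nu>) * t)"

lemma integral_cis_int: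
  "(LINT t|lebesgue_on {0..1}. cis (2 * pi * of_int k * t)) = (if k = 0 then 1 else 0)"
proof (cases "k = 0")
  case True
  then show ?thesis by (simp add: measure_restrict_space)
next
  case False
  define c where "c = 2 * pi * real_of_int k"
  have c: "c \<noteq> 0" using False by (simp add: c_def)
  have "((\<lambda>t. cis (c * t)) has_integral (- \<i> / c * cis (c * 1) - - \<i> / c * cis (c * 0))) {0..1}"
  proof (rule fundamental_theorem_of_calculus)
    fix t :: real
    have "((\<lambda>z. - \<i> / c * exp (\<i> * c * z)) has_field_derivative exp (\<i> * c * of_real t)) (at (of_real t))"
      using c by (auto intro!: derivative_eq_intros)
    from has_vector_derivative_real_field[OF this]
    show "((\<lambda>t. - \<i> / c * cis (c * t)) has_vector_derivative cis (c * t)) (at t within {0..1})"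
      by (simp add: cis_conv_exp mult.assoc)
  qed simp
  moreover have "cis c = 1" unfolding c_def by (rule cis_multiple_2pi) simp
  ultimately have "((\<lambda>t. cis (c * t)) has_integral 0) {0..1}" by simp
  moreover have "integrable (lebesgue_on {0..1}) (\<lambda>t. cis (c * t))"
    by (rule continuous_imp_integrable_real) (intro continuous_intros)
  ultimately show ?thesis using False by (simp add: lebesgue_integral_eq_integral integral_unique c_def)
qed

lemma orthonormal_fourier_exp: "orthonormal_system (lebesgue_on {0..1}) (fourier_exp \<nu>)"
  unfolding orthonormal_system_def
proof safe
  show "square_integrable (lebesgue_on {0..1}) (fourier_exp \<nu> i)" for i
    unfolding fourier_exp_def[abs_def] by (intro square_integrable_continuous continuous_intros)
  fix i j
  have "fourier_exp \<nu> i t * cnj (fourier_exp \<nu> j t) = cis (2 * pi * of_int (i - j) * t)" for t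
    by (simp add: fourier_exp_def cis_cnj cis_mult algebra_simps)
  then show "l2_inner (lebesgue_on {0..1}) (fourier_exp \<nu> i) (fourier_exp \<nu> j) = (if i = j then 1 else 0)"
    unfolding l2_inner_def using integral_cis_int[of "i - j"] by simp
qed

theorem Parseval_fourier_exp:
  assumes "square_integrable (lebesgue_on {0..1}) f"
  shows "((\<lambda>m. (cmod (l2_inner (lebesgue_on {0..1}) f (fourier_exp \<nu> m)))\<^sup>2) has_sum l2_norm2 (lebesgue_on {0..1}) f) UNIV"
proof (rule Parseval_of_dense[OF assms orthonormal_fourier_exp])
  fix \<epsilon> :: real assume e: "\<epsilon> > 0"
  \<comment> \<open>Multiplying by \<open>cis (- 2 * pi * \<nu> * t)\<close> is an isometry that turns \<open>fourier_exp \<nu>\<close> into the ordinary exponentials.\<close>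
  define g where "g t = cis (- 2 * pi * \<nu> * t) * f t" for t
  have fm: "f \<in> borel_measurable (lebesgue_on {0..1})" using assms by (simp add: square_integrable_def)
  have "(\<lambda>t. cis (- 2 * pi * \<nu> * t)) \<in> borel_measurable (lebesgue_on {0..1})"
    by (intro continuous_imp_measurable_on_sets_lebesgue continuous_intros) simp
  with fm have "g \<in> borel_measurable (lebesgue_on {0..1})" unfolding g_def[abs_def] by simp
  then have "square_integrable (lebesgue_on {0..1}) g"
    using assms by (simp add: square_integrable_def g_def norm_mult)
  from trig_poly_dense[OF this e] obtain p where p: "trig_poly p" "l2_norm2 (lebesgue_on {0..1}) (\<lambda>t. g t - p t) < \<epsilon>"
    by blast
  from trig_poly_expansion[OF p(1)] obtain N a where
    a: "\<And>t. p t = (\<Sum>m\<in>{-int N..int N}. a m * cis (2 * pi * of_int m * t))" by blast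
  have "cmod (g t - p t) = cmod (f t - (\<Sum>m\<in>{-int N..int N}. a m * fourier_exp \<nu> m t))" for t
  proof -
    have "f t - (\<Sum>m\<in>{-int N..int N}. a m * fourier_exp \<nu> m t) = cis (2 * pi * \<nu> * t) * (g t - p t)"
    proof -
      have 1: "fourier_exp \<nu> m t = cis (2 * pi * \<nu> * t) * cis (2 * pi * of_int m * t)" for m
        by (simp add: fourier_exp_def cis_mult algebra_simps)
      have 2: "cis (2 * pi * \<nu> * t) * g t = f t" by (simp add: g_def cis_mult flip: mult.assoc)
      show ?thesis unfolding 1 right_diff_distrib 2 a sum_distrib_left by (simp add: mult.left_commute)
    qed
    then show ?thesis by (simp add: norm_mult)
  qed
  then show "\<exists>I a. finite I \<and> l2_norm2 (lebesgue_on {0..1}) (\<lambda>t. f t - (\<Sum>i\<in>I. a i * fourier_exp \<nu> i t)) < \<epsilon>"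
    using p(2) unfolding l2_norm2_def by (intro exI[of _ "{-int N..int N}"] exI[of _ a]) simp
qed

text \<open>
  Polarization of the identity for norms, applied both to the functions and to their coefficients.
\<close>

lemma Parseval_fourier_exp_inner:
  assumes "square_integrable (lebesgue_on {0..1}) f" "square_integrable (lebesgue_on {0..1}) g"
  shows "((\<lambda>m. l2_inner (lebesgue_on {0..1}) f (fourier_exp \<nu> m) * cnj (l2_inner (lebesgue_on {0..1}) g (fourier_exp \<nu> m))) 
     has_sum l2_inner (lebesgue_on {0..1}) f g) UNIV"
proof -
  let ?M = "lebesgue_on {0..1::real}"
  let ?c = "\<lambda>f m. l2_inner ?M f (fourier_exp \<nu> m)"
  have e: "square_integrable ?M (fourier_exp \<nu> m)" for m 
    using orthonormal_fourier_exp by (simp add: orthonormal_system_def)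
  have lin: "?c (\<lambda>t. f t + z * g t) m = ?c f m + z * ?c g m" for z m
    using l2_inner_add_left[OF assms(1) square_integrable_cmult[OF assms(2)] e] by (simp add: l2_inner_cmult_left)
  have P: "((\<lambda>m. complex_of_real ((cmod (?c f m + z * ?c g m))\<^sup>2)) has_sum of_real (l2_norm2 ?M (\<lambda>t. f t + z * g t))) UNIV" for z
    using has_sum_of_real[OF Parseval_fourier_exp[OF square_integrable_add[OF assms(1) square_integrable_cmult[OF assms(2), of z]], of \<nu>]] by (simp only: lin)
  have "((\<lambda>m. complex_of_real ((cmod (?c f m + 1 * ?c g m))\<^sup>2) + (- 1) * complex_of_real ((cmod (?c f m + (-1) * ?c g m))\<^sup>2)
    + \<i> * complex_of_real ((cmod (?c f m + \<i> * ?c g m))\<^sup>2) + (- \<i>) * complex_of_real ((cmod (?c f m + (-\<i>) * ?c g m))\<^sup>2)) has_sum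
    (of_real (l2_norm2 ?M (\<lambda>t. f t + 1 * g t)) + (- 1) * of_real (l2_norm2 ?M (\<lambda>t. f t + (-1) * g t))
     + \<i> * of_real (l2_norm2 ?M (\<lambda>t. f t + \<i> * g t)) + (- \<i>) * of_real (l2_norm2 ?M (\<lambda>t. f t + (-\<i>) * g t)))) UNIV"
    by (intro has_sum_add has_sum_cmult_right P)
  also have "(of_real (l2_norm2 ?M (\<lambda>t. f t + 1 * g t)) + (- 1) * of_real (l2_norm2 ?M (\<lambda>t. f t + (-1) * g t))
     + \<i> * of_real (l2_norm2 ?M (\<lambda>t. f t + \<i> * g t)) + (- \<i>) * of_real (l2_norm2 ?M (\<lambda>t. f t + (-\<i>) * g t))) = 4 * l2_inner ?M f g"
    unfolding l2_inner_polarization[OF assms] by simp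
  also have "(\<lambda>m. complex_of_real ((cmod (?c f m + 1 * ?c g m))\<^sup>2) + (- 1) * complex_of_real ((cmod (?c f m + (-1) * ?c g m))\<^sup>2)
    + \<i> * complex_of_real ((cmod (?c f m + \<i> * ?c g m))\<^sup>2) + (- \<i>) * complex_of_real ((cmod (?c f m + (-\<i>) * ?c g m))\<^sup>2)) = (\<lambda>m. 4 * (?c f m * cnj (?c g m)))"
    unfolding polarization_complex by simp
  finally show ?thesis by (subst (asm) has_sum_cmult_right_iff) auto
qed

section \<open>Fourier transforms of polynomials times the Gaussian\<close>

definition gaussian :: "real \<Rightarrow> real" where "gaussian t = exp (- pi * t\<^sup>2)"

lemma gaussian_normal_density: "gaussian t = normal_density 0 (1 / sqrt (2 * pi)) t"
  by (simp add: gaussian_def normal_density_def power_divide)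

lemma integrable_gaussian_moment: "integrable lborel (\<lambda>t. gaussian t * t ^ k)"
  unfolding gaussian_normal_density using integrable_normal_moment[of "1 / sqrt (2 * pi)" 0 k] by simp

text \<open>
  Simple exponential decay is all that Schur's test and the periodization need.
\<close>

lemma power_gaussian_le: "\<bar>t\<bar> ^ k * gaussian t \<le> fact k * exp 1 * exp (- \<bar>t\<bar>)"
proof -
  have "\<bar>t\<bar> ^ k * gaussian t \<le> (fact k * exp \<bar>t\<bar>) * gaussian t"
    by (intro mult_right_mono power_le_fact_exp) (auto simp: gaussian_def)
  also have "\<dots> = fact k * exp (\<bar>t\<bar> - pi * t\<^sup>2)" by (simp add: gaussian_def exp_diff exp_minus field_simps)
  also have "\<dots> \<le> fact k * exp (1 - \<bar>t\<bar>)"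
  proof -
    have "2 * \<bar>t\<bar> \<le> t\<^sup>2 + 1" using sum_squares_bound[of "\<bar>t\<bar>" 1] by simp
    moreover have "1 * t\<^sup>2 \<le> pi * t\<^sup>2" using pi_gt3 by (intro mult_right_mono) auto
    ultimately have "\<bar>t\<bar> - pi * t\<^sup>2 \<le> 1 - \<bar>t\<bar>" by linarith
    then show ?thesis by simp
  qed
  also have "\<dots> = fact k * exp 1 * exp (- \<bar>t\<bar>)" by (simp add: exp_diff exp_minus field_simps)
  finally show ?thesis .
qed

lemma poly_gaussian_le:
  fixes q :: "complex poly"
  obtains C where "0 < C" "\<And>t. cmod (poly q (of_real t) * of_real (gaussian t)) \<le> C * exp (- \<bar>t\<bar>)"
proof
  let ?C = "(\<Sum>k\<le>degree q. cmod (coeff q k) * (fact k * exp 1)) + 1"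
  show "0 < ?C" by (intro add_nonneg_pos sum_nonneg) auto
  fix t
  have "cmod (poly q (of_real t) * of_real (gaussian t)) = cmod (\<Sum>k\<le>degree q. coeff q k * of_real t ^ k * of_real (gaussian t))"
    by (simp add: poly_altdef sum_distrib_right)
  also have "\<dots> \<le> (\<Sum>k\<le>degree q. cmod (coeff q k) * (\<bar>t\<bar> ^ k * gaussian t))"
    by (intro sum_norm_le) (auto simp: norm_mult norm_power gaussian_def)
  also have "\<dots> \<le> (\<Sum>k\<le>degree q. cmod (coeff q k) * (fact k * exp 1 * exp (- \<bar>t\<bar>)))"
    by (intro sum_mono mult_left_mono power_gaussian_le) auto
  also have "\<dots> = (\<Sum>k\<le>degree q. cmod (coeff q k) * (fact k * exp 1)) * exp (- \<bar>t\<bar>)"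
    by (simp add: sum_distrib_right mult.assoc)
  also have "\<dots> \<le> ?C * exp (- \<bar>t\<bar>)" by (intro mult_right_mono) auto
  finally show "cmod (poly q (of_real t) * of_real (gaussian t)) \<le> ?C * exp (- \<bar>t\<bar>)" .
qed

definition fourier_transform :: "(real \<Rightarrow> complex) \<Rightarrow> real \<Rightarrow> complex" where
  "fourier_transform g y = (LINT t|lborel. g t * cis (- 2 * pi * y * t))"

lemma integrable_cis_mult:
  assumes "integrable lborel g" shows "integrable lborel (\<lambda>t. g t * cis (a * t))"
proof (rule Bochner_Integration.integrable_bound[OF assms])
  have "(\<lambda>t. cis (a * t)) \<in> borel_measurable lborel"
    by (simp, intro borel_measurable_continuous_onI continuous_intros)
  then show "(\<lambda>t. g t * cis (a * t)) \<in> borel_measurable lborel" using assms by simp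
qed (simp add: norm_mult)

lemma integrable_moment_complex: "integrable lborel (\<lambda>t. of_real (t ^ k * gaussian t) :: complex)"
  using integrable_gaussian_moment[of k] by (intro integrable_of_real) (simp add: mult.commute)

lemma fourier_transform_gaussian: "fourier_transform (\<lambda>t. of_real (gaussian t)) y = of_real (gaussian y)"
proof -
  \<comment> \<open>The scaling that turns \<open>gaussian\<close> into the standard normal density.\<close>
  define s where "s = sqrt (2 * pi)"
  have s: "s > 0" "s\<^sup>2 = 2 * pi" by (auto simp: s_def)
  have "of_real (gaussian y) = char std_normal_distribution (- s * y)"
    unfolding char_std_normal_distribution using s by (simp add: gaussian_def power_mult_distrib)
  also have "\<dots> = (LINT x|lborel. std_normal_density x *\<^sub>R cis (- s * y * x))"
    unfolding char_def by (subst integral_density) (auto simp: cis_conv_exp)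
  also have "\<dots> = s *\<^sub>R (LINT t|lborel. std_normal_density (0 + s * t) *\<^sub>R cis (- s * y * (0 + s * t)))"
    using lborel_integral_real_affine[of s "\<lambda>x. std_normal_density x *\<^sub>R cis (- s * y * x)" 0] s by simp
  also have "\<dots> = (LINT t|lborel. of_real (gaussian t) * cis (- 2 * pi * y * t))"
    unfolding integral_scaleR_right[symmetric]
  proof (intro Bochner_Integration.integral_cong refl)
    fix t
    have "s * std_normal_density (s * t) = gaussian t"
      using s by (simp add: normal_density_def gaussian_def power_mult_distrib s_def)
    moreover have "- s * y * (s * t) = - (s\<^sup>2) * y * t" by (simp add: power2_eq_square)
    then have "- s * y * (s * t) = - 2 * pi * y * t" unfolding s(2) by simp
    ultimately show "s *\<^sub>R std_normal_density (0 + s * t) *\<^sub>R cis (- s * y * (0 + s * t)) = of_real (gaussian t) * cis (- 2 * pi * y * t)"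
      by (simp only: add_0 scaleR_scaleR) (simp add: scaleR_conv_of_real)
  qed
  finally show ?thesis by (simp add: fourier_transform_def)
qed

lemma lborel_integral_derivative_eq_0:
  fixes F :: "real \<Rightarrow> complex"
  assumes d: "\<And>t. (F has_vector_derivative f t) (at t)" and c: "\<And>t. isCont f t" and i: "integrable lborel f"
    and l: "(F \<longlongrightarrow> 0) at_top" "(F \<longlongrightarrow> 0) at_bot"
  shows "(LINT t|lborel. f t) = 0"
proof -
  have "(LBINT t=-\<infinity>..\<infinity>. f t) = 0 - 0"
    by (rule interval_integral_FTC_integrable[where F = F])
      (use assms in \<open>auto simp: ereal_tendsto_simps set_integrable_def einterval_def\<close>)
  then show ?thesis by (simp add: interval_lebesgue_integral_def einterval_def set_lebesgue_integral_def)
qed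

text \<open>
  Integration by parts: the derivative of \<open>t ^ k * gaussian t * cis (- 2 * pi * y * t)\<close>
  has integral zero. For \<open>k = 0\<close> the first summand on the right has the coefficient 0.
\<close>

lemma fourier_transform_moment_rec:
  "fourier_transform (\<lambda>t. of_real (t ^ Suc k * gaussian t)) y =
    of_real (real k / (2 * pi)) * fourier_transform (\<lambda>t. of_real (t ^ (k - 1) * gaussian t)) y
     - \<i> * of_real y * fourier_transform (\<lambda>t. of_real (t ^ k * gaussian t)) y"
proof -
  define c where "c t = cis (- 2 * pi * y * t)" for t
  define u where "u k t = complex_of_real (t ^ k * gaussian t) * c t" for k t
  have iu: "integrable lborel (u k)" for k
    unfolding u_def[abs_def] c_def by (rule integrable_cis_mult[OF integrable_moment_complex])
  \<comment> \<open>\<open>f\<close> is the derivative of \<open>u k\<close>, whose integral vanishes.\<close>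
  define f where "f t = of_nat k * u (k - 1) t - of_real (2 * pi) * u (Suc k) t - \<i> * of_real (2 * pi * y) * u k t" for t
  have nu: "cmod (u k t) \<le> fact k * exp 1 * exp (- \<bar>t\<bar>)" for k t
    using power_gaussian_le[of t k] by (simp add: u_def c_def norm_mult norm_power gaussian_def)
  define A where "A = \<i> * complex_of_real (- 2 * pi * y)"
  define E where "E z = exp (- of_real pi * z\<^sup>2 + A * z)" for z
  have E: "E (of_real t) = of_real (gaussian t) * c t" for t
  proof -
    have 1: "- of_real pi * (of_real t)\<^sup>2 = complex_of_real (- pi * t\<^sup>2)" 
      and 2: "A * of_real t = \<i> * complex_of_real (- 2 * pi * y * t)" by (simp_all add: A_def)
    show ?thesis unfolding E_def exp_add 1 2 exp_of_real by (simp only: c_def cis_conv_exp gaussian_def)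
  qed
  have eq: "of_real t ^ j * E (of_real t) = u j t" for j t
    unfolding E u_def by (simp only: of_real_mult of_real_power mult.assoc)
  have "(LINT t|lborel. f t) = 0"
  proof (rule lborel_integral_derivative_eq_0[where F = "u k"])
    fix t
    have "(E has_field_derivative E z * (- of_real pi * (2 * z) + A)) (at z)" for z
      unfolding E_def[abs_def] by (auto intro!: derivative_eq_intros)
    from DERIV_mult[OF DERIV_power[OF DERIV_ident] this]
    have "((\<lambda>z. z ^ k * E z) has_field_derivative of_nat k * (z ^ (k - Suc 0) * E z) + E z * (- of_real pi * (2 * z) + A) * z ^ k) (at z)" for z
      by (simp add: mult.assoc)
    from has_vector_derivative_real_field[OF this]
    have d: "(u k has_vector_derivative of_nat k * u (k - 1) t + E (of_real t) * (- of_real pi * (2 * of_real t) + A) * of_real t ^ k) (at t)"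
      unfolding eq by simp
    have "E (of_real t) * (- of_real pi * (2 * of_real t) + A) * of_real t ^ k = 
       - of_real (2 * pi) * (of_real t ^ Suc k * E (of_real t)) + A * (of_real t ^ k * E (of_real t))"
      by (simp add: algebra_simps)
    also have "\<dots> = - of_real (2 * pi) * u (Suc k) t - \<i> * of_real (2 * pi * y) * u k t" 
      unfolding eq by (simp add: A_def)
    finally have "of_nat k * u (k - 1) t + E (of_real t) * (- of_real pi * (2 * of_real t) + A) * of_real t ^ k = f t"
      unfolding f_def by (simp only: mult_minus_left diff_conv_add_uminus add.assoc)
    with d show "(u k has_vector_derivative f t) (at t)" by (simp only:)
  next
    have "continuous_on UNIV f"
      unfolding f_def[abs_def] u_def c_def gaussian_def by (intro continuous_intros)
    then show "isCont f t" for t by (simp add: continuous_on_eq_continuous_at)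
    show "integrable lborel f" unfolding f_def[abs_def]
      by (intro Bochner_Integration.integrable_diff integrable_mult_right iu)
    have "filterlim (\<lambda>t::real. - norm t) at_bot at_infinity"
      using filterlim_norm_at_top by (simp only: filterlim_uminus_at_top)
    then have "((\<lambda>t::real. exp (- norm t)) \<longlongrightarrow> 0) at_infinity"
      by (rule filterlim_compose[OF exp_at_bot])
    from tendsto_mult_right_zero[OF this, of "fact k * exp 1"]
    have "((\<lambda>t::real. fact k * exp 1 * exp (- \<bar>t\<bar>)) \<longlongrightarrow> 0) at_infinity" by simp
    then have inf: "(u k \<longlongrightarrow> 0) at_infinity" by (rule Lim_null_comparison[rotated]) (use nu in simp)
    show "(u k \<longlongrightarrow> 0) at_top" by (rule tendsto_mono[OF at_top_le_at_infinity inf])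
    show "(u k \<longlongrightarrow> 0) at_bot" by (rule tendsto_mono[OF at_bot_le_at_infinity inf])
  qed
  moreover have "(LINT t|lborel. f t) = of_nat k * integral\<^sup>L lborel (u (k - 1)) - of_real (2 * pi) * integral\<^sup>L lborel (u (Suc k)) - \<i> * of_real (2 * pi * y) * integral\<^sup>L lborel (u k)"
    unfolding f_def[abs_def] using iu by simp
  moreover have "integral\<^sup>L lborel (u k) = fourier_transform (\<lambda>t. of_real (t ^ k * gaussian t)) y" for k
    by (simp add: u_def[abs_def] c_def fourier_transform_def)
  ultimately have "of_nat k * a - of_real (2 * pi) * b - \<i> * of_real (2 * pi * y) * c = 0" 
    if "a = fourier_transform (\<lambda>t. of_real (t ^ (k - 1) * gaussian t)) y" "b = fourier_transform (\<lambda>t. of_real (t ^ Suc k * gaussian t)) y"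
      "c = fourier_transform (\<lambda>t. of_real (t ^ k * gaussian t)) y" for a b c
    using that by simp
  note 1 = this[OF refl refl refl]
  have "b = of_real (real k / (2 * pi)) * a - \<i> * of_real y * c" 
    if "of_nat k * a - of_real (2 * pi) * b - \<i> * of_real (2 * pi * y) * c = 0" for a b c
  proof -
    have "b = (of_real (2 * pi) * b) / of_real (2 * pi)" by simp
    also have "of_real (2 * pi) * b = of_nat k * a - \<i> * of_real (2 * pi * y) * c" using that by (simp add: algebra_simps)
    finally show ?thesis by (simp add: diff_divide_distrib)
  qed
  from this[OF 1] show ?thesis .
qed

text \<open>
  The recurrence multiplies the leading coefficient by \<open>- \<i>\<close> in each step; in particular it
  never vanishes.
\<close>

lemma fourier_transform_moment:
  "\<exists>P :: complex poly. degree P \<le> k \<and> coeff P k = (- \<i>) ^ k \<and> 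
     (\<forall>y. fourier_transform (\<lambda>t. of_real (t ^ k * gaussian t)) y = poly P (of_real y) * of_real (gaussian y))"
proof (induction k rule: less_induct)
  case (less k)
  show ?case
  proof (cases k)
    case 0
    then show ?thesis using fourier_transform_gaussian by (intro exI[of _ 1]) simp
  next
    case (Suc j)
    have "j < k" "j - 1 < k" using Suc by auto
    from less.IH[OF this(1)] obtain P where P: "degree P \<le> j" "coeff P j = (- \<i>) ^ j" 
      "\<And>y. fourier_transform (\<lambda>t. of_real (t ^ j * gaussian t)) y = poly P (of_real y) * of_real (gaussian y)"
      by blast
    from less.IH[OF \<open>j - 1 < k\<close>] obtain P' where P': "degree P' \<le> j - 1" 
      "\<And>y. fourier_transform (\<lambda>t. of_real (t ^ (j - 1) * gaussian t)) y = poly P' (of_real y) * of_real (gaussian y)"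
      by blast
    let ?R = "smult (of_real (real j / (2 * pi))) P' - smult \<i> (pCons 0 P)"
    show ?thesis
    proof (intro exI[of _ ?R] conjI allI)
      have "degree (smult (of_real (real j / (2 * pi))) P') \<le> k" using P'(1) Suc by (intro order_trans[OF degree_smult_le]) simp
      moreover have "degree (smult \<i> (pCons 0 P)) \<le> k" using P(1) Suc by (intro order_trans[OF degree_smult_le]) (simp add: degree_pCons_le order_trans[OF degree_pCons_le])
      ultimately show "degree ?R \<le> k" by (rule degree_diff_le)
      have "coeff P' k = 0" using P'(1) Suc by (intro coeff_eq_0) simp
      then show "coeff ?R k = (- \<i>) ^ k" using P(2) Suc by simp
      show "fourier_transform (\<lambda>t. of_real (t ^ k * gaussian t)) y = poly ?R (of_real y) * of_real (gaussian y)" for y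
        unfolding Suc fourier_transform_moment_rec P(3) P'(2) by (simp add: algebra_simps)
    qed
  qed
qed

lemma integrable_poly_gaussian: "integrable lborel (\<lambda>t. poly q (of_real t) * of_real (gaussian t) :: complex)"
proof -
  have "integrable lborel (\<lambda>t. \<Sum>k\<le>degree q. coeff q k * of_real (t ^ k * gaussian t))"
    by (intro Bochner_Integration.integrable_sum integrable_mult_right integrable_moment_complex)
  then show ?thesis by (simp add: poly_altdef sum_distrib_right mult.assoc)
qed

text \<open>
  That the degree is preserved exactly is essential below: a polynomial of smaller degree would
  be annihilated by the zeros of order \<open>r\<close> at the origin.
\<close>

lemma fourier_transform_poly_gaussian:
  fixes q :: "complex poly"
  assumes "degree q \<le> r" "coeff q r \<noteq> 0"
  obtains P :: "complex poly" where "degree P \<le> r" "coeff P r \<noteq> 0"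
    "\<And>y. fourier_transform (\<lambda>t. poly q (of_real t) * of_real (gaussian t)) y = poly P (of_real y) * of_real (gaussian y)"
proof -
  obtain P :: "nat \<Rightarrow> complex poly" where P: "\<And>k. degree (P k) \<le> k" "\<And>k. coeff (P k) k = (- \<i>) ^ k"
     "\<And>k y. fourier_transform (\<lambda>t. of_real (t ^ k * gaussian t)) y = poly (P k) (of_real y) * of_real (gaussian y)"
    using fourier_transform_moment by metis
  have q: "degree q = r" using assms le_degree by (metis antisym)
  show ?thesis
  proof
    let ?P = "\<Sum>k\<le>r. smult (coeff q k) (P k)"
    show "degree ?P \<le> r"
      by (intro degree_sum_le order_trans[OF degree_smult_le]) (auto intro: order_trans[OF P(1)])
    have "coeff ?P r = (\<Sum>k\<in>{r}. coeff q k * coeff (P k) r)"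
      unfolding coeff_sum coeff_smult
    proof (rule sum.mono_neutral_right)
      have "coeff (P i) r = 0" if "i \<in> {..r} - {r}" for i
        using P(1)[of i] that by (intro coeff_eq_0) auto
      then show "\<forall>i\<in>{..r} - {r}. coeff q i * coeff (P i) r = 0" by simp
    qed auto
    then show "coeff ?P r \<noteq> 0" using assms(2) P(2)[of r] by simp
    fix y
    have "fourier_transform (\<lambda>t. poly q (of_real t) * of_real (gaussian t)) y = 
      (LINT t|lborel. (\<Sum>k\<le>r. coeff q k * (of_real (t ^ k * gaussian t) * cis (- 2 * pi * y * t))))"
      unfolding fourier_transform_def poly_altdef q by (simp add: sum_distrib_right mult.assoc)
    also have "\<dots> = (\<Sum>k\<le>r. coeff q k * fourier_transform (\<lambda>t. of_real (t ^ k * gaussian t)) y)"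
      unfolding fourier_transform_def
      by (simp only: Bochner_Integration.integral_sum integrable_mult_right integrable_cis_mult[OF integrable_moment_complex] integral_mult_right_zero)
    finally show "fourier_transform (\<lambda>t. poly q (of_real t) * of_real (gaussian t)) y = poly ?P (of_real y) * of_real (gaussian y)"
      unfolding P(3) by (simp add: poly_sum sum_distrib_right mult.assoc)
  qed
qed

lemma fourier_transform_modulation:
  "fourier_transform (modulation \<xi> h) y = fourier_transform h (y - \<xi>)"
  unfolding fourier_transform_def modulation_def
proof (rule Bochner_Integration.integral_cong[OF refl])
  fix t
  have "cis (2 * pi * \<xi> * t) * cis (- 2 * pi * y * t) = cis (- 2 * pi * (y - \<xi>) * t)"
    unfolding cis_mult by (simp add: algebra_simps)
  then show "cis (2 * pi * \<xi> * t) * h t * cis (- 2 * pi * y * t) = h t * cis (- 2 * pi * (y - \<xi>) * t)"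
    by (metis mult.assoc mult.commute)
qed

section \<open>Hermite functions\<close>

lemma iterated_deriv_gaussian:
  "\<exists>u :: real poly. degree u \<le> r \<and> coeff u r = (- 4 * pi) ^ r \<and>
     (deriv ^^ r) (\<lambda>s::real. exp (- 2 * pi * s\<^sup>2)) = (\<lambda>s. poly u s * exp (- 2 * pi * s\<^sup>2))"
proof (induction r)
  case 0
  then show ?case by (intro exI[of _ 1]) simp
next
  case (Suc r)
  then obtain u :: "real poly" where u: "degree u \<le> r" "coeff u r = (- 4 * pi) ^ r" 
    "(deriv ^^ r) (\<lambda>s::real. exp (- 2 * pi * s\<^sup>2)) = (\<lambda>s. poly u s * exp (- 2 * pi * s\<^sup>2))" by blast
  let ?v = "pderiv u + smult (- 4 * pi) (pCons 0 u)"
  show ?case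
  proof (intro exI[of _ ?v] conjI)
    have "degree (pderiv u) \<le> Suc r" using u(1) by (simp add: degree_pderiv)
    moreover have "degree (smult (- 4 * pi) (pCons 0 u)) \<le> Suc r"
      using u(1) by (intro order_trans[OF degree_smult_le] order_trans[OF degree_pCons_le]) simp
    ultimately show "degree ?v \<le> Suc r" by (rule degree_add_le)
    have "coeff (pderiv u) (Suc r) = 0" using u(1) by (intro coeff_eq_0) (simp add: degree_pderiv)
    then show "coeff ?v (Suc r) = (- 4 * pi) ^ Suc r" using u(2) by simp
    have "((\<lambda>s. poly u s * exp (- 2 * pi * s\<^sup>2)) has_field_derivative poly ?v s * exp (- 2 * pi * s\<^sup>2)) (at s)" for s
    proof -
      have "((\<lambda>s. exp (- 2 * pi * s\<^sup>2)) has_field_derivative exp (- 2 * pi * s\<^sup>2) * (- 2 * pi * (2 * s))) (at s)"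
        by (auto intro!: derivative_eq_intros)
      from DERIV_mult[OF poly_DERIV this] show ?thesis by (simp add: algebra_simps)
    qed
    then show "(deriv ^^ Suc r) (\<lambda>s::real. exp (- 2 * pi * s\<^sup>2)) = (\<lambda>s. poly ?v s * exp (- 2 * pi * s\<^sup>2))"
      unfolding funpow.simps comp_def u(3) by (intro ext DERIV_imp_deriv)
  qed
qed

lemma poly_map_poly_of_real: "poly (map_poly of_real u) (of_real t :: complex) = of_real (poly u t)"
  by (induction u) (simp_all add: map_poly_pCons)

lemma hermite_unnormalized_eq:
  obtains u :: "real poly" where "degree u \<le> r" "coeff u r \<noteq> 0"
    "hermite_unnormalized r = (\<lambda>t. of_real (poly u t * gaussian t))"
proof -
  obtain u :: "real poly" where u: "degree u \<le> r" "coeff u r = (- 4 * pi) ^ r" 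
    "(deriv ^^ r) (\<lambda>s::real. exp (- 2 * pi * s\<^sup>2)) = (\<lambda>s. poly u s * exp (- 2 * pi * s\<^sup>2))" 
    using iterated_deriv_gaussian by blast
  have "exp (pi * t\<^sup>2) * (poly u t * exp (- 2 * pi * t\<^sup>2)) = poly u t * gaussian t" for t
  proof -
    have "pi * t\<^sup>2 + (- 2 * pi * t\<^sup>2) = - pi * t\<^sup>2" by simp
    then show ?thesis by (metis (no_types, lifting) exp_add gaussian_def mult.left_commute)
  qed
  then have "hermite_unnormalized r = (\<lambda>t. of_real (poly u t * gaussian t))"
    unfolding hermite_unnormalized_def[abs_def] u(3) by metis
  with u show ?thesis by (intro that) auto
qed

text \<open>
  This makes the normalizing constant of the Hermite functions nonzero.
\<close>

lemma L2_norm_poly_gaussian_pos: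
  fixes u :: "real poly"
  assumes "u \<noteq> 0"
  shows "L2_norm_on UNIV (\<lambda>t. of_real (poly u t * gaussian t)) > 0"
proof -
  define w where "w t = (poly u t * gaussian t)\<^sup>2" for t
  have "continuous_on UNIV w" unfolding w_def gaussian_def by (intro continuous_intros)
  then have wm [measurable]: "w \<in> borel_measurable borel" by (rule borel_measurable_continuous_onI)
  have wm': "w \<in> borel_measurable lborel" using wm by simp
  have i: "integrable lborel w"
  proof (rule Bochner_Integration.integrable_bound[OF integrable_poly_gaussian[of "map_poly of_real (u * u)"]])
    show "w \<in> borel_measurable lborel" by (rule wm')
    have "norm (w t) \<le> norm (poly (map_poly of_real (u * u)) (complex_of_real t) * complex_of_real (gaussian t))" for t
    proof -
      have g: "0 \<le> gaussian t" "gaussian t \<le> 1" by (auto simp: gaussian_def)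
      have "gaussian t * gaussian t \<le> gaussian t * 1" using g by (intro mult_left_mono) auto
      then have "(poly u t * poly u t) * (gaussian t * gaussian t) \<le> (poly u t * poly u t) * gaussian t"
        by (intro mult_left_mono) auto
      then show ?thesis using g unfolding poly_map_poly_of_real w_def by (simp add: norm_mult power2_eq_square abs_mult mult_ac)
    qed
    then show "AE t in lborel. norm (w t) \<le> norm (poly (map_poly of_real (u * u)) (complex_of_real t) * complex_of_real (gaussian t))" by simp
  qed
  have "integral\<^sup>L lborel w \<noteq> 0"
  proof
    assume "integral\<^sup>L lborel w = 0"
    then have "AE t in lborel. w t = 0"
      using integral_nonneg_eq_0_iff_AE[OF i] by (simp add: w_def)
    then have ae: "AE t in lborel. poly u t = 0" by (simp add: w_def gaussian_def)
    \<comment> \<open>A nonzero polynomial has only finitely many zeros.\<close>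
    have "finite {t. poly u t = 0}" by (rule poly_roots_finite[OF assms])
    then have "{t. poly u t = 0} \<in> null_sets lborel" by (rule finite_imp_null_set_lborel)
    from AE_not_in[OF this] ae have "AE t in lborel::real measure. False" by eventually_elim simp
    then obtain N where "N \<in> null_sets lborel" "(UNIV :: real set) \<subseteq> N" by (auto simp: eventually_ae_filter)
    then show False by (simp add: top.extremum_unique null_sets_def)
  qed
  moreover have "0 \<le> integral\<^sup>L lborel w" by (simp add: w_def)
  moreover have "L2_norm_on UNIV (\<lambda>t. of_real (poly u t * gaussian t)) = sqrt (integral\<^sup>L lborel w)"
    unfolding L2_norm_on_def set_lebesgue_integral_def
    using integral_completion[OF wm'] by (simp add: w_def[abs_def] norm_mult power_mult_distrib abs_mult)
  ultimately show ?thesis by simp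
qed

lemma hermite_fun_eq_poly_gaussian:
  obtains Q :: "complex poly" where "degree Q \<le> r" "coeff Q r \<noteq> 0"
    "hermite_fun r = (\<lambda>t. poly Q (of_real t) * of_real (gaussian t))"
proof -
  obtain u :: "real poly" where u: "degree u \<le> r" "coeff u r \<noteq> 0"
    "hermite_unnormalized r = (\<lambda>t. of_real (poly u t * gaussian t))" by (rule hermite_unnormalized_eq)
  have "u \<noteq> 0" using u(2) by auto
  then have c: "hermite_const r \<noteq> 0"
    using L2_norm_poly_gaussian_pos[of u] by (simp add: hermite_const_def u(3))
  let ?Q = "smult (of_real (hermite_const r)) (map_poly of_real u) :: complex poly"
  show ?thesis
  proof
    show "degree ?Q \<le> r" using u(1) c by (simp add: degree_map_poly)
    show "coeff ?Q r \<noteq> 0" using c u(2) by (simp add: coeff_map_poly)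
    show "hermite_fun r = (\<lambda>t. poly ?Q (of_real t) * of_real (gaussian t))"
      by (rule ext) (simp add: hermite_fun_def u(3) poly_map_poly_of_real)
  qed
qed

section \<open>Periodization\<close>

lemma cis_int_multiple: "cis (2 * pi * of_int m * of_int k) = 1"
  using cis_multiple_2pi[of "of_int (m * k)"] by (simp add: mult.assoc)

lemma lebesgue_on_01_integral:
  fixes F :: "real \<Rightarrow> complex"
  assumes [measurable]: "F \<in> borel_measurable borel"
  shows "(LINT t|lebesgue_on {0..1}. F t) = (LINT t|lborel. indicator {0..<1} t *\<^sub>R F t)"
proof -
  have "(LINT t|lebesgue_on {0..1}. F t) = (LINT t|lebesgue. indicator {0..1} t *\<^sub>R F t)"
    by (rule integral_restrict_space) simp
  also have "\<dots> = (LINT t|lborel. indicator {0..1} t *\<^sub>R F t)"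
    by (rule integral_completion) measurable
  also have "\<dots> = (LINT t|lborel. indicator {0..<1} t *\<^sub>R F t)"
  proof (rule integral_cong_AE)
    show "AE t in lborel. indicator {0..1} t *\<^sub>R F t = indicator {0..<1} t *\<^sub>R F t"
      using AE_lborel_singleton[of "1::real"] by eventually_elim (auto simp: indicator_def)
  qed measurable
  finally show ?thesis .
qed

context
  fixes g :: "real \<Rightarrow> complex" and C \<nu> :: real
  assumes cont: "continuous_on UNIV g" and int: "integrable lborel g"
    and decay: "\<And>t. cmod (g t) \<le> C * exp (- \<bar>t\<bar>)"
begin

lemma periodization_summable:
  obtains B where "\<And>t. (\<lambda>k::int. cmod (g (t - of_int k))) summable_on UNIV" "\<And>t. (\<Sum>\<^sub>\<infinity>k::int. cmod (g (t - of_int k))) \<le> B"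
proof -
  have "cmod (g 0) \<le> C" using decay[of 0] by simp
  then have C: "0 \<le> C" using norm_ge_zero[of "g 0"] by linarith
  obtain D where D: "0 < D" "\<And>x::real. (\<lambda>n::int. exp (- \<bar>x - 1 * of_int n\<bar>)) summable_on UNIV"
    "\<And>x::real. (\<Sum>\<^sub>\<infinity>n::int. exp (- \<bar>x - 1 * of_int n\<bar>)) \<le> D"
    using lattice_exp_sum[of 1] by auto
  have s: "(\<lambda>k::int. cmod (g (t - of_int k))) summable_on UNIV" for t
    by (rule summable_on_comparison_test[OF summable_on_cmult_right[OF D(2)[of t], of C]]) (use decay in auto)
  have "(\<Sum>\<^sub>\<infinity>k::int. cmod (g (t - of_int k))) \<le> C * D" for t
  proof -
    have "(\<Sum>\<^sub>\<infinity>k::int. cmod (g (t - of_int k))) \<le> (\<Sum>\<^sub>\<infinity>k::int. C * exp (- \<bar>t - 1 * of_int k\<bar>))"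
      by (rule infsum_mono[OF s summable_on_cmult_right[OF D(2)]]) (use decay in auto)
    also have "\<dots> = C * (\<Sum>\<^sub>\<infinity>k::int. exp (- \<bar>t - 1 * of_int k\<bar>))" by (rule infsum_cmult_right')
    also have "\<dots> \<le> C * D" by (rule mult_left_mono[OF D(3) C])
    finally show ?thesis .
  qed
  with s that show ?thesis by blast
qed

lemma periodization_has_sum:
  "((\<lambda>k::int. cis (2 * pi * of_int k * \<nu>) * g (t - of_int k)) has_sum periodization \<nu> g t) UNIV"
proof -
  obtain B where "(\<lambda>k::int. cmod (g (t - of_int k))) summable_on UNIV" using periodization_summable by metis
  then have "(\<lambda>k::int. cmod (cis (2 * pi * of_int k * \<nu>) * g (t - of_int k))) summable_on UNIV" by (simp add: norm_mult)
  then show ?thesis unfolding periodization_def by (rule has_sum_infsum[OF abs_summable_summable])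
qed

lemma periodization_bounded: obtains B where "\<And>t. cmod (periodization \<nu> g t) \<le> B"
proof -
  obtain B where B: "\<And>t. (\<lambda>k::int. cmod (g (t - of_int k))) summable_on UNIV" "\<And>t. (\<Sum>\<^sub>\<infinity>k::int. cmod (g (t - of_int k))) \<le> B"
    using periodization_summable by blast
  have "cmod (periodization \<nu> g t) \<le> B" for t
  proof -
    have "cmod (periodization \<nu> g t) \<le> (\<Sum>\<^sub>\<infinity>k::int. cmod (cis (2 * pi * of_int k * \<nu>) * g (t - of_int k)))"
      unfolding periodization_def by (rule norm_infsum_bound) (use B(1) in \<open>simp add: norm_mult\<close>)
    also have "\<dots> \<le> B" using B(2) by (simp add: norm_mult)
    finally show ?thesis .
  qed
  then show ?thesis using that by blast
qed

lemma periodization_borel: "periodization \<nu> g \<in> borel_measurable borel"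
proof (rule borel_measurable_LIMSEQ_metric)
  show "(\<lambda>N. \<Sum>k\<in>{-int N..int N}. cis (2 * pi * of_int k * \<nu>) * g (t - of_int k)) \<longlonglongrightarrow> periodization \<nu> g t" for t
    by (rule has_sum_int_LIMSEQ[OF periodization_has_sum])
  have "continuous_on UNIV (\<lambda>t. g (t - of_int k))" for k :: int
    by (rule continuous_on_compose2[OF cont]) (auto intro!: continuous_intros)
  then show "(\<lambda>t. \<Sum>k\<in>{-int N..int N}. cis (2 * pi * of_int k * \<nu>) * g (t - of_int k)) \<in> borel_measurable borel" for N
    by (intro borel_measurable_continuous_onI continuous_on_sum continuous_on_mult continuous_on_const)
qed

lemma periodization_shift: "periodization \<nu> g (t + of_int j) = cis (2 * pi * of_int j * \<nu>) * periodization \<nu> g t"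
proof -
  have "periodization \<nu> g (t + of_int j) = (\<Sum>\<^sub>\<infinity>k::int. cis (2 * pi * of_int j * \<nu>) * (cis (2 * pi * of_int k * \<nu>) * g (t - of_int k)))"
    unfolding periodization_def
  proof (rule infsum_reindex_bij_witness[where j = "\<lambda>k. k - j" and i = "\<lambda>k. k + j"])
    fix k
    have "cis (2 * pi * of_int j * \<nu>) * cis (2 * pi * of_int (k - j) * \<nu>) = cis (2 * pi * of_int k * \<nu>)"
      unfolding cis_mult by (simp add: algebra_simps)
    moreover have "t - of_int (k - j) = t + of_int j - of_int k" by simp
    ultimately show "cis (2 * pi * of_int j * \<nu>) * (cis (2 * pi * of_int (k - j) * \<nu>) * g (t - of_int (k - j))) = 
      cis (2 * pi * of_int k * \<nu>) * g (t + of_int j - of_int k)"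
      by (simp only: mult.assoc[symmetric])
  qed auto
  also have "\<dots> = cis (2 * pi * of_int j * \<nu>) * periodization \<nu> g t" unfolding periodization_def by (rule infsum_cmult_right')
  finally show ?thesis .
qed

lemma periodization_in_L2_nu: "periodization \<nu> g \<in> L2_nu \<nu>"
proof -
  obtain B where B: "\<And>t. cmod (periodization \<nu> g t) \<le> B" using periodization_bounded by blast
  have m: "periodization \<nu> g \<in> borel_measurable lebesgue"
    using periodization_borel by (intro measurable_completion) simp
  have "square_integrable (lebesgue_on {0..1}) (periodization \<nu> g)"
    by (rule square_integrable_bounded[OF measurable_restrict_space1[OF m] B])
  then have "set_integrable lebesgue {0..1} (\<lambda>t. (cmod (periodization \<nu> g t))\<^sup>2)"
    unfolding square_integrable_def set_integrable_def by (simp add: integrable_restrict_space)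
  then show ?thesis using m periodization_shift by (simp add: L2_nu_def)
qed

text \<open>
  Unfolding: the translates of the unit interval by integers tile the line, so the integral of the periodization
  against an exponential over the unit interval is an integral of \<open>g\<close> over the whole line. Both sides are compared
  along the symmetric partial sums, with dominated convergence on either side.
\<close>

lemma periodization_fourier_coeff:
  "l2_inner (lebesgue_on {0..1}) (periodization \<nu> g) (fourier_exp \<nu> m) = fourier_transform g (of_int m + \<nu>)"
proof -
  let ?p = "periodization \<nu> g"
  \<comment> \<open>Because \<open>m\<close> is an integer, each term of the periodization times \<open>cnj (fourier_exp \<nu> m t)\<close> is a translate of \<open>G\<close>.\<close>
  define G where "G t = g t * cis (- 2 * pi * (of_int m + \<nu>) * t)" for t
  have contG: "continuous_on UNIV G" unfolding G_def by (intro continuous_intros cont)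
  have Gm [measurable]: "G \<in> borel_measurable borel" by (rule borel_measurable_continuous_onI[OF contG])
  have intG: "integrable lborel G" unfolding G_def[abs_def] by (rule integrable_cis_mult[OF int])
  have normG: "cmod (G t) = cmod (g t)" for t by (simp add: G_def norm_mult)
  define H where "H N t = (\<Sum>k\<in>{-int N..int N}. G (t - of_int k))" for N :: nat and t :: real
  have Gshift: "cis (2 * pi * of_int k * \<nu>) * g (t - of_int k) * cnj (fourier_exp \<nu> m t) = G (t - of_int k)" for k t
  proof -
    have "G (t - of_int k) = g (t - of_int k) * (cis (2 * pi * of_int k * \<nu>) * cnj (fourier_exp \<nu> m t)) * cis (2 * pi * of_int m * of_int k)"
      unfolding mult.assoc unfolding G_def fourier_exp_def cis_cnj cis_mult by (simp add: algebra_simps)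
    then show ?thesis by (simp only: cis_int_multiple) (simp add: mult_ac)
  qed
  have "((\<lambda>k. G (t - of_int k)) has_sum (?p t * cnj (fourier_exp \<nu> m t))) UNIV" for t
    using has_sum_cmult_left[OF periodization_has_sum[of t], of "cnj (fourier_exp \<nu> m t)"] by (simp only: Gshift)
  then have lim: "(\<lambda>N. H N t) \<longlonglongrightarrow> ?p t * cnj (fourier_exp \<nu> m t)" for t
    unfolding H_def by (rule has_sum_int_LIMSEQ)
  obtain B where B: "\<And>t. (\<lambda>k::int. cmod (g (t - of_int k))) summable_on UNIV" "\<And>t. (\<Sum>\<^sub>\<infinity>k::int. cmod (g (t - of_int k))) \<le> B"
    using periodization_summable by blast
  have Hb: "cmod (H N t) \<le> B" for N t
  proof -
    have "cmod (H N t) \<le> (\<Sum>k\<in>{-int N..int N}. cmod (g (t - of_int k)))"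
      unfolding H_def by (intro sum_norm_le) (simp add: normG)
    also have "\<dots> \<le> (\<Sum>\<^sub>\<infinity>k::int. cmod (g (t - of_int k)))" by (rule finite_sum_le_infsum[OF B(1)]) auto
    finally show ?thesis using B(2)[of t] by linarith
  qed
  have Hm [measurable]: "H N \<in> borel_measurable borel" for N unfolding H_def[abs_def] by measurable
  have meas: "F \<in> borel_measurable (lebesgue_on {0..1})" if "F \<in> borel_measurable borel" for F :: "real \<Rightarrow> complex"
    using that by (intro measurable_restrict_space1 measurable_completion) simp
  have lim1: "(\<lambda>N. LINT t|lebesgue_on {0..1}. H N t) \<longlonglongrightarrow> (LINT t|lebesgue_on {0..1}. ?p t * cnj (fourier_exp \<nu> m t))"
  proof (rule integral_dominated_convergence[where w = "\<lambda>_. B"])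
    show "(\<lambda>t. ?p t * cnj (fourier_exp \<nu> m t)) \<in> borel_measurable (lebesgue_on {0..1})"
    proof (rule meas)
      have "fourier_exp \<nu> m \<in> borel_measurable borel"
        unfolding fourier_exp_def[abs_def] by (intro borel_measurable_continuous_onI continuous_intros)
      then show "(\<lambda>t. ?p t * cnj (fourier_exp \<nu> m t)) \<in> borel_measurable borel" using periodization_borel by measurable
    qed
    show "H N \<in> borel_measurable (lebesgue_on {0..1})" for N by (rule meas[OF Hm])
    show "AE t in lebesgue_on {0..1}. (\<lambda>N. H N t) \<longlonglongrightarrow> ?p t * cnj (fourier_exp \<nu> m t)" by (rule AE_I2[OF lim])
    show "AE t in lebesgue_on {0..1}. norm (H N t) \<le> B" for N by (rule AE_I2[OF Hb])
  qed simp
  \<comment> \<open>\<open>J N\<close> is the indicator of the union of the translates of \<open>{0..<1}\<close> that occur in the partial sum.\<close>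
  define J where "J N t = (\<Sum>k\<in>{-int N..int N}. indicator {0..<1} (t + of_int k) :: real)" for N :: nat and t :: real
  have J: "J N t = (if \<bar>\<lfloor>t\<rfloor>\<bar> \<le> int N then 1 else 0)" for N t
  proof -
    have *: "indicator {0..<1} (t + of_int k) = (if k = - \<lfloor>t\<rfloor> then 1 else (0::real))" for k
    proof -
      have "t + of_int k \<in> {0..<1} \<longleftrightarrow> \<lfloor>t\<rfloor> = - k" unfolding floor_eq_iff by auto
      then show ?thesis by (auto simp: indicator_def)
    qed
    show ?thesis unfolding J_def * by (auto simp: abs_le_iff)
  qed
  have HJ: "(LINT t|lebesgue_on {0..1}. H N t) = (LINT t|lborel. J N t *\<^sub>R G t)" for N
  proof -
    have i: "integrable lborel (\<lambda>t. indicator {0..<1} (t + of_int k) *\<^sub>R G t)" for k :: int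
      by (rule Bochner_Integration.integrable_bound[OF intG]) (auto simp: indicator_def)
    have tr: "(LINT t|lborel. indicator {0..<1} t *\<^sub>R G (t - of_int k)) = (LINT t|lborel. indicator {0..<1} (t + of_int k) *\<^sub>R G t)" for k :: int
      using lborel_integral_real_affine[of 1 "\<lambda>t. indicator {0..<1} t *\<^sub>R G (t - of_int k)" "of_int k"] by (simp add: add.commute)
    have i': "integrable lborel (\<lambda>t. indicator {0..<1} t *\<^sub>R G (t - of_int k))" for k :: int
      using lborel_integrable_real_affine[OF i[of k], of 1 "- of_int k"] by simp
    have "(LINT t|lebesgue_on {0..1}. H N t) = (LINT t|lborel. indicator {0..<1} t *\<^sub>R H N t)"
      by (rule lebesgue_on_01_integral[OF Hm])
    also have "\<dots> = (\<Sum>k\<in>{-int N..int N}. LINT t|lborel. indicator {0..<1} t *\<^sub>R G (t - of_int k))"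
      unfolding H_def scaleR_sum_right by (rule Bochner_Integration.integral_sum[OF i'])
    also have "\<dots> = (\<Sum>k\<in>{-int N..int N}. LINT t|lborel. indicator {0..<1} (t + of_int k) *\<^sub>R G t)" unfolding tr ..
    also have "\<dots> = (LINT t|lborel. J N t *\<^sub>R G t)"
      unfolding J_def scaleR_sum_left by (rule Bochner_Integration.integral_sum[symmetric, OF i])
    finally show ?thesis .
  qed
  have lim2: "(\<lambda>N. LINT t|lborel. J N t *\<^sub>R G t) \<longlonglongrightarrow> (LINT t|lborel. G t)"
  proof (rule integral_dominated_convergence[where w = "\<lambda>t. norm (G t)"])
    have "(\<lambda>N. J N t *\<^sub>R G t) \<longlonglongrightarrow> G t" for t
    proof (rule tendsto_eventually)
      show "eventually (\<lambda>N. J N t *\<^sub>R G t = G t) sequentially"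
        using eventually_ge_at_top[of "nat \<bar>\<lfloor>t\<rfloor>\<bar>"] by eventually_elim (auto simp: J)
    qed
    then show "AE t in lborel. (\<lambda>N. J N t *\<^sub>R G t) \<longlonglongrightarrow> G t" by simp
    show "AE t in lborel. norm (J N t *\<^sub>R G t) \<le> norm (G t)" for N by (auto simp: J)
    have "(\<lambda>t. J N t *\<^sub>R G t) \<in> borel_measurable borel" for N unfolding J_def by measurable
    then show "(\<lambda>t. J N t *\<^sub>R G t) \<in> borel_measurable lborel" for N by simp
    show "G \<in> borel_measurable lborel" using Gm by simp
    show "integrable lborel (\<lambda>t. norm (G t))" using intG by simp
  qed
  have "(LINT t|lebesgue_on {0..1}. ?p t * cnj (fourier_exp \<nu> m t)) = (LINT t|lborel. G t)"
    using lim1 lim2 unfolding HJ by (rule LIMSEQ_unique)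
  then show ?thesis unfolding l2_inner_def fourier_transform_def G_def .
qed

end

section \<open>The dual system\<close>

lemma exp_moment_poly:
  fixes R :: "complex poly"
  assumes "exp_summable d" "degree R \<le> r"
  shows "((\<lambda>n. of_real (d n) * poly R (of_int n) * of_real (exp (y * of_int n))) has_sum
    (\<Sum>k\<le>r. coeff R k * of_real (exp_moment d k y))) UNIV"
proof -
  have pR: "poly R x = (\<Sum>k\<le>r. coeff R k * x ^ k)" for x
    unfolding poly_altdef using assms(2) by (intro sum.mono_neutral_left) (auto simp: coeff_eq_0)
  have "((\<lambda>n. \<Sum>k\<le>r. coeff R k * of_real (d n * of_int n ^ k * exp (y * of_int n))) has_sum
    (\<Sum>k\<le>r. coeff R k * of_real (exp_moment d k y))) UNIV"
    by (intro has_sum_finite_sum has_sum_cmult_right has_sum_of_real exp_moment_has_sum assms finite_atMost)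
  also have "(\<lambda>n. \<Sum>k\<le>r. coeff R k * of_real (d n * of_int n ^ k * exp (y * of_int n))) =
     (\<lambda>n. of_real (d n) * poly R (of_int n) * of_real (exp (y * of_int n)))"
    by (simp add: fun_eq_iff pR sum_distrib_left sum_distrib_right mult_ac)
  finally show ?thesis .
qed

text \<open>
  After the Gaussians have been multiplied out, the sum is a combination of the derivatives up to order \<open>r\<close> at
  \<open>2 * pi * \<beta> * l\<close> of the function with coefficients \<open>d\<close>. All of them vanish for \<open>l \<noteq> 0\<close>, and for
  \<open>l = 0\<close> only the \<open>r\<close>-th one survives; \<open>\<kappa>\<close> is what remains.
\<close>

lemma dual_kernel_at:
  fixes P :: "complex poly"
  assumes P: "degree P \<le> r" "coeff P r \<noteq> 0" and b: "0 < \<beta>"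
  defines "d \<equiv> dual_seq (2 * pi * \<beta>) r"
  defines "\<kappa> \<equiv> coeff P r * of_real ((- \<beta>) ^ r * exp_moment d r 0)"
  shows "((\<lambda>n. (of_real (d n * exp (pi * \<beta>\<^sup>2 * (of_int n)\<^sup>2 - 2 * pi * \<beta> * of_int n * \<sigma> + pi * \<sigma>\<^sup>2)) / \<kappa>) *
       (poly P (of_real (\<sigma> + of_int l - \<beta> * of_int n)) * of_real (gaussian (\<sigma> + of_int l - \<beta> * of_int n)))) has_sum (if l = 0 then 1 else 0)) UNIV"
    and "\<kappa> \<noteq> 0"
proof -
  define a where "a = 2 * pi * \<beta>"
  have a: "a > 0" using b by (simp add: a_def)
  have d: "d = dual_seq a r" by (simp add: d_def a_def)
  have sd: "exp_summable d" unfolding d by (rule exp_growth_imp_summable[OF dual_seq_growth[OF a]])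
  have D: "exp_moment d r 0 \<noteq> 0" "\<And>k. k < r \<Longrightarrow> exp_moment d k 0 = 0"
    using dual_seq_exact_order[OF a, of r] by (auto simp: d zero_order_ge_def)
  have Z: "exp_moment d k (a * of_int l) = 0" if "k \<le> r" "l \<noteq> 0" for k
    using dual_seq_zero[OF a that(2), of r] that(1) by (auto simp: d zero_order_ge_def)
  show \<kappa>: "\<kappa> \<noteq> 0" using P(2) D(1) b by (simp add: \<kappa>_def)
  have degP: "degree P = r" using P le_degree by (metis antisym)
  \<comment> \<open>As a function of \<open>n\<close>, the polynomial factor is \<open>R\<close>; only its leading coefficient survives the summation.\<close>
  define x where "x = \<sigma> + of_int l"
  define R where "R = pcompose P [:of_real x, - of_real \<beta>:]"
  have degR: "degree R \<le> r" using degP b by (simp add: R_def degree_pcompose)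
  have "lead_coeff R = lead_coeff P * (- of_real \<beta>) ^ r"
    unfolding R_def using b degP by (subst lead_coeff_comp) auto
  moreover have "degree R = r" using degP b by (simp add: R_def degree_pcompose)
  ultimately have R: "coeff R r = coeff P r * (- of_real \<beta>) ^ r" using degP by simp
  have poly_R: "poly R (of_int n) = poly P (of_real (x - \<beta> * of_int n))" for n
    by (simp add: R_def poly_pcompose algebra_simps)
  have sum_eq: "(\<Sum>k\<le>r. coeff R k * of_real (exp_moment d k (a * of_int l))) = (if l = 0 then \<kappa> else 0)"
  proof (cases "l = 0")
    case True
    have "(\<Sum>k\<le>r. coeff R k * of_real (exp_moment d k 0)) = (\<Sum>k\<in>{r}. coeff R k * of_real (exp_moment d k 0))"
      using D(2) by (intro sum.mono_neutral_right) auto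
    then show ?thesis using True by (simp add: R \<kappa>_def)
  qed (simp add: Z)
  define A where "A = exp (pi * \<sigma>\<^sup>2 - pi * x\<^sup>2)"
  have "((\<lambda>n. (of_real A / \<kappa>) * (of_real (d n) * poly R (of_int n) * of_real (exp (a * of_int l * of_int n)))) has_sum
     ((of_real A / \<kappa>) * (if l = 0 then \<kappa> else 0))) UNIV"
    unfolding sum_eq[symmetric] by (intro has_sum_cmult_right exp_moment_poly sd degR)
  also have "(of_real A / \<kappa>) * (if l = 0 then \<kappa> else 0) = (if l = 0 then 1 else 0)"
    using \<kappa> by (simp add: A_def x_def)
  also have "(\<lambda>n. (of_real A / \<kappa>) * (of_real (d n) * poly R (of_int n) * of_real (exp (a * of_int l * of_int n)))) = 
    (\<lambda>n. (of_real (d n * exp (pi * \<beta>\<^sup>2 * (of_int n)\<^sup>2 - 2 * pi * \<beta> * of_int n * \<sigma> + pi * \<sigma>\<^sup>2)) / \<kappa>) *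
       (poly P (of_real (\<sigma> + of_int l - \<beta> * of_int n)) * of_real (gaussian (\<sigma> + of_int l - \<beta> * of_int n))))"
  proof
    fix n :: int
    \<comment> \<open>The terms quadratic in \<open>n\<close> cancel against those of the Gaussian, which leaves the exponential \<open>exp (a * l * n)\<close>.\<close>
    have "A * exp (a * of_int l * of_int n) = exp (pi * \<beta>\<^sup>2 * (of_int n)\<^sup>2 - 2 * pi * \<beta> * of_int n * \<sigma> + pi * \<sigma>\<^sup>2) * gaussian (x - \<beta> * of_int n)"
      unfolding A_def gaussian_def x_def a_def exp_add[symmetric] by (simp add: power2_eq_square algebra_simps)
    then have "complex_of_real A * of_real (exp (a * of_int l * of_int n)) = of_real (exp (pi * \<beta>\<^sup>2 * (of_int n)\<^sup>2 - 2 * pi * \<beta> * of_int n * \<sigma> + pi * \<sigma>\<^sup>2)) * of_real (gaussian (x - \<beta> * of_int n))"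
      by (simp only: of_real_mult[symmetric])
    then have "(complex_of_real A * of_real (exp (a * of_int l * of_int n))) * (of_real (d n) * poly R (of_int n)) / \<kappa> = (of_real (exp (pi * \<beta>\<^sup>2 * (of_int n)\<^sup>2 - 2 * pi * \<beta> * of_int n * \<sigma> + pi * \<sigma>\<^sup>2)) * of_real (gaussian (x - \<beta> * of_int n))) * (of_real (d n) * poly R (of_int n)) / \<kappa>"
      by (simp only:)
    then show "(of_real A / \<kappa>) * (of_real (d n) * poly R (of_int n) * of_real (exp (a * of_int l * of_int n))) = 
      (of_real (d n * exp (pi * \<beta>\<^sup>2 * (of_int n)\<^sup>2 - 2 * pi * \<beta> * of_int n * \<sigma> + pi * \<sigma>\<^sup>2)) / \<kappa>) *
       (poly P (of_real (\<sigma> + of_int l - \<beta> * of_int n)) * of_real (gaussian (\<sigma> + of_int l - \<beta> * of_int n)))"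
      unfolding poly_R x_def[symmetric] of_real_mult by (simp only: times_divide_eq_left times_divide_eq_right mult_ac)
  qed
  finally show "((\<lambda>n. (of_real (d n * exp (pi * \<beta>\<^sup>2 * (of_int n)\<^sup>2 - 2 * pi * \<beta> * of_int n * \<sigma> + pi * \<sigma>\<^sup>2)) / \<kappa>) *
       (poly P (of_real (\<sigma> + of_int l - \<beta> * of_int n)) * of_real (gaussian (\<sigma> + of_int l - \<beta> * of_int n)))) has_sum (if l = 0 then 1 else 0)) UNIV" .
qed

text \<open>
  The Gaussian growth \<open>exp (pi * \<beta>\<^sup>2 * n\<^sup>2)\<close> of the correcting factor competes with the decay
  \<open>exp (- pi * \<beta> * n\<^sup>2 / (r + 1))\<close> of the coefficients, and the latter wins precisely for
  \<open>\<beta> < 1 / (r + 1)\<close>.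
\<close>

lemma dual_kernel:
  fixes P :: "complex poly"
  assumes P: "degree P \<le> r" "coeff P r \<noteq> 0" and b: "0 < \<beta>" "\<beta> < 1 / (real r + 1)"
  defines "\<phi> \<equiv> \<lambda>y. poly P (of_real y) * of_real (gaussian y)"
  obtains C and B :: "real \<Rightarrow> int \<Rightarrow> complex" where "0 \<le> C" 
    "\<And>\<tau> n. cmod (B \<tau> n) \<le> C * exp (- \<bar>\<tau> - \<beta> * of_int n\<bar>)"
    "\<And>\<tau> l. ((\<lambda>n. B \<tau> n * \<phi> (\<tau> + of_int l - \<beta> * of_int n)) has_sum (if l = 0 then 1 else 0)) UNIV"
proof -
  define a where "a = 2 * pi * \<beta>"
  have a: "a > 0" using b by (simp add: a_def)
  define d where "d = dual_seq a r"
  define \<kappa> where "\<kappa> = coeff P r * of_real ((- \<beta>) ^ r * exp_moment d r 0)"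
  define E where "E \<sigma> n = pi * \<beta>\<^sup>2 * (of_int n)\<^sup>2 - a * of_int n * \<sigma> + pi * \<sigma>\<^sup>2" for \<sigma> and n :: int
  note dual = dual_kernel_at[OF P b(1), folded a_def, folded d_def, folded \<kappa>_def, folded E_def]
  obtain C K where C: "0 \<le> C" "0 \<le> K" "\<And>n. \<bar>d n\<bar> \<le> C * exp (- a * (of_int n)\<^sup>2 / (2 * real (r + 1)) + K * \<bar>of_int n\<bar>)"
    using dual_seq_decay[OF a, of r] unfolding d_def by blast
  \<comment> \<open>Translating \<open>n\<close> reduces \<open>\<tau>\<close> to its residue in \<open>[0, \<beta>)\<close>, so that all constants are uniform in \<open>\<tau>\<close>.\<close>
  define s where "s \<tau> = \<tau> - \<beta> * of_int \<lfloor>\<tau> / \<beta>\<rfloor>" for \<tau>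
  have s: "0 \<le> s \<tau>" "s \<tau> \<le> \<beta>" for \<tau>
  proof -
    define k where "k = \<lfloor>\<tau> / \<beta>\<rfloor>"
    have "of_int k \<le> \<tau> / \<beta>" "\<tau> / \<beta> < of_int k + 1" by (auto simp: k_def)
    then show "0 \<le> s \<tau>" "s \<tau> \<le> \<beta>" using b(1) by (auto simp: s_def field_simps simp flip: k_def)
  qed
  \<comment> \<open>The surplus of Gaussian decay; this is where \<open>\<beta> < 1 / (r + 1)\<close> enters.\<close>
  define \<delta> where "\<delta> = pi * \<beta> * (1 / (real r + 1) - \<beta>)"
  have \<delta>: "\<delta> > 0" using b by (simp add: \<delta>_def)
  define L where "L = K + 2 * pi * \<beta>\<^sup>2 + \<beta>"
  define C' where "C' = C / cmod \<kappa> * exp (L\<^sup>2 / (4 * \<delta>) + pi * \<beta>\<^sup>2 + \<beta>)"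
  have bound: "cmod (of_real (d n * exp (E \<sigma> n)) / \<kappa>) \<le> C' * exp (- \<bar>\<sigma> - \<beta> * of_int n\<bar>)"
    if \<sigma>: "0 \<le> \<sigma>" "\<sigma> \<le> \<beta>" for \<sigma> and n :: int
  proof -
    define m :: real where "m = \<bar>of_int n\<bar>"
    have m: "(of_int n)\<^sup>2 = m\<^sup>2" "0 \<le> m" by (auto simp: m_def)
    have "(pi * \<beta>) * (- (of_int n * \<sigma>)) \<le> (pi * \<beta>) * (m * \<beta>)"
    proof (rule mult_left_mono)
      have "- (of_int n * \<sigma>) \<le> m * \<sigma>" using \<sigma>(1) by (auto simp: m_def abs_if mult_right_mono)
      also have "\<dots> \<le> m * \<beta>" using m(2) \<sigma>(2) by (intro mult_left_mono)
      finally show "- (of_int n * \<sigma>) \<le> m * \<beta>" .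
    qed (use b in simp)
    moreover have "pi * \<sigma>\<^sup>2 \<le> pi * \<beta>\<^sup>2" using \<sigma> by (intro mult_left_mono power_mono) auto
    moreover have "E \<sigma> n = pi * \<beta>\<^sup>2 * m\<^sup>2 + 2 * ((pi * \<beta>) * (- (of_int n * \<sigma>))) + pi * \<sigma>\<^sup>2"
      unfolding E_def a_def m(1) by (simp add: algebra_simps)
    moreover have "2 * ((pi * \<beta>) * (m * \<beta>)) = 2 * pi * \<beta>\<^sup>2 * m" by (simp add: power2_eq_square)
    ultimately have E: "E \<sigma> n \<le> pi * \<beta>\<^sup>2 * m\<^sup>2 + 2 * pi * \<beta>\<^sup>2 * m + pi * \<beta>\<^sup>2" by linarith
    have dm: "\<bar>\<sigma> - \<beta> * of_int n\<bar> \<le> \<beta> + \<beta> * m"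
      using \<sigma> b(1) abs_triangle_ineq4[of \<sigma> "\<beta> * of_int n"] by (simp add: m_def abs_mult)
    have "0 \<le> (2 * \<delta> * m - L)\<^sup>2 / (4 * \<delta>)" using \<delta> by simp
    also have "\<dots> = \<delta> * m\<^sup>2 - L * m + L\<^sup>2 / (4 * \<delta>)" using \<delta> by (simp add: power2_eq_square field_simps)
    finally have sq: "- \<delta> * m\<^sup>2 + L * m \<le> L\<^sup>2 / (4 * \<delta>)" by simp
    have e1: "- a * (of_int n)\<^sup>2 / (2 * real (r + 1)) = - \<delta> * m\<^sup>2 - pi * \<beta>\<^sup>2 * m\<^sup>2"
      unfolding m(1) \<delta>_def a_def by (simp add: power2_eq_square field_simps)
    have e2: "L * m = K * m + 2 * pi * \<beta>\<^sup>2 * m + \<beta> * m" by (simp add: L_def algebra_simps)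
    have ex: "(- a * (of_int n)\<^sup>2 / (2 * real (r + 1)) + K * m) + E \<sigma> n \<le> (L\<^sup>2 / (4 * \<delta>) + pi * \<beta>\<^sup>2 + \<beta>) - \<bar>\<sigma> - \<beta> * of_int n\<bar>"
      using E dm sq unfolding e1 e2 by linarith
    have "cmod (of_real (d n * exp (E \<sigma> n)) / \<kappa>) = \<bar>d n\<bar> * exp (E \<sigma> n) / cmod \<kappa>"
      by (simp add: norm_divide norm_mult abs_mult)
    also have "\<dots> \<le> (C * exp (- a * (of_int n)\<^sup>2 / (2 * real (r + 1)) + K * m)) * exp (E \<sigma> n) / cmod \<kappa>"
      using C(3)[of n] by (intro divide_right_mono mult_right_mono) (auto simp: m_def)
    also have "\<dots> = C / cmod \<kappa> * exp ((- a * (of_int n)\<^sup>2 / (2 * real (r + 1)) + K * m) + E \<sigma> n)"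
      by (simp only: exp_add) simp
    also have "\<dots> \<le> C / cmod \<kappa> * exp ((L\<^sup>2 / (4 * \<delta>) + pi * \<beta>\<^sup>2 + \<beta>) - \<bar>\<sigma> - \<beta> * of_int n\<bar>)"
      using C(1) ex by (intro mult_left_mono) auto
    also have "\<dots> = C' * exp (- \<bar>\<sigma> - \<beta> * of_int n\<bar>)" by (simp only: C'_def diff_conv_add_uminus exp_add mult.assoc)
    finally show ?thesis .
  qed
  define B where "B \<tau> n = of_real (d (n - \<lfloor>\<tau> / \<beta>\<rfloor>) * exp (E (s \<tau>) (n - \<lfloor>\<tau> / \<beta>\<rfloor>))) / \<kappa>" for \<tau> and n :: int
  have shift: "s \<tau> + x - \<beta> * of_int (n - \<lfloor>\<tau> / \<beta>\<rfloor>) = \<tau> + x - \<beta> * of_int n" for \<tau> x and n :: int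
    by (simp add: s_def algebra_simps)
  show ?thesis
  proof
    show "0 \<le> C'" using C(1) by (simp add: C'_def)
    show "cmod (B \<tau> n) \<le> C' * exp (- \<bar>\<tau> - \<beta> * of_int n\<bar>)" for \<tau> n
      using bound[OF s(1)[of \<tau>] s(2)[of \<tau>], of "n - \<lfloor>\<tau> / \<beta>\<rfloor>"] shift[where \<tau> = \<tau> and x = 0 and n = n] by (simp add: B_def)
    show "((\<lambda>n. B \<tau> n * \<phi> (\<tau> + of_int l - \<beta> * of_int n)) has_sum (if l = 0 then 1 else 0)) UNIV" for \<tau> l
      using dual(1)[of "s \<tau>" l] unfolding B_def \<phi>_def
      by (subst has_sum_reindex_bij_witness[where j = "\<lambda>n. n - \<lfloor>\<tau> / \<beta>\<rfloor>" and i = "\<lambda>n. n + \<lfloor>\<tau> / \<beta>\<rfloor>" and T = UNIV and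
           h = "\<lambda>n. (of_real (d n * exp (E (s \<tau>) n)) / \<kappa>) * (poly P (of_real (s \<tau> + of_int l - \<beta> * of_int n)) * of_real (gaussian (s \<tau> + of_int l - \<beta> * of_int n)))"])
        (simp_all only: shift diff_add_cancel add_diff_cancel UNIV_I)
  qed
qed

section \<open>The frame property\<close>

lemma L2_nu_square_integrable:
  assumes "f \<in> L2_nu \<nu>" shows "square_integrable (lebesgue_on {0..1}) f"
proof -
  have "f \<in> borel_measurable lebesgue" "set_integrable lebesgue {0..1} (\<lambda>t. (cmod (f t))\<^sup>2)"
    using assms by (simp_all add: L2_nu_def)
  then show ?thesis
    unfolding square_integrable_def set_integrable_def by (simp add: integrable_restrict_space measurable_restrict_space1)
qed

lemma inner_01_eq: "inner_01 f g = l2_inner (lebesgue_on {0..1}) f g"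
  by (simp add: inner_01_def l2_inner_def set_lebesgue_integral_def integral_restrict_space)

lemma L2_norm_on_01_eq: "(L2_norm_on {0..1} f)\<^sup>2 = l2_norm2 (lebesgue_on {0..1}) f"
proof -
  have "l2_norm2 (lebesgue_on {0..1}) f = (LINT t:{0..1}|lebesgue. (cmod (f t))\<^sup>2)"
    by (simp add: l2_norm2_def set_lebesgue_integral_def integral_restrict_space)
  then show ?thesis using l2_norm2_nonneg[of "lebesgue_on {0..1}" f] by (simp add: L2_norm_on_def)
qed

theorem theorem1:
  fixes \<nu> \<beta> :: real and r :: nat
  assumes "\<beta> > 0" and "\<beta> < 1 / (real r + 1)"
  shows "is_gabor_frame \<nu> (hermite_fun r) \<beta>"
proof -
  obtain Q :: "complex poly" where Q: "degree Q \<le> r" "coeff Q r \<noteq> 0"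
    "hermite_fun r = (\<lambda>t. poly Q (of_real t) * of_real (gaussian t))" by (rule hermite_fun_eq_poly_gaussian)
  obtain P :: "complex poly" where P: "degree P \<le> r" "coeff P r \<noteq> 0"
    "\<And>y. fourier_transform (hermite_fun r) y = poly P (of_real y) * of_real (gaussian y)"
    using fourier_transform_poly_gaussian[OF Q(1,2)] unfolding Q(3) by metis
  define \<phi> where "\<phi> = (\<lambda>y. poly P (of_real y) * complex_of_real (gaussian y))"
  obtain C1 where C1: "0 < C1" "\<And>y. cmod (\<phi> y) \<le> C1 * exp (- \<bar>y\<bar>)"
    using poly_gaussian_le[of P] unfolding \<phi>_def by metis
  obtain C2 and B :: "real \<Rightarrow> int \<Rightarrow> complex" where C2: "0 \<le> C2" "\<And>\<tau> n. cmod (B \<tau> n) \<le> C2 * exp (- \<bar>\<tau> - \<beta> * of_int n\<bar>)"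
    and B': "\<And>\<tau> l. ((\<lambda>n. B \<tau> n * (poly P (of_real (\<tau> + of_int l - \<beta> * of_int n)) * of_real (gaussian (\<tau> + of_int l - \<beta> * of_int n)))) has_sum (if l = 0 then 1 else 0)) UNIV"
    by (rule dual_kernel[OF P(1,2) assms]) blast
  have B: "((\<lambda>n. B \<tau> n * \<phi> (\<tau> + of_int l - \<beta> * of_int n)) has_sum (if l = 0 then 1 else 0)) UNIV" for \<tau> l
    unfolding \<phi>_def by (rule B')
  \<comment> \<open>The common majorant of both matrices; its row and column sums are sums over shifted lattices.\<close>
  define W where "W m n = exp (- \<bar>(of_int m + \<nu>) - \<beta> * of_int n\<bar>)" for m n :: int
  obtain S1 where S1: "0 < S1" "\<And>m. (\<lambda>n. W m n) summable_on UNIV" "\<And>m. (\<Sum>\<^sub>\<infinity>n. W m n) \<le> S1"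
    unfolding W_def by (rule lattice_exp_sum[OF assms(1)]) blast
  obtain S2' where S2': "0 < S2'" "\<And>x::real. (\<lambda>m::int. exp (- \<bar>x - 1 * of_int m\<bar>)) summable_on UNIV"
    "\<And>x::real. (\<Sum>\<^sub>\<infinity>m::int. exp (- \<bar>x - 1 * of_int m\<bar>)) \<le> S2'"
    by (rule lattice_exp_sum[of 1]) simp_all
  have W': "W m n = exp (- \<bar>(\<beta> * of_int n - \<nu>) - 1 * of_int m\<bar>)" for m n by (simp add: W_def abs_minus_commute algebra_simps)
  have S2: "(\<lambda>m. W m n) summable_on UNIV" "(\<Sum>\<^sub>\<infinity>m. W m n) \<le> S2'" for n
    unfolding W' by (rule S2'(2), rule S2'(3))
  define T where "T n m = cnj (\<phi> (of_int m + \<nu> - \<beta> * of_int n))" for n m :: int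
  define T' where "T' m n = cnj (B (of_int m + \<nu>) n)" for m n :: int
  have T: "cmod (T n m) \<le> C1 * W m n" for n m unfolding T_def W_def complex_mod_cnj by (rule C1(2))
  have T': "cmod (T' m n) \<le> C2 * W m n" for m n unfolding T'_def W_def complex_mod_cnj by (rule C2(2))
  have TT: "((\<lambda>n. T' m n * T n m') has_sum (if m = m' then 1 else 0)) UNIV" for m m'
  proof -
    have "((\<lambda>n. cnj (B (of_int m + \<nu>) n * \<phi> (of_int m + \<nu> + of_int (m' - m) - \<beta> * of_int n))) has_sum cnj (if m' - m = 0 then 1 else 0)) UNIV"
      using B[of "of_int m + \<nu>" "m' - m"] by (subst has_sum_cnj_iff)
    then show ?thesis by (cases "m = m'") (simp_all add: T_def T'_def algebra_simps)
  qed
  define h where "h n = modulation (\<beta> * of_int n) (hermite_fun r)" for n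
  have h_cont: "continuous_on UNIV (h n)" for n
    unfolding h_def modulation_def Q(3) gaussian_def by (intro continuous_intros)
  have h_int: "integrable lborel (h n)" for n
    using integrable_cis_mult[OF integrable_poly_gaussian[of Q], of "2 * pi * (\<beta> * of_int n)"] by (simp add: h_def modulation_def[abs_def] Q(3) mult_ac)
  obtain C0 where C0: "\<And>t. cmod (hermite_fun r t) \<le> C0 * exp (- \<bar>t\<bar>)"
    using poly_gaussian_le[of Q] unfolding Q(3) by metis
  have h_decay: "cmod (h n t) \<le> C0 * exp (- \<bar>t\<bar>)" for n t using C0[of t] by (simp add: h_def modulation_def norm_mult)
  have sys: "gabor_system \<nu> (hermite_fun r) \<beta> n = periodization \<nu> (h n)" for n by (simp add: gabor_system_def h_def)
  have mem: "gabor_system \<nu> (hermite_fun r) \<beta> n \<in> L2_nu \<nu>" for n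
    unfolding sys by (rule periodization_in_L2_nu[OF h_cont h_int h_decay])
  have coeff: "cnj (l2_inner (lebesgue_on {0..1}) (gabor_system \<nu> (hermite_fun r) \<beta> n) (fourier_exp \<nu> m)) = T n m" for n m
    unfolding sys periodization_fourier_coeff[OF h_cont h_int h_decay] T_def
    by (simp add: h_def fourier_transform_modulation P(3) \<phi>_def)
  have main: "(\<lambda>n. (cmod (inner_01 f (gabor_system \<nu> (hermite_fun r) \<beta> n)))\<^sup>2) summable_on UNIV \<and>
     (L2_norm_on {0..1} f)\<^sup>2 \<le> (C2 * S1) * (C2 * S2') * (\<Sum>\<^sub>\<infinity>n. (cmod (inner_01 f (gabor_system \<nu> (hermite_fun r) \<beta> n)))\<^sup>2) \<and>
     (\<Sum>\<^sub>\<infinity>n. (cmod (inner_01 f (gabor_system \<nu> (hermite_fun r) \<beta> n)))\<^sup>2) \<le> (C1 * S2') * (C1 * S1) * (L2_norm_on {0..1} f)\<^sup>2"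
    if f: "f \<in> L2_nu \<nu>" for f
  proof -
    define c where "c m = l2_inner (lebesgue_on {0..1}) f (fourier_exp \<nu> m)" for m
    define F where "F n = inner_01 f (gabor_system \<nu> (hermite_fun r) \<beta> n)" for n
    note sf = L2_nu_square_integrable[OF f]
    have c: "((\<lambda>m. (cmod (c m))\<^sup>2) has_sum (L2_norm_on {0..1} f)\<^sup>2) UNIV"
      unfolding c_def L2_norm_on_01_eq by (rule Parseval_fourier_exp[OF sf])
    have F: "F n = (\<Sum>\<^sub>\<infinity>m. T n m * c m)" for n
      using Parseval_fourier_exp_inner[OF sf L2_nu_square_integrable[OF mem], of \<nu> n]
      unfolding coeff c_def[symmetric] F_def inner_01_eq by (simp add: mult.commute infsumI)
    have C1': "0 \<le> C1" and W0: "\<And>m n. 0 \<le> W m n" using C1(1) by (auto simp: W_def)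
    note bounds = Schur_left_inverse_bounds[where W = W and T = T and T' = T' and c = c and F = F,
      OF W0 S1(2,3) S2 C1' T C2(1) T' TT has_sum_imp_summable[OF c] F]
    show ?thesis using bounds infsumI[OF c] by (simp add: F_def)
  qed
  show ?thesis unfolding is_gabor_frame_def
  proof (intro conjI allI mem exI ballI)
    \<comment> \<open>Adding 1 keeps the constant positive without knowing that \<open>C2 > 0\<close>.\<close>
    let ?q = "(C2 * S1) * (C2 * S2') + 1"
    have q: "?q > 0" using C2(1) S1(1) S2'(1) by (intro add_nonneg_pos) auto
    show "0 < 1 / ?q" using q by simp
    show "0 < (C1 * S2') * (C1 * S1)" using C1(1) S1(1) S2'(1) by simp
    fix f assume f: "f \<in> L2_nu \<nu>"
    let ?s = "\<Sum>\<^sub>\<infinity>n. (cmod (inner_01 f (gabor_system \<nu> (hermite_fun r) \<beta> n)))\<^sup>2"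
    show "(\<lambda>n. (cmod (inner_01 f (gabor_system \<nu> (hermite_fun r) \<beta> n)))\<^sup>2) summable_on UNIV" using main[OF f] by blast
    show "?s \<le> (C1 * S2') * (C1 * S1) * (L2_norm_on {0..1} f)\<^sup>2" using main[OF f] by blast
    have "0 \<le> ?s" by (intro infsum_nonneg) auto
    then have "(L2_norm_on {0..1} f)\<^sup>2 \<le> ?q * ?s" using conjunct1[OF conjunct2[OF main[OF f]]] by (simp add: distrib_right)
    then show "1 / ?q * (L2_norm_on {0..1} f)\<^sup>2 \<le> ?s" using q by (simp add: pos_divide_le_eq mult.commute)
  qed
qed

end
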